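(* Let $\mathbf{k}$ be a field, $U$ a $2$-dimensional $\mathbf{k}$-vector space with basis $\{1,x\}$, and $n\ge m\ge 1$ integers. Let $$\alpha\colon \mathrm{D}^m(\mathrm{Sym}^{n-m}U)\to\bigwedge^m(\mathrm{Sym}^{n-1}U),\quad \beta\colon \bigwedge^m(\mathrm{Sym}^{n-1}U)\to \mathrm{Sym}^{n-m}(\mathrm{D}^mU),\quad \gamma\colon \mathrm{D}^m(\mathrm{Sym}^{n-m}U)\to\mathrm{Sym}^{n-m}(\mathrm{D}^mU)$$ be the maps defined in the context ($\beta$ and $\gamma$ being the Hermite reciprocity isomorphisms). Then $\alpha$ is an isomorphism, and $\beta\circ\alpha=\gamma$.
   Context: $\mathrm{D}^m V\subset V^{\otimes m}$ is the $m$-th divided power (symmetric tensors). $\mathrm{Sym}^dU$ has basis $1,x,\dots,x^d$. For vector spaces $A,B$ there are canonical maps $\mathrm{D}^m A\otimes \bigwedge^m B\to\bigwedge^m(A\otimes B)$, $\big(\sum_\alpha a_{\alpha_1}\otimes\cdots\otimes a_{\alpha_m}\big)\otimes (b_1\wedge\cdots\wedge b_m)\mapsto \sum_\alpha (a_{\alpha_1}\otimes b_1)\wedge\cdots\wedge(a_{\alpha_m}\otimes b_m)$, and $\mathrm{D}^m A\otimes \mathrm{D}^m B\to \mathrm{D}^m(A\otimes B)$ (tensor symmetric tensors factor by factor). Definition of $\alpha$: the composition $\mathrm{D}^m(\mathrm{Sym}^{n-m}U)\cong \mathrm{D}^m(\mathrm{Sym}^{n-m}U)\otimes\bigwedge^m(\mathrm{Sym}^{m-1}U)\to\bigwedge^m(\mathrm{Sym}^{n-m}U\otimes\mathrm{Sym}^{m-1}U)\to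 \bigwedge^m(\mathrm{Sym}^{n-1}U)$, where the first isomorphism uses $\mathbf{k}\cong\bigwedge^m(\mathrm{Sym}^{m-1}U)$, $1\mapsto x^{m-1}\wedge\cdots\wedge x\wedge1$, the second is the canonical map above, and the third is $\bigwedge^m$ of multiplication. Definition of $\beta,\gamma$: taking $A=U$, $B=\mathrm{Sym}^dU$ in the canonical maps and composing with $\bigwedge^m$ (resp. $\mathrm{D}^m$) of the multiplication $U\otimes \mathrm{Sym}^dU\to\mathrm{Sym}^{d+1}U$ makes $\bigoplus_{d\ge0}\bigwedge^m(\mathrm{Sym}^dU)$ and $\bigoplus_{d\ge0}\mathrm{D}^m(\mathrm{Sym}^dU)$ into graded $\mathrm{Sym}(\mathrm{D}^mU)$-modules; write $*$ for the action. They are free of rank one, generated by $x^{m-1}\wedge\cdots\wedge x\wedge 1\in\bigwedge^m(\mathrm{Sym}^{m-1}U)$ and $1\in\mathbf{k}\cong \mathrm{D}^m(\mathrm{Sym}^0U)$ respectively. The isomorphisms $\beta$ and $\gamma$ are the inverses of $f\mapsto f*(x^{m-1}\wedge\cdots\wedge x\wedge1)$ and $f\mapsto f*1$ for $f\in\mathrm{Sym}^{n-m}(\mathrm{D}^mU)$. *)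

theory Defs
  imports Complex_Main "HOL-Library.Function_Algebras" "HOL-Combinatorics.Permutations"
begin

text \<open>
  A vector space is given by a scalar multiplication s on a type of class ab_group_add and a
  carrier V that is a linear subspace of this type; m-tuples of vectors are lists of length m.
\<close>

definition tuples :: "'v set \<Rightarrow> nat \<Rightarrow> 'v list set" where
  "tuples V m = {vs. length vs = m \<and> set vs \<subseteq> V}"

definition multilinear_on ::
  "('k \<Rightarrow> 'v::ab_group_add \<Rightarrow> 'v) \<Rightarrow> 'v set \<Rightarrow> nat \<Rightarrow> ('k \<Rightarrow> 'w::ab_group_add \<Rightarrow> 'w) \<Rightarrow> ('v list \<Rightarrow> 'w) \<Rightarrow> bool"
where
  "multilinear_on s V m t f \<longleftrightarrow>
     (\<forall>vs\<in>tuples V m. \<forall>i<m. \<forall>a\<in>V. \<forall>b\<in>V. \<forall>c.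
        f (vs[i := a + b]) = f (vs[i := a]) + f (vs[i := b]) \<and>
        f (vs[i := s c a]) = t c (f (vs[i := a])))"

definition alternating_on ::
  "('k \<Rightarrow> 'v::ab_group_add \<Rightarrow> 'v) \<Rightarrow> 'v set \<Rightarrow> nat \<Rightarrow> ('k \<Rightarrow> 'w::ab_group_add \<Rightarrow> 'w) \<Rightarrow> ('v list \<Rightarrow> 'w) \<Rightarrow> bool"
where
  "alternating_on s V m t f \<longleftrightarrow>
     multilinear_on s V m t f \<and> (\<forall>vs\<in>tuples V m. \<not> distinct vs \<longrightarrow> f vs = 0)"

definition symmetric_on ::
  "('k \<Rightarrow> 'v::ab_group_add \<Rightarrow> 'v) \<Rightarrow> 'v set \<Rightarrow> nat \<Rightarrow> ('k \<Rightarrow> 'w::ab_group_add \<Rightarrow> 'w) \<Rightarrow> ('v list \<Rightarrow> 'w) \<Rightarrow> bool"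
where
  "symmetric_on s V m t f \<longleftrightarrow>
     multilinear_on s V m t f \<and>
     (\<forall>vs\<in>tuples V m. \<forall>\<sigma>. \<sigma> permutes {..<m} \<longrightarrow> f (permute_list \<sigma> vs) = f vs)"

definition bilinear_on ::
  "('k \<Rightarrow> 'a::ab_group_add \<Rightarrow> 'a) \<Rightarrow> 'a set \<Rightarrow> ('k \<Rightarrow> 'b::ab_group_add \<Rightarrow> 'b) \<Rightarrow> 'b set \<Rightarrow>
   ('k \<Rightarrow> 'w::ab_group_add \<Rightarrow> 'w) \<Rightarrow> ('a \<times> 'b \<Rightarrow> 'w) \<Rightarrow> bool"
where
  "bilinear_on sA A sB B t f \<longleftrightarrow>
     (\<forall>a\<in>A. \<forall>a'\<in>A. \<forall>b\<in>B. \<forall>b'\<in>B. \<forall>c.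
        f (a + a', b) = f (a, b) + f (a', b) \<and> f (sA c a, b) = t c (f (a, b)) \<and>
        f (a, b + b') = f (a, b) + f (a, b') \<and> f (a, sB c b) = t c (f (a, b)))"

text \<open>
  Tensor products, tensor powers, exterior powers and symmetric powers are all realised in the
  same way.  If \<Phi> is the space of all bilinear (multilinear, alternating, symmetric multilinear)
  forms on a set X of tuples, then the tensor product (tensor, exterior, symmetric power) is the
  linear span of the evaluations \<phi> \<mapsto> \<phi> x, x \<in> X, which play the role of the pure tensors
  (decomposable wedges, monomials).  Over a field this is the usual quotient of the free vector
  space on X, because linear forms separate the points of that quotient; the universal properties
  are proved below.  For w in such a space and \<phi> in \<Phi>, w \<phi> is the
  value at w of the linear form induced by \<phi>.
\<close>

definition fscale :: "'k::field \<Rightarrow> ('x \<Rightarrow> 'k) \<Rightarrow> 'x \<Rightarrow> 'k" where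
  "fscale c F = (\<lambda>x. c * F x)"

definition ev :: "('x \<Rightarrow> 'k::field) set \<Rightarrow> 'x \<Rightarrow> ('x \<Rightarrow> 'k) \<Rightarrow> 'k" where
  "ev \<Phi> x = (\<lambda>\<phi>. if \<phi> \<in> \<Phi> then \<phi> x else 0)"

definition ev_span :: "('x \<Rightarrow> 'k::field) set \<Rightarrow> 'x set \<Rightarrow> (('x \<Rightarrow> 'k) \<Rightarrow> 'k) set" where
  "ev_span \<Phi> X = module.span fscale (ev \<Phi> ` X)"

definition bilin_forms ::
  "('k::field \<Rightarrow> 'a::ab_group_add \<Rightarrow> 'a) \<Rightarrow> 'a set \<Rightarrow> ('k \<Rightarrow> 'b::ab_group_add \<Rightarrow> 'b) \<Rightarrow> 'b set \<Rightarrow> ('a \<times> 'b \<Rightarrow> 'k) set"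
where
  "bilin_forms sA A sB B = {\<phi>. bilinear_on sA A sB B (*) \<phi>}"

definition mult_forms :: "('k::field \<Rightarrow> 'v::ab_group_add \<Rightarrow> 'v) \<Rightarrow> 'v set \<Rightarrow> nat \<Rightarrow> ('v list \<Rightarrow> 'k) set" where
  "mult_forms s V m = {\<phi>. multilinear_on s V m (*) \<phi>}"

definition alt_forms :: "('k::field \<Rightarrow> 'v::ab_group_add \<Rightarrow> 'v) \<Rightarrow> 'v set \<Rightarrow> nat \<Rightarrow> ('v list \<Rightarrow> 'k) set" where
  "alt_forms s V m = {\<phi>. alternating_on s V m (*) \<phi>}"

definition sym_forms :: "('k::field \<Rightarrow> 'v::ab_group_add \<Rightarrow> 'v) \<Rightarrow> 'v set \<Rightarrow> nat \<Rightarrow> ('v list \<Rightarrow> 'k) set" where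
  "sym_forms s V m = {\<phi>. symmetric_on s V m (*) \<phi>}"

type_synonym ('v, 'k) power_elem = "('v list \<Rightarrow> 'k) \<Rightarrow> 'k"
type_synonym ('a, 'b, 'k) tensor_elem = "('a \<times> 'b \<Rightarrow> 'k) \<Rightarrow> 'k"

definition tensor_space ::
  "('k::field \<Rightarrow> 'a::ab_group_add \<Rightarrow> 'a) \<Rightarrow> 'a set \<Rightarrow> ('k \<Rightarrow> 'b::ab_group_add \<Rightarrow> 'b) \<Rightarrow> 'b set \<Rightarrow> ('a, 'b, 'k) tensor_elem set"
where
  "tensor_space sA A sB B = ev_span (bilin_forms sA A sB B) (A \<times> B)"

definition tensor ::
  "('k::field \<Rightarrow> 'a::ab_group_add \<Rightarrow> 'a) \<Rightarrow> 'a set \<Rightarrow> ('k \<Rightarrow> 'b::ab_group_add \<Rightarrow> 'b) \<Rightarrow> 'b set \<Rightarrow>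
   'a \<Rightarrow> 'b \<Rightarrow> ('a, 'b, 'k) tensor_elem"
where
  "tensor sA A sB B a b = ev (bilin_forms sA A sB B) (a, b)"

definition tensor_power ::
  "('k::field \<Rightarrow> 'v::ab_group_add \<Rightarrow> 'v) \<Rightarrow> 'v set \<Rightarrow> nat \<Rightarrow> ('v, 'k) power_elem set" where
  "tensor_power s V m = ev_span (mult_forms s V m) (tuples V m)"

definition pure_tensor ::
  "('k::field \<Rightarrow> 'v::ab_group_add \<Rightarrow> 'v) \<Rightarrow> 'v set \<Rightarrow> 'v list \<Rightarrow> ('v, 'k) power_elem" where
  "pure_tensor s V vs = ev (mult_forms s V (length vs)) vs"

definition ext_power ::
  "('k::field \<Rightarrow> 'v::ab_group_add \<Rightarrow> 'v) \<Rightarrow> 'v set \<Rightarrow> nat \<Rightarrow> ('v, 'k) power_elem set" where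
  "ext_power s V m = ev_span (alt_forms s V m) (tuples V m)"

definition wedge ::
  "('k::field \<Rightarrow> 'v::ab_group_add \<Rightarrow> 'v) \<Rightarrow> 'v set \<Rightarrow> 'v list \<Rightarrow> ('v, 'k) power_elem" where
  "wedge s V vs = ev (alt_forms s V (length vs)) vs"

definition sym_power ::
  "('k::field \<Rightarrow> 'v::ab_group_add \<Rightarrow> 'v) \<Rightarrow> 'v set \<Rightarrow> nat \<Rightarrow> ('v, 'k) power_elem set" where
  "sym_power s V d = ev_span (sym_forms s V d) (tuples V d)"

definition sym_prod ::
  "('k::field \<Rightarrow> 'v::ab_group_add \<Rightarrow> 'v) \<Rightarrow> 'v set \<Rightarrow> 'v list \<Rightarrow> ('v, 'k) power_elem" where
  "sym_prod s V vs = ev (sym_forms s V (length vs)) vs"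

text \<open>
  The action of a permutation sends the pure tensor of vs to that of permute_list \<sigma> vs; the
  divided power consists of the invariant (symmetric) tensors.
\<close>

definition perm_tensor :: "(nat \<Rightarrow> nat) \<Rightarrow> ('v, 'k) power_elem \<Rightarrow> ('v, 'k) power_elem" where
  "perm_tensor \<sigma> T = (\<lambda>\<phi>. T (\<lambda>vs. \<phi> (permute_list \<sigma> vs)))"

definition div_power ::
  "('k::field \<Rightarrow> 'v::ab_group_add \<Rightarrow> 'v) \<Rightarrow> 'v set \<Rightarrow> nat \<Rightarrow> ('v, 'k) power_elem set" where
  "div_power s V m =
     {T \<in> tensor_power s V m. \<forall>\<sigma>. \<sigma> permutes {..<m} \<longrightarrow> perm_tensor \<sigma> T = T}"


text \<open>
  Maps induced on exterior and divided powers by a linear map f into the space W.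
\<close>

definition ext_map ::
  "('k::field \<Rightarrow> 'w::ab_group_add \<Rightarrow> 'w) \<Rightarrow> 'w set \<Rightarrow> nat \<Rightarrow> ('v \<Rightarrow> 'w) \<Rightarrow> ('v, 'k) power_elem \<Rightarrow> ('w, 'k) power_elem"
where
  "ext_map t W m f w = (\<lambda>\<psi>. if \<psi> \<in> alt_forms t W m then w (\<lambda>vs. \<psi> (map f vs)) else 0)"

definition div_map ::
  "('k::field \<Rightarrow> 'w::ab_group_add \<Rightarrow> 'w) \<Rightarrow> 'w set \<Rightarrow> nat \<Rightarrow> ('v \<Rightarrow> 'w) \<Rightarrow> ('v, 'k) power_elem \<Rightarrow> ('w, 'k) power_elem"
where
  "div_map t W m f T = (\<lambda>\<psi>. if \<psi> \<in> mult_forms t W m then T (\<lambda>vs. \<psi> (map f vs)) else 0)"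

text \<open>
  The canonical maps from the tensor product of the m-th divided power of A with the m-th exterior
  (divided) power of B to the m-th exterior (divided) power of the tensor product of A and B.
\<close>

definition canon_ext ::
  "('k::field \<Rightarrow> 'a::ab_group_add \<Rightarrow> 'a) \<Rightarrow> 'a set \<Rightarrow> ('k \<Rightarrow> 'b::ab_group_add \<Rightarrow> 'b) \<Rightarrow> 'b set \<Rightarrow> nat \<Rightarrow>
   (('a, 'k) power_elem, ('b, 'k) power_elem, 'k) tensor_elem \<Rightarrow> (('a, 'b, 'k) tensor_elem, 'k) power_elem"
where
  "canon_ext sA A sB B m z =
     (\<lambda>\<psi>. if \<psi> \<in> alt_forms fscale (tensor_space sA A sB B) m
          then z (\<lambda>(T, w). w (\<lambda>bs. T (\<lambda>as. \<psi> (map2 (tensor sA A sB B) as bs)))) else 0)"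

definition canon_div ::
  "('k::field \<Rightarrow> 'a::ab_group_add \<Rightarrow> 'a) \<Rightarrow> 'a set \<Rightarrow> ('k \<Rightarrow> 'b::ab_group_add \<Rightarrow> 'b) \<Rightarrow> 'b set \<Rightarrow> nat \<Rightarrow>
   (('a, 'k) power_elem, ('b, 'k) power_elem, 'k) tensor_elem \<Rightarrow> (('a, 'b, 'k) tensor_elem, 'k) power_elem"
where
  "canon_div sA A sB B m z =
     (\<lambda>\<psi>. if \<psi> \<in> mult_forms fscale (tensor_space sA A sB B) m
          then z (\<lambda>(T, S). S (\<lambda>bs. T (\<lambda>as. \<psi> (map2 (tensor sA A sB B) as bs)))) else 0)"


text \<open>
  From here on U is the whole type 'u, with scalar multiplication s; one and x stand for the
  vectors 1 and x of the chosen basis.  The basis vector x^i of the symmetric power of degree d is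
  the product of i factors x and d - i factors one; in degree 0 the unit is the empty product.
\<close>

abbreviation SymU :: "('k::field \<Rightarrow> 'u::ab_group_add \<Rightarrow> 'u) \<Rightarrow> nat \<Rightarrow> ('u, 'k) power_elem set" where
  "SymU s d \<equiv> sym_power s UNIV d"

definition xpow :: "('k::field \<Rightarrow> 'u::ab_group_add \<Rightarrow> 'u) \<Rightarrow> 'u \<Rightarrow> 'u \<Rightarrow> nat \<Rightarrow> nat \<Rightarrow> ('u, 'k) power_elem" where
  "xpow s one x d i = sym_prod s UNIV (replicate i x @ replicate (d - i) one)"

definition wedge_gen :: "('k::field \<Rightarrow> 'u::ab_group_add \<Rightarrow> 'u) \<Rightarrow> 'u \<Rightarrow> 'u \<Rightarrow> nat \<Rightarrow> (('u, 'k) power_elem, 'k) power_elem" where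
  "wedge_gen s one x m = wedge fscale (SymU s (m - 1)) (map (xpow s one x (m - 1)) (rev [0..<m]))"

definition div_gen :: "('k::field \<Rightarrow> 'u::ab_group_add \<Rightarrow> 'u) \<Rightarrow> nat \<Rightarrow> (('u, 'k) power_elem, 'k) power_elem" where
  "div_gen s m = pure_tensor fscale (SymU s 0) (replicate m (sym_prod s UNIV []))"

definition sym_mult ::
  "('k::field \<Rightarrow> 'u::ab_group_add \<Rightarrow> 'u) \<Rightarrow> nat \<Rightarrow> nat \<Rightarrow>
   (('u, 'k) power_elem, ('u, 'k) power_elem, 'k) tensor_elem \<Rightarrow> ('u, 'k) power_elem"
where
  "sym_mult s a b z =
     (\<lambda>\<phi>. if \<phi> \<in> sym_forms s UNIV (a + b)
          then z (\<lambda>(p, q). p (\<lambda>us. q (\<lambda>vs. \<phi> (us @ vs)))) else 0)"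

definition U_mult ::
  "('k::field \<Rightarrow> 'u::ab_group_add \<Rightarrow> 'u) \<Rightarrow> nat \<Rightarrow> ('u, ('u, 'k) power_elem, 'k) tensor_elem \<Rightarrow> ('u, 'k) power_elem"
where
  "U_mult s d z =
     (\<lambda>\<phi>. if \<phi> \<in> sym_forms s UNIV (Suc d)
          then z (\<lambda>(u, q). q (\<lambda>vs. \<phi> (u # vs))) else 0)"

definition alpha ::
  "('k::field \<Rightarrow> 'u::ab_group_add \<Rightarrow> 'u) \<Rightarrow> 'u \<Rightarrow> 'u \<Rightarrow> nat \<Rightarrow> nat \<Rightarrow>
   (('u, 'k) power_elem, 'k) power_elem \<Rightarrow> (('u, 'k) power_elem, 'k) power_elem"
where
  "alpha s one x n m =
     ext_map fscale (SymU s (n - 1)) m (sym_mult s (n - m) (m - 1)) \<circ>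
     canon_ext fscale (SymU s (n - m)) fscale (SymU s (m - 1)) m \<circ>
     (\<lambda>T. tensor fscale (div_power fscale (SymU s (n - m)) m)
                 fscale (ext_power fscale (SymU s (m - 1)) m) T (wedge_gen s one x m))"

text \<open>
  The action of an element t of the m-th divided power of U, and the action of an element of
  degree j of its symmetric algebra, on the component of degree d of the two graded modules.
  The latter is the linear extension of t1 ... tj * w = tj * (... * (t1 * w)).
\<close>

definition ext_act ::
  "('k::field \<Rightarrow> 'u::ab_group_add \<Rightarrow> 'u) \<Rightarrow> nat \<Rightarrow> nat \<Rightarrow> ('u, 'k) power_elem \<Rightarrow>
   (('u, 'k) power_elem, 'k) power_elem \<Rightarrow> (('u, 'k) power_elem, 'k) power_elem"
where
  "ext_act s m d t w =
     ext_map fscale (SymU s (Suc d)) m (U_mult s d)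
       (canon_ext s UNIV fscale (SymU s d) m
         (tensor fscale (div_power s UNIV m) fscale (ext_power fscale (SymU s d) m) t w))"

definition div_act ::
  "('k::field \<Rightarrow> 'u::ab_group_add \<Rightarrow> 'u) \<Rightarrow> nat \<Rightarrow> nat \<Rightarrow> ('u, 'k) power_elem \<Rightarrow>
   (('u, 'k) power_elem, 'k) power_elem \<Rightarrow> (('u, 'k) power_elem, 'k) power_elem"
where
  "div_act s m d t w =
     div_map fscale (SymU s (Suc d)) m (U_mult s d)
       (canon_div s UNIV fscale (SymU s d) m
         (tensor fscale (div_power s UNIV m) fscale (div_power fscale (SymU s d) m) t w))"

primrec act_list :: "(nat \<Rightarrow> 't \<Rightarrow> 'w \<Rightarrow> 'w) \<Rightarrow> nat \<Rightarrow> 't list \<Rightarrow> 'w \<Rightarrow> 'w" where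
  "act_list act d [] w = w"
| "act_list act d (t # ts) w = act_list act (Suc d) ts (act d t w)"

definition ext_star ::
  "('k::field \<Rightarrow> 'u::ab_group_add \<Rightarrow> 'u) \<Rightarrow> nat \<Rightarrow> nat \<Rightarrow> nat \<Rightarrow> (('u, 'k) power_elem, 'k) power_elem \<Rightarrow>
   (('u, 'k) power_elem, 'k) power_elem \<Rightarrow> (('u, 'k) power_elem, 'k) power_elem"
where
  "ext_star s m j d f w =
     (\<lambda>\<psi>. if \<psi> \<in> alt_forms fscale (SymU s (d + j)) m
          then f (\<lambda>ts. act_list (ext_act s m) d ts w \<psi>) else 0)"

definition div_star ::
  "('k::field \<Rightarrow> 'u::ab_group_add \<Rightarrow> 'u) \<Rightarrow> nat \<Rightarrow> nat \<Rightarrow> nat \<Rightarrow> (('u, 'k) power_elem, 'k) power_elem \<Rightarrow>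
   (('u, 'k) power_elem, 'k) power_elem \<Rightarrow> (('u, 'k) power_elem, 'k) power_elem"
where
  "div_star s m j d f w =
     (\<lambda>\<psi>. if \<psi> \<in> mult_forms fscale (SymU s (d + j)) m
          then f (\<lambda>ts. act_list (div_act s m) d ts w \<psi>) else 0)"

definition beta ::
  "('k::field \<Rightarrow> 'u::ab_group_add \<Rightarrow> 'u) \<Rightarrow> 'u \<Rightarrow> 'u \<Rightarrow> nat \<Rightarrow> nat \<Rightarrow>
   (('u, 'k) power_elem, 'k) power_elem \<Rightarrow> (('u, 'k) power_elem, 'k) power_elem"
where
  "beta s one x n m =
     inv_into (sym_power fscale (div_power s UNIV m) (n - m))
       (\<lambda>f. ext_star s m (n - m) (m - 1) f (wedge_gen s one x m))"

definition gamma ::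
  "('k::field \<Rightarrow> 'u::ab_group_add \<Rightarrow> 'u) \<Rightarrow> nat \<Rightarrow> nat \<Rightarrow>
   (('u, 'k) power_elem, 'k) power_elem \<Rightarrow> (('u, 'k) power_elem, 'k) power_elem"
where
  "gamma s n m =
     inv_into (sym_power fscale (div_power s UNIV m) (n - m))
       (\<lambda>f. div_star s m (n - m) 0 f (div_gen s m))"

definition linear_iso_on ::
  "('k \<Rightarrow> 'v::ab_group_add \<Rightarrow> 'v) \<Rightarrow> 'v set \<Rightarrow> ('k \<Rightarrow> 'w::ab_group_add \<Rightarrow> 'w) \<Rightarrow> 'w set \<Rightarrow> ('v \<Rightarrow> 'w) \<Rightarrow> bool"
where
  "linear_iso_on s V t W f \<longleftrightarrow>
     (\<forall>a\<in>V. \<forall>b\<in>V. f (a + b) = f a + f b) \<and> (\<forall>c. \<forall>a\<in>V. f (s c a) = t c (f a)) \<and> bij_betw f V W"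


text \<open>
  Universal properties (uniqueness is clear since the spaces are spanned by the pure elements), and
  the values of the maps above on pure elements.
\<close>

lemma vector_space_fscale: "vector_space fscale"
  by unfold_locales (auto simp: fscale_def fun_eq_iff algebra_simps)

interpretation fs: vector_space "fscale :: 'k::field \<Rightarrow> ('x \<Rightarrow> 'k) \<Rightarrow> 'x \<Rightarrow> 'k"
  by (rule vector_space_fscale)

lemma vector_space_mult: "vector_space ((*) :: 'k::field \<Rightarrow> 'k \<Rightarrow> 'k)"
  by unfold_locales (auto simp: algebra_simps)

lemma linear_form_separates:
  fixes t :: "'k::field \<Rightarrow> 'w::ab_group_add \<Rightarrow> 'w"
  assumes "vector_space t" and "\<And>l. Vector_Spaces.linear t (*) l \<Longrightarrow> l w = 0"
  shows "w = 0"
proof (rule ccontr)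
  assume w: "w \<noteq> 0"
  interpret p: vector_space_pair t "(*) :: 'k \<Rightarrow> 'k \<Rightarrow> 'k"
    using assms(1) vector_space_mult by (simp add: vector_space_pair_def)
  have "p.vs1.independent {w}"
    using w by (simp add: p.vs1.independent_insert)
  then obtain l where "Vector_Spaces.linear t (*) l" "l w = 1"
    using p.linear_independent_extend[of "{w}" "\<lambda>_. 1"] by auto
  then show False using assms(2)[of l] by simp
qed

lemma ev_universal:
  fixes t :: "'k::field \<Rightarrow> 'w::ab_group_add \<Rightarrow> 'w" and f :: "'x \<Rightarrow> 'w"
  assumes t: "vector_space t"
    and f: "\<And>l. Vector_Spaces.linear t (*) l \<Longrightarrow> l \<circ> f \<in> \<Phi>"
  shows "\<exists>F. Vector_Spaces.linear fscale t F \<and> (\<forall>x\<in>X. F (ev \<Phi> x) = f x)"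
proof -
  interpret p: vector_space_pair "fscale :: 'k \<Rightarrow> (('x \<Rightarrow> 'k) \<Rightarrow> 'k) \<Rightarrow> _" t
    using t vector_space_fscale by (simp add: vector_space_pair_def)
  obtain B where B: "B \<subseteq> ev \<Phi> ` X" "fs.independent B" "ev \<Phi> ` X \<subseteq> fs.span B"
    using fs.maximal_independent_subset by blast
  define g where "g b = (SOME x. x \<in> X \<and> ev \<Phi> x = b)" for b
  have g: "g b \<in> X" "ev \<Phi> (g b) = b" if "b \<in> B" for b
    using B(1) that someI_ex[of "\<lambda>x. x \<in> X \<and> ev \<Phi> x = b"] unfolding g_def by blast+
  obtain F where F: "Vector_Spaces.linear fscale t F" "\<forall>b\<in>B. F b = f (g b)"
    using p.linear_independent_extend[OF B(2), of "\<lambda>b. f (g b)"] by auto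
  have key: "l (F w) = w (l \<circ> f)" if l: "Vector_Spaces.linear t (*) l" and w: "w \<in> fs.span B" for l w
  proof -
    interpret l: Vector_Spaces.linear t "(*)" l by (rule l)
    interpret F: Vector_Spaces.linear fscale t F by (rule F)
    show ?thesis using w
    proof (induction rule: fs.span_induct_alt)
      case base then show ?case using F.zero l.zero by (simp flip: zero_fun_def)
    next
      case (step c b y)
      have "b (l \<circ> f) = ev \<Phi> (g b) (l \<circ> f)" using g step by simp
      also have "\<dots> = l (F b)" using f[OF l] F(2) step by (simp add: ev_def)
      finally have "l (F b) = b (l \<circ> f)" by simp
      have 1: "l (F (fscale c b + y)) = c * l (F b) + l (F y)" by (simp only: F.add F.scale l.add l.scale)
      have 2: "(fscale c b + y) (l \<circ> f) = c * b (l \<circ> f) + y (l \<circ> f)" by (simp add: fscale_def)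
      show ?case by (simp only: 1 2 step \<open>l (F b) = b (l \<circ> f)\<close>)
    qed
  qed
  have "F (ev \<Phi> x) = f x" if x: "x \<in> X" for x
  proof -
    have "l (F (ev \<Phi> x) - f x) = 0" if l: "Vector_Spaces.linear t (*) l" for l
    proof -
      interpret l: Vector_Spaces.linear t "(*)" l by (rule l)
      show ?thesis using key[OF l, of "ev \<Phi> x"] B(3) x f[OF l] by (auto simp: l.diff ev_def)
    qed
    then have "F (ev \<Phi> x) - f x = 0" by (rule linear_form_separates[OF t])
    then show ?thesis by simp
  qed
  then show ?thesis using F(1) by blast
qed

lemma multilinear_comp_linear:
  assumes "multilinear_on s V m t f" "Vector_Spaces.linear t r l"
  shows "multilinear_on s V m r (l \<circ> f)"
proof -
  interpret l: Vector_Spaces.linear t r l by fact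
  show ?thesis using assms(1) unfolding multilinear_on_def by (simp add: l.add l.scale)
qed

lemma linear_form_zero: "Vector_Spaces.linear t r l \<Longrightarrow> l 0 = 0"
proof -
  assume "Vector_Spaces.linear t r l"
  then interpret l: Vector_Spaces.linear t r l .
  show ?thesis by (rule l.zero)
qed

theorem tensor_space_universal:
  fixes sA :: "'k::field \<Rightarrow> 'a::ab_group_add \<Rightarrow> 'a"
  assumes "vector_space t" "bilinear_on sA A sB B t f"
  shows "\<exists>F. Vector_Spaces.linear fscale t F \<and> (\<forall>a\<in>A. \<forall>b\<in>B. F (tensor sA A sB B a b) = f (a, b))"
proof -
  have "\<exists>F. Vector_Spaces.linear fscale t F \<and> (\<forall>x\<in>A\<times>B. F (ev (bilin_forms sA A sB B) x) = f x)"
  proof (rule ev_universal[OF assms(1)])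
    fix l assume "Vector_Spaces.linear t (*) l"
    then interpret l: Vector_Spaces.linear t "(*)" l .
    show "l \<circ> f \<in> bilin_forms sA A sB B"
      using assms(2) unfolding bilin_forms_def bilinear_on_def by (simp add: l.add l.scale)
  qed
  then show ?thesis unfolding tensor_def by blast
qed

theorem tensor_power_universal:
  fixes s :: "'k::field \<Rightarrow> 'v::ab_group_add \<Rightarrow> 'v"
  assumes "vector_space t" "multilinear_on s V m t f"
  shows "\<exists>F. Vector_Spaces.linear fscale t F \<and> (\<forall>vs\<in>tuples V m. F (pure_tensor s V vs) = f vs)"
  using ev_universal[OF assms(1), of f "mult_forms s V m" "tuples V m"] multilinear_comp_linear[OF assms(2)]
  unfolding pure_tensor_def mult_forms_def tuples_def by auto

theorem ext_power_universal:
  fixes s :: "'k::field \<Rightarrow> 'v::ab_group_add \<Rightarrow> 'v"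
  assumes "vector_space t" "alternating_on s V m t f"
  shows "\<exists>F. Vector_Spaces.linear fscale t F \<and> (\<forall>vs\<in>tuples V m. F (wedge s V vs) = f vs)"
proof -
  have "\<exists>F. Vector_Spaces.linear fscale t F \<and> (\<forall>vs\<in>tuples V m. F (ev (alt_forms s V m) vs) = f vs)"
    by (rule ev_universal[OF assms(1)])
      (use assms(2) multilinear_comp_linear linear_form_zero in
        \<open>fastforce simp: alt_forms_def alternating_on_def\<close>)
  then show ?thesis by (simp add: wedge_def tuples_def)
qed

theorem sym_power_universal:
  fixes s :: "'k::field \<Rightarrow> 'v::ab_group_add \<Rightarrow> 'v"
  assumes "vector_space t" "symmetric_on s V m t f"
  shows "\<exists>F. Vector_Spaces.linear fscale t F \<and> (\<forall>vs\<in>tuples V m. F (sym_prod s V vs) = f vs)"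
  using ev_universal[OF assms(1), of f "sym_forms s V m" "tuples V m"]
    multilinear_comp_linear[of s V m t f] assms(2)
  unfolding sym_prod_def sym_forms_def symmetric_on_def tuples_def by auto

lemma tensor_bilinear:
  "bilinear_on sA A sB B fscale (\<lambda>(a, b). tensor sA A sB B a b)"
  unfolding bilinear_on_def tensor_def ev_def fscale_def bilin_forms_def by (auto simp: fun_eq_iff)

lemma pure_tensor_multilinear: "multilinear_on s V m fscale (pure_tensor s V)"
  unfolding multilinear_on_def pure_tensor_def ev_def fscale_def mult_forms_def tuples_def by (auto simp: fun_eq_iff)

lemma wedge_alternating: "alternating_on s V m fscale (wedge s V)"
  unfolding alternating_on_def multilinear_on_def wedge_def ev_def fscale_def alt_forms_def tuples_def by (auto simp: fun_eq_iff)

lemma sym_prod_symmetric: "symmetric_on s V m fscale (sym_prod s V)"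
  unfolding symmetric_on_def multilinear_on_def sym_prod_def ev_def fscale_def sym_forms_def tuples_def by (auto simp: fun_eq_iff)

lemma power_spans:
  "tensor_power s V m = fs.span (pure_tensor s V ` tuples V m)"
  "ext_power s V m = fs.span (wedge s V ` tuples V m)"
  "sym_power s V m = fs.span (sym_prod s V ` tuples V m)"
  "tensor_space sA A sB B = fs.span ((\<lambda>(a, b). tensor sA A sB B a b) ` (A \<times> B))"
  unfolding tensor_power_def ext_power_def sym_power_def tensor_space_def ev_span_def
    pure_tensor_def wedge_def sym_prod_def tensor_def tuples_def
  by (auto intro!: arg_cong[where f=fs.span] image_cong)

lemma ev_span_forms:
  assumes "w \<in> ev_span \<Phi> X" "\<phi> \<in> \<Phi>" "\<phi>1 \<in> \<Phi>" "\<phi>2 \<in> \<Phi>"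
    and "\<And>x. x \<in> X \<Longrightarrow> \<phi> x = c1 * \<phi>1 x + c2 * \<phi>2 x"
  shows "w \<phi> = c1 * w \<phi>1 + c2 * w \<phi>2"
  using assms(1) unfolding ev_span_def
proof (induction rule: fs.span_induct_alt)
  case base then show ?case by simp
next
  case (step c b y)
  then obtain x where "x \<in> X" "b = ev \<Phi> x" by blast
  then have "b \<phi> = c1 * b \<phi>1 + c2 * b \<phi>2" using assms by (simp add: ev_def)
  then show ?case using step by (simp add: fscale_def algebra_simps)
qed

lemma ev_span_eq:
  assumes "w \<in> ev_span \<Phi> X" "\<phi> \<in> \<Phi>" "\<phi>1 \<in> \<Phi>" "\<And>x. x \<in> X \<Longrightarrow> \<phi> x = \<phi>1 x"
  shows "w \<phi> = w \<phi>1"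
  using ev_span_forms[OF assms(1-3,3), of 1 0] assms(4) by simp

lemma ev_span_finite:
  assumes "w \<in> ev_span \<Phi> X"
  shows "\<exists>Y. finite Y \<and> Y \<subseteq> X \<and> w \<in> ev_span \<Phi> Y"
  using assms unfolding ev_span_def
proof (induction rule: fs.span_induct_alt)
  case base then show ?case using fs.span_zero by (intro exI[of _ "{}"]) (simp flip: zero_fun_def)
next
  case (step c b y)
  then obtain x Y where x: "x \<in> X" "b = ev \<Phi> x" "finite Y" "Y \<subseteq> X" "y \<in> fs.span (ev \<Phi> ` Y)" by blast
  have "y \<in> fs.span (ev \<Phi> ` insert x Y)" 
    using fs.span_mono[of "ev \<Phi> ` Y" "ev \<Phi> ` insert x Y"] x by auto
  moreover have "b \<in> fs.span (ev \<Phi> ` insert x Y)" using x by (auto intro: fs.span_base)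
  ultimately have "fscale c b + y \<in> fs.span (ev \<Phi> ` insert x Y)"
    by (intro fs.span_add fs.span_scale)
  then show ?case using x(1,3,4) by (meson finite_insert insert_subset)
qed

lemma tuples_update: "vs \<in> tuples V m \<Longrightarrow> a \<in> V \<Longrightarrow> vs[i := a] \<in> tuples V m"
  unfolding tuples_def using set_update_subset_insert by fastforce

lemma tuples_nth: "vs \<in> tuples V m \<Longrightarrow> i < m \<Longrightarrow> vs ! i \<in> V"
  unfolding tuples_def using nth_mem by blast

lemma permute_list_update:
  assumes "\<sigma> permutes {..<m}" "length vs = m" "k < m"
  shows "permute_list \<sigma> (vs[k := a]) = (permute_list \<sigma> vs)[inv \<sigma> k := a]"
proof (rule nth_equalityI)
  fix i assume "i < length (permute_list \<sigma> (vs[k := a]))"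
  then have i: "i < m" using assms by simp
  have s: "\<sigma> i < m" using permutes_in_image[OF assms(1), of i] i by simp
  have e: "\<sigma> i = k \<longleftrightarrow> inv \<sigma> k = i" using permutes_inverses[OF assms(1)] by metis
  show "permute_list \<sigma> (vs[k := a]) ! i = (permute_list \<sigma> vs)[inv \<sigma> k := a] ! i"
    using i s e assms by (auto simp: permute_list_nth nth_list_update)
qed simp

lemma permute_list_tuples:
  "\<sigma> permutes {..<m} \<Longrightarrow> vs \<in> tuples V m \<Longrightarrow> permute_list \<sigma> vs \<in> tuples V m"
  unfolding tuples_def by simp

lemma mult_forms_permute:
  assumes "\<sigma> permutes {..<m}" "\<phi> \<in> mult_forms s V m"
  shows "(\<lambda>vs. \<phi> (permute_list \<sigma> vs)) \<in> mult_forms s V m"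
  unfolding mult_forms_def multilinear_on_def mem_Collect_eq
proof (intro ballI allI impI)
  fix vs i a b c assume h: "vs \<in> tuples V m" "i < m" "a \<in> V" "b \<in> V"
  have "inv \<sigma> i < m" using permutes_in_image[OF permutes_inv[OF assms(1)], of i] h by simp
  moreover have "length vs = m" using h by (simp add: tuples_def)
  ultimately show "\<phi> (permute_list \<sigma> (vs[i := a + b])) =
          \<phi> (permute_list \<sigma> (vs[i := a])) + \<phi> (permute_list \<sigma> (vs[i := b])) \<and>
          \<phi> (permute_list \<sigma> (vs[i := s c a])) = c * \<phi> (permute_list \<sigma> (vs[i := a]))"
    using h permute_list_tuples[OF assms(1) h(1)] assms(2)
    by (simp add: permute_list_update[OF assms(1)] mult_forms_def multilinear_on_def)
qed

lemma multilinear_sum: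
  assumes sp: "vector_space s" "module.subspace s V" and f: "\<phi> \<in> mult_forms s V m"
    and "finite B" "B \<subseteq> V" "vs \<in> tuples V m" "i < m"
  shows "\<phi> (vs[i := \<Sum>b\<in>B. s (c b) b]) = (\<Sum>b\<in>B. c b * \<phi> (vs[i := b]))"
  using assms(4,5)
proof (induction B rule: finite_induct)
  case empty
  interpret vector_space s by fact
  have "\<phi> (vs[i := s 0 0]) = 0 * \<phi> (vs[i := 0])"
    using f assms(6,7) subspace_0[OF sp(2)] unfolding mult_forms_def multilinear_on_def by blast
  then show ?case by simp
next
  case (insert b B)
  interpret vector_space s by fact
  have 1: "s (c b) b \<in> V" "(\<Sum>b\<in>B. s (c b) b) \<in> V" 
    using insert sp(2) by (auto intro!: subspace_scale subspace_sum)
  have 2: "\<phi> (vs[i := s (c b) b + (\<Sum>b\<in>B. s (c b) b)]) = \<phi> (vs[i := s (c b) b]) + \<phi> (vs[i := (\<Sum>b\<in>B. s (c b) b)])"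
    using f assms(6,7) 1 unfolding mult_forms_def multilinear_on_def by blast
  have 3: "\<phi> (vs[i := s (c b) b]) = c b * \<phi> (vs[i := b])"
    using f assms(6,7) insert unfolding mult_forms_def multilinear_on_def by blast
  show ?case using insert 2 3 by simp
qed

text \<open>In characteristic 2 this is not immediate from the invariance of T under transposing i and j.\<close>

lemma div_power_alternating:
  fixes s :: "'k::field \<Rightarrow> 'v::ab_group_add \<Rightarrow> 'v"
  assumes sp: "vector_space s" "module.subspace s V"
    and T: "T \<in> div_power s V m" and f: "\<phi> \<in> mult_forms s V m"
    and ij: "i < m" "j < m" "i \<noteq> j"
    and alt: "\<And>vs. vs \<in> tuples V m \<Longrightarrow> vs ! i = vs ! j \<Longrightarrow> \<phi> vs = 0"
  shows "T \<phi> = 0"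
proof -
  interpret vector_space s by fact
  obtain B where B: "B \<subseteq> V" "independent B" "V \<subseteq> span B"
    using maximal_independent_subset[of V] by blast
  have spB: "span B = V" using B sp(2) by (metis span_minimal subset_antisym)
  let ?r = "representation B"
  obtain Y where Y: "finite Y" "Y \<subseteq> tuples V m" "T \<in> ev_span (mult_forms s V m) Y"
    using T ev_span_finite[of T "mult_forms s V m" "tuples V m"]
    unfolding div_power_def tensor_power_def by (elim CollectE conjE) auto
  define B0 where "B0 = (\<Union>vs\<in>Y. \<Union>v\<in>set vs. {b. ?r v b \<noteq> 0})"
  have B0: "finite B0" "B0 \<subseteq> B" 
    using Y(1) finite_representation representation_ne_zero unfolding B0_def by blast+
  obtain h :: "'v \<Rightarrow> nat" where h: "inj_on h B0"
    using finite_imp_inj_to_nat_seg[OF B0(1)] by blast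
  define G where "G vs p q = \<phi> (vs[i := p, j := q])" for vs p q
  define \<phi>' where "\<phi>' vs = (\<Sum>p\<in>B0. \<Sum>q\<in>B0. if h p < h q then ?r (vs ! i) p * ?r (vs ! j) q * G vs p q else 0)" for vs
  have radd: "?r (a + b) = (\<lambda>p. ?r a p + ?r b p)" "?r (s c a) = (\<lambda>p. c * ?r a p)" if "a \<in> V" "b \<in> V" for a b c
    using that spB representation_add[OF B(2), of b a] representation_scale[OF B(2), of a c] by simp_all
  have f': "\<phi>' \<in> mult_forms s V m"
    unfolding mult_forms_def multilinear_on_def mem_Collect_eq
  proof (intro ballI allI impI)
    fix vs k a b c assume v: "vs \<in> tuples V m" "k < m" "a \<in> V" "b \<in> V"
    have len: "length vs = m" using v by (simp add: tuples_def)
    have G: "G (vs[k := a + b]) p q = (if k = i \<or> k = j then G vs p q else G (vs[k := a]) p q + G (vs[k := b]) p q)"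
      "G (vs[k := s c a]) p q = (if k = i \<or> k = j then G vs p q else c * G (vs[k := a]) p q)"
      "k = i \<or> k = j \<Longrightarrow> G (vs[k := d]) p q = G vs p q"
      if "p \<in> B0" "q \<in> B0" for p q d
    proof -
      have t: "vs[i := p, j := q] \<in> tuples V m" using that v B0 B by (auto intro!: tuples_update)
      have sw: "vs[k := d, i := p, j := q] = vs[i := p, j := q, k := d]" if "k \<noteq> i" "k \<noteq> j" for d
        using that by (metis list_update_swap)
      have sw2: "vs[k := d, i := p, j := q] = vs[i := p, j := q]" if "k = i \<or> k = j" for d
        using that ij by (metis list_update_overwrite list_update_swap)
      show "G (vs[k := a + b]) p q = (if k = i \<or> k = j then G vs p q else G (vs[k := a]) p q + G (vs[k := b]) p q)"
       "G (vs[k := s c a]) p q = (if k = i \<or> k = j then G vs p q else c * G (vs[k := a]) p q)"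
       "k = i \<or> k = j \<Longrightarrow> G (vs[k := d]) p q = G vs p q"
        using f t v sw sw2 unfolding G_def mult_forms_def multilinear_on_def by auto
    qed
    show "\<phi>' (vs[k := a + b]) = \<phi>' (vs[k := a]) + \<phi>' (vs[k := b]) \<and> \<phi>' (vs[k := s c a]) = c * \<phi>' (vs[k := a])"
    proof -
      let ?H = "\<lambda>vs p q. if h p < h q then ?r (vs ! i) p * ?r (vs ! j) q * G vs p q else 0"
      consider "k = i" | "k = j" | "k \<noteq> i" "k \<noteq> j" by blast
      then have "?H (vs[k := a + b]) p q = ?H (vs[k := a]) p q + ?H (vs[k := b]) p q \<and>
         ?H (vs[k := s c a]) p q = c * ?H (vs[k := a]) p q" if pq: "p \<in> B0" "q \<in> B0" for p q
      proof cases
        case 1 then show ?thesis using G[OF pq] ij len radd[OF v(3,4)] by (simp add: algebra_simps)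
      next
        case 2 then show ?thesis using G[OF pq] ij len radd[OF v(3,4)] by (simp add: algebra_simps)
      next
        case 3 then show ?thesis using G[OF pq] ij len by (simp add: algebra_simps)
      qed
      then show ?thesis
        unfolding \<phi>'_def sum.distrib[symmetric] sum_distrib_left by (auto intro!: sum.cong)
    qed
  qed
  define \<sigma> where "\<sigma> = transpose i j"
  have \<sigma>: "\<sigma> permutes {..<m}" unfolding \<sigma>_def using ij by (intro permutes_swap_id) auto
  have inv: "T (\<lambda>vs. \<phi>' (permute_list \<sigma> vs)) = T \<phi>'"
    using T \<sigma> unfolding div_power_def perm_tensor_def by (auto dest!: fun_cong)
  have key: "\<phi> vs = \<phi>' vs - \<phi>' (permute_list \<sigma> vs)" if v: "vs \<in> Y" for vs
  proof -
    have v': "vs \<in> tuples V m" using v Y by auto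
    have len: "length vs = m" using v' by (simp add: tuples_def)
    have ex: "w = (\<Sum>b\<in>B0. s (?r w b) b)" if "w \<in> set vs" for w
    proof -
      have "w \<in> span B" using that v' spB by (auto simp: tuples_def)
      then have "w = (\<Sum>b | ?r w b \<noteq> 0. s (?r w b) b)" using sum_nonzero_representation_eq[OF B(2)] by simp
      also have "\<dots> = (\<Sum>b\<in>B0. s (?r w b) b)"
        using that v B0(1) unfolding B0_def by (intro sum.mono_neutral_left) (auto simp: B0_def)
      finally show ?thesis .
    qed
    have B0V: "B0 \<subseteq> V" using B0 B by auto
    have "\<phi> vs = \<phi> (vs[i := (\<Sum>b\<in>B0. s (?r (vs ! i) b) b)])"
      using ex[of "vs ! i"] ij len by (simp add: list_update_same_conv[symmetric, THEN iffD1])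
    also have "\<dots> = (\<Sum>p\<in>B0. ?r (vs ! i) p * \<phi> (vs[i := p]))"
      by (rule multilinear_sum[OF sp f B0(1) B0V v' ij(1)])
    also have "\<dots> = (\<Sum>p\<in>B0. ?r (vs ! i) p * (\<Sum>q\<in>B0. ?r (vs ! j) q * G vs p q))"
    proof (rule sum.cong[OF refl])
      fix p assume p: "p \<in> B0"
      have t: "vs[i := p] \<in> tuples V m" using p B0V v' by (auto intro: tuples_update)
      have "vs[i := p] = vs[i := p, j := (\<Sum>b\<in>B0. s (?r (vs ! j) b) b)]"
        using ex[of "vs ! j"] ij len by (metis list_update_id nth_list_update_neq nth_mem)
      then show "?r (vs ! i) p * \<phi> (vs[i := p]) = ?r (vs ! i) p * (\<Sum>q\<in>B0. ?r (vs ! j) q * G vs p q)"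
        using multilinear_sum[OF sp f B0(1) B0V t ij(2)] unfolding G_def by metis
    qed
    also have "\<dots> = (\<Sum>p\<in>B0. \<Sum>q\<in>B0. ?r (vs ! i) p * ?r (vs ! j) q * G vs p q)"
      by (simp add: sum_distrib_left mult.assoc)
    finally have 1: "\<phi> vs = (\<Sum>p\<in>B0. \<Sum>q\<in>B0. ?r (vs ! i) p * ?r (vs ! j) q * G vs p q)" .
    have G0: "G vs p p = 0" if "p \<in> V" for p
      unfolding G_def using that v' ij len by (intro alt tuples_update) (auto simp: nth_list_update)
    have Gadd: "G vs (p + p') q = G vs p q + G vs p' q" "G vs q (p + p') = G vs q p + G vs q p'"
      if "p \<in> V" "p' \<in> V" "q \<in> V" for p p' q
    proof -
      have "vs[j := q] \<in> tuples V m" "vs[i := q] \<in> tuples V m" using that v' by (auto intro: tuples_update)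
      then have "\<phi> (vs[j := q, i := p + p']) = \<phi> (vs[j := q, i := p]) + \<phi> (vs[j := q, i := p'])"
          "\<phi> (vs[i := q, j := p + p']) = \<phi> (vs[i := q, j := p]) + \<phi> (vs[i := q, j := p'])"
        using f that ij unfolding mult_forms_def multilinear_on_def by auto
      then show "G vs (p + p') q = G vs p q + G vs p' q" "G vs q (p + p') = G vs q p + G vs q p'"
        using ij(3) unfolding G_def by (metis list_update_swap)+
    qed
    have Ganti: "G vs p q = - G vs q p" if "p \<in> V" "q \<in> V" for p q
    proof -
      have pq: "p + q \<in> V" using that sp(2) subspace_add by blast
      have "0 = G vs (p + q) (p + q)" using G0[OF pq] by simp
      also have "\<dots> = G vs p q + G vs q p" using Gadd that pq G0[OF that(1)] G0[OF that(2)] by simp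
      finally show ?thesis by (simp add: eq_neg_iff_add_eq_0)
    qed
    let ?L = "\<lambda>p q. if h p < h q then ?r (vs ! i) p * ?r (vs ! j) q * G vs p q else 0"
    let ?R = "\<lambda>p q. if h q < h p then ?r (vs ! i) p * ?r (vs ! j) q * G vs p q else 0"
    have "?r (vs ! i) p * ?r (vs ! j) q * G vs p q = ?L p q + ?R p q" if "p \<in> B0" "q \<in> B0" for p q
      using that h G0 B0V by (cases "p = q") (auto simp: inj_on_def neq_iff)
    then have 2: "\<phi> vs = (\<Sum>p\<in>B0. \<Sum>q\<in>B0. ?L p q) + (\<Sum>p\<in>B0. \<Sum>q\<in>B0. ?R p q)"
      unfolding 1 sum.distrib[symmetric] by (intro sum.cong refl) auto
    have nth: "permute_list \<sigma> vs ! i = vs ! j" "permute_list \<sigma> vs ! j = vs ! i"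
      using \<sigma> ij len by (auto simp: permute_list_nth \<sigma>_def)
    have upd: "(permute_list \<sigma> vs)[i := p, j := q] = vs[i := p, j := q]" for p q
    proof (rule nth_equalityI)
      fix l assume "l < length ((permute_list \<sigma> vs)[i := p, j := q])"
      then have "l < m" using len by simp
      then show "(permute_list \<sigma> vs)[i := p, j := q] ! l = vs[i := p, j := q] ! l"
        using \<sigma> len ij by (auto simp: nth_list_update permute_list_nth \<sigma>_def transpose_def)
    qed simp
    have "(\<Sum>p\<in>B0. \<Sum>q\<in>B0. ?R p q) = (\<Sum>q\<in>B0. \<Sum>p\<in>B0. ?R p q)" by (rule sum.swap)
    also have "\<dots> = - \<phi>' (permute_list \<sigma> vs)"
      unfolding \<phi>'_def nth sum_negf[symmetric]
    proof (intro sum.cong refl)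
      fix p q assume "p \<in> B0" "q \<in> B0"
      then have pq: "p \<in> V" "q \<in> V" using B0V by auto
      show "?R q p = - (if h p < h q then ?r (vs ! j) p * ?r (vs ! i) q * G (permute_list \<sigma> vs) p q else 0)"
        using Ganti[OF pq(2,1)] upd by (simp add: G_def)
    qed
    finally show ?thesis using 2 by (simp add: \<phi>'_def)
  qed
  have "T \<phi> = 1 * T \<phi>' + (-1) * T (\<lambda>vs. \<phi>' (permute_list \<sigma> vs))"
    by (rule ev_span_forms[OF Y(3) f f' mult_forms_permute[OF \<sigma> f']]) (use key in auto)
  then show ?thesis using inv by simp
qed

lemma map2_update1:
  "length as = length bs \<Longrightarrow> i < length as \<Longrightarrow> map2 f (as[i := a]) bs = (map2 f as bs)[i := f a (bs ! i)]"
  by (rule nth_equalityI) (auto simp: nth_list_update)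

lemma map2_update2:
  "length as = length bs \<Longrightarrow> i < length as \<Longrightarrow> map2 f as (bs[i := b]) = (map2 f as bs)[i := f (as ! i) b]"
  by (rule nth_equalityI) (auto simp: nth_list_update)

lemma map2_tensor_tuples:
  assumes "as \<in> tuples A m" "bs \<in> tuples B m"
  shows "map2 (tensor sA A sB B) as bs \<in> tuples (tensor_space sA A sB B) m"
proof -
  have "tensor sA A sB B a b \<in> tensor_space sA A sB B" if "a \<in> A" "b \<in> B" for a b
    using that by (auto simp: power_spans intro!: fs.span_base)
  then show ?thesis using assms unfolding tuples_def by (auto) (meson in_mono set_zip_leftD set_zip_rightD)
qed

lemma tensor_in_space: "a \<in> A \<Longrightarrow> b \<in> B \<Longrightarrow> tensor sA A sB B a b \<in> tensor_space sA A sB B"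
  by (auto simp: power_spans intro!: fs.span_base)

lemma pull_left:
  assumes "\<psi> \<in> mult_forms fscale (tensor_space sA A sB B) m" "bs \<in> tuples B m"
  shows "(\<lambda>as. \<psi> (map2 (tensor sA A sB B) as bs)) \<in> mult_forms sA A m"
  unfolding mult_forms_def multilinear_on_def mem_Collect_eq
proof (intro ballI allI impI)
  fix as i a b c assume h: "as \<in> tuples A m" "i < m" "a \<in> A" "b \<in> A"
  let ?t = "tensor sA A sB B"
  have l: "length as = length bs" "i < length as" using h assms by (auto simp: tuples_def)
  have bi: "bs ! i \<in> B" using assms(2) h(2) by (rule tuples_nth)
  have "?t (a + b) (bs ! i) = ?t a (bs ! i) + ?t b (bs ! i)" "?t (sA c a) (bs ! i) = fscale c (?t a (bs ! i))"
    using tensor_bilinear[of sA A sB B] h bi unfolding bilinear_on_def by auto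
  then show "\<psi> (map2 ?t (as[i := a + b]) bs) = \<psi> (map2 ?t (as[i := a]) bs) + \<psi> (map2 ?t (as[i := b]) bs) \<and>
       \<psi> (map2 ?t (as[i := sA c a]) bs) = c * \<psi> (map2 ?t (as[i := a]) bs)"
    using assms(1) map2_tensor_tuples[OF h(1) assms(2), of sA sB] h(2) tensor_in_space[OF h(3) bi, of sA sB] tensor_in_space[OF h(4) bi, of sA sB]
    unfolding mult_forms_def multilinear_on_def mem_Collect_eq map2_update1[OF l] by metis
qed

lemma pull_right:
  assumes "\<psi> \<in> mult_forms fscale (tensor_space sA A sB B) m" "as \<in> tuples A m"
  shows "(\<lambda>bs. \<psi> (map2 (tensor sA A sB B) as bs)) \<in> mult_forms sB B m"
  unfolding mult_forms_def multilinear_on_def mem_Collect_eq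
proof (intro ballI allI impI)
  fix bs i a b c assume h: "bs \<in> tuples B m" "i < m" "a \<in> B" "b \<in> B"
  let ?t = "tensor sA A sB B"
  have l: "length as = length bs" "i < length as" using h assms by (auto simp: tuples_def)
  have ai: "as ! i \<in> A" using assms(2) h(2) by (rule tuples_nth)
  have "?t (as ! i) (a + b) = ?t (as ! i) a + ?t (as ! i) b" "?t (as ! i) (sB c a) = fscale c (?t (as ! i) a)"
    using tensor_bilinear[of sA A sB B] h ai unfolding bilinear_on_def by auto
  then show "\<psi> (map2 ?t as (bs[i := a + b])) = \<psi> (map2 ?t as (bs[i := a])) + \<psi> (map2 ?t as (bs[i := b])) \<and>
       \<psi> (map2 ?t as (bs[i := sB c a])) = c * \<psi> (map2 ?t as (bs[i := a]))"
    using assms(1) map2_tensor_tuples[OF assms(2) h(1), of sA sB] h(2) tensor_in_space[OF ai h(3), of sA sB] tensor_in_space[OF ai h(4), of sA sB]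
    unfolding mult_forms_def multilinear_on_def mem_Collect_eq map2_update2[OF l] by metis
qed

lemma contract_mult:
  assumes B: "module.subspace sB B" "vector_space sB" and T: "T \<in> tensor_power sA A m"
    and \<psi>: "\<psi> \<in> mult_forms fscale (tensor_space sA A sB B) m"
  shows "(\<lambda>bs. T (\<lambda>as. \<psi> (map2 (tensor sA A sB B) as bs))) \<in> mult_forms sB B m"
  unfolding mult_forms_def multilinear_on_def mem_Collect_eq
proof (intro ballI allI impI)
  interpret vector_space sB by fact
  fix bs i a b c assume h: "bs \<in> tuples B m" "i < m" "a \<in> B" "b \<in> B"
  let ?t = "tensor sA A sB B"
  let ?f = "\<lambda>bs as. \<psi> (map2 ?t as bs)"
  have ab: "a + b \<in> B" "sB c a \<in> B" using h B(1) subspace_add subspace_scale by blast+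
  have u: "bs[i := d] \<in> tuples B m" if "d \<in> B" for d using h that by (auto intro: tuples_update)
  have f: "?f bs \<in> mult_forms sA A m" if "bs \<in> tuples B m" for bs using pull_left[OF \<psi> that] .
  have r: "(\<lambda>bs. ?f bs as) \<in> mult_forms sB B m" if "as \<in> tuples A m" for as using pull_right[OF \<psi> that] .
  have T': "T \<in> ev_span (mult_forms sA A m) (tuples A m)" using T by (simp add: tensor_power_def)
  have "T (?f (bs[i := a + b])) = 1 * T (?f (bs[i := a])) + 1 * T (?f (bs[i := b]))"
    by (rule ev_span_forms[OF T' f f f]) (use u ab h r in \<open>auto simp: mult_forms_def multilinear_on_def\<close>)
  moreover have "T (?f (bs[i := sB c a])) = c * T (?f (bs[i := a])) + 0 * T (?f (bs[i := b]))"
    by (rule ev_span_forms[OF T' f f f]) (use u ab h r in \<open>auto simp: mult_forms_def multilinear_on_def\<close>)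
  ultimately show "T (?f (bs[i := a + b])) = T (?f (bs[i := a])) + T (?f (bs[i := b])) \<and>
       T (?f (bs[i := sB c a])) = c * T (?f (bs[i := a]))" by simp
qed

lemma contract_alt:
  assumes A: "module.subspace sA A" "vector_space sA" and B: "module.subspace sB B" "vector_space sB"
    and T: "T \<in> div_power sA A m"
    and \<psi>: "\<psi> \<in> alt_forms fscale (tensor_space sA A sB B) m"
  shows "(\<lambda>bs. T (\<lambda>as. \<psi> (map2 (tensor sA A sB B) as bs))) \<in> alt_forms sB B m"
proof -
  have \<psi>m: "\<psi> \<in> mult_forms fscale (tensor_space sA A sB B) m" 
    using \<psi> by (simp add: alt_forms_def mult_forms_def alternating_on_def)
  have "T (\<lambda>as. \<psi> (map2 (tensor sA A sB B) as bs)) = 0" if bs: "bs \<in> tuples B m" "\<not> distinct bs" for bs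
  proof -
    have len: "length bs = m" using bs by (simp add: tuples_def)
    obtain i j where ij: "i < m" "j < m" "i \<noteq> j" "bs ! i = bs ! j"
      using bs(2) len by (auto simp: distinct_conv_nth)
    show ?thesis
    proof (rule div_power_alternating[OF A(2,1) T pull_left[OF \<psi>m bs(1)] ij(1-3)])
      fix as assume as: "as \<in> tuples A m" "as ! i = as ! j"
      then have "map2 (tensor sA A sB B) as bs ! i = map2 (tensor sA A sB B) as bs ! j"
        using ij len by (simp add: tuples_def)
      then have "\<not> distinct (map2 (tensor sA A sB B) as bs)"
        using ij(1-3) len as(1) unfolding distinct_conv_nth tuples_def by auto
      then show "\<psi> (map2 (tensor sA A sB B) as bs) = 0"
        using \<psi> map2_tensor_tuples[OF as(1) bs(1), of sA sB] by (simp add: alt_forms_def alternating_on_def)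
    qed
  qed
  moreover have "T \<in> tensor_power sA A m" using T by (simp add: div_power_def)
  ultimately show ?thesis using contract_mult[OF B _ \<psi>m, of T]
    by (simp add: alt_forms_def mult_forms_def alternating_on_def)
qed

lemma alt_forms_lin:
  assumes "\<phi>1 \<in> alt_forms s V m" "\<phi>2 \<in> alt_forms s V m"
  shows "(\<lambda>x. c1 * \<phi>1 x + c2 * \<phi>2 x) \<in> alt_forms s V m"
  using assms unfolding alt_forms_def alternating_on_def multilinear_on_def by (simp add: algebra_simps)

lemma mult_forms_lin:
  assumes "\<phi>1 \<in> mult_forms s V m" "\<phi>2 \<in> mult_forms s V m"
  shows "(\<lambda>x. c1 * \<phi>1 x + c2 * \<phi>2 x) \<in> mult_forms s V m"
  using assms unfolding mult_forms_def multilinear_on_def by (simp add: algebra_simps)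

lemma tensor_apply:
  assumes "bilinear_on sA A sB B (*) \<phi>"
  shows "tensor sA A sB B a b \<phi> = \<phi> (a, b)"
  using assms by (simp add: tensor_def ev_def bilin_forms_def)

lemma canon_ext_tensor:
  assumes A: "module.subspace sA A" "vector_space sA" and B: "module.subspace sB B" "vector_space sB"
    and \<psi>: "\<psi> \<in> alt_forms fscale (tensor_space sA A sB B) m"
  shows "canon_ext sA A sB B m (tensor fscale (div_power sA A m) fscale (ext_power sB B m) T w) \<psi> =
         w (\<lambda>bs. T (\<lambda>as. \<psi> (map2 (tensor sA A sB B) as bs)))"
proof -
  let ?g = "\<lambda>T bs. T (\<lambda>as. \<psi> (map2 (tensor sA A sB B) as bs))"
  note alt = contract_alt[OF A B _ \<psi>]
  have "bilinear_on fscale (div_power sA A m) fscale (ext_power sB B m) (*) (\<lambda>(T, w). w (?g T))"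
    unfolding bilinear_on_def
  proof (intro ballI allI)
    fix T T' w w' c assume h: "T \<in> div_power sA A m" "T' \<in> div_power sA A m" "w \<in> ext_power sB B m" "w' \<in> ext_power sB B m"
    have w: "w \<in> ev_span (alt_forms sB B m) (tuples B m)" using h by (simp add: ext_power_def)
    have "w (?g (T + T')) = 1 * w (?g T) + 1 * w (?g T')"
      by (rule ev_span_forms[OF w _ alt[OF h(1)] alt[OF h(2)]]) 
        (use alt_forms_lin[OF alt[OF h(1)] alt[OF h(2)], of 1 1] in simp_all)
    moreover have "w (?g (fscale c T)) = c * w (?g T) + 0 * w (?g T')"
      by (rule ev_span_forms[OF w _ alt[OF h(1)] alt[OF h(2)]]) 
        (use alt_forms_lin[OF alt[OF h(1)] alt[OF h(2)], of c 0] in \<open>simp_all add: fscale_def\<close>)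
    ultimately show "(case (T + T', w) of (T, w) \<Rightarrow> w (?g T)) = (case (T, w) of (T, w) \<Rightarrow> w (?g T)) + (case (T', w) of (T, w) \<Rightarrow> w (?g T)) \<and>
       (case (fscale c T, w) of (T, w) \<Rightarrow> w (?g T)) = c * (case (T, w) of (T, w) \<Rightarrow> w (?g T)) \<and>
       (case (T, w + w') of (T, w) \<Rightarrow> w (?g T)) = (case (T, w) of (T, w) \<Rightarrow> w (?g T)) + (case (T, w') of (T, w) \<Rightarrow> w (?g T)) \<and>
       (case (T, fscale c w) of (T, w) \<Rightarrow> w (?g T)) = c * (case (T, w) of (T, w) \<Rightarrow> w (?g T))"
      by (simp add: fscale_def)
  qed
  from tensor_apply[OF this, of T w] show ?thesis using \<psi> by (simp add: canon_ext_def)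
qed

lemma sum_fun_apply: "(\<Sum>i\<in>I. f i) x = (\<Sum>i\<in>I. f i x)"
  by (induction I rule: infinite_finite_induct) auto

theorem canon_ext_formula:
  assumes A: "module.subspace sA A" "vector_space sA" and B: "module.subspace sB B" "vector_space sB"
    and a: "\<And>\<alpha>. \<alpha> \<in> I \<Longrightarrow> a \<alpha> \<in> tuples A m" and b: "b \<in> tuples B m"
    and T: "T = (\<Sum>\<alpha>\<in>I. pure_tensor sA A (a \<alpha>))" "T \<in> div_power sA A m"
  shows "canon_ext sA A sB B m (tensor fscale (div_power sA A m) fscale (ext_power sB B m) T (wedge sB B b)) =
         (\<Sum>\<alpha>\<in>I. wedge fscale (tensor_space sA A sB B) (map2 (tensor sA A sB B) (a \<alpha>) b))"
proof
  fix \<psi>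
  let ?t = "tensor sA A sB B"
  have lb: "length b = m" using b by (simp add: tuples_def)
  have la: "length (a \<alpha>) = m" if "\<alpha> \<in> I" for \<alpha> using a[OF that] by (simp add: tuples_def)
  show "canon_ext sA A sB B m (tensor fscale (div_power sA A m) fscale (ext_power sB B m) T (wedge sB B b)) \<psi> =
         (\<Sum>\<alpha>\<in>I. wedge fscale (tensor_space sA A sB B) (map2 ?t (a \<alpha>) b)) \<psi>"
  proof (cases "\<psi> \<in> alt_forms fscale (tensor_space sA A sB B) m")
    case True
    then have m: "\<psi> \<in> mult_forms fscale (tensor_space sA A sB B) m" by (simp add: alt_forms_def mult_forms_def alternating_on_def)
    have "wedge sB B b (\<lambda>bs. T (\<lambda>as. \<psi> (map2 ?t as bs))) = T (\<lambda>as. \<psi> (map2 ?t as b))"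
      using contract_alt[OF A B T(2) True] lb by (simp add: wedge_def ev_def)
    also have "\<dots> = (\<Sum>\<alpha>\<in>I. \<psi> (map2 ?t (a \<alpha>) b))"
      unfolding T(1) sum_fun_apply using pull_left[OF m b] la by (auto intro!: sum.cong simp: pure_tensor_def ev_def)
    finally show ?thesis using canon_ext_tensor[OF A B True, of T "wedge sB B b"] True la lb
      by (simp add: sum_fun_apply wedge_def ev_def)
  next
    case False
    then show ?thesis using la lb by (simp add: canon_ext_def sum_fun_apply wedge_def ev_def)
  qed
qed

lemma canon_div_tensor:
  assumes B: "module.subspace sB B" "vector_space sB"
    and \<psi>: "\<psi> \<in> mult_forms fscale (tensor_space sA A sB B) m"
  shows "canon_div sA A sB B m (tensor fscale (div_power sA A m) fscale (div_power sB B m) T w) \<psi> =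
         w (\<lambda>bs. T (\<lambda>as. \<psi> (map2 (tensor sA A sB B) as bs)))"
proof -
  let ?g = "\<lambda>T bs. T (\<lambda>as. \<psi> (map2 (tensor sA A sB B) as bs))"
  note mul = contract_mult[OF B _ \<psi>]
  have "bilinear_on fscale (div_power sA A m) fscale (div_power sB B m) (*) (\<lambda>(T, w). w (?g T))"
    unfolding bilinear_on_def
  proof (intro ballI allI)
    fix T T' w w' c assume h0: "T \<in> div_power sA A m" "T' \<in> div_power sA A m" "w \<in> div_power sB B m" "w' \<in> div_power sB B m"
    then have h: "T \<in> tensor_power sA A m" "T' \<in> tensor_power sA A m" by (auto simp: div_power_def)
    have w: "w \<in> ev_span (mult_forms sB B m) (tuples B m)" using h0 by (simp add: div_power_def tensor_power_def)
    have "w (?g (T + T')) = 1 * w (?g T) + 1 * w (?g T')"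
      by (rule ev_span_forms[OF w _ mul[OF h(1)] mul[OF h(2)]]) 
        (use mult_forms_lin[OF mul[OF h(1)] mul[OF h(2)], of 1 1] in simp_all)
    moreover have "w (?g (fscale c T)) = c * w (?g T) + 0 * w (?g T')"
      by (rule ev_span_forms[OF w _ mul[OF h(1)] mul[OF h(2)]]) 
        (use mult_forms_lin[OF mul[OF h(1)] mul[OF h(2)], of c 0] in \<open>simp_all add: fscale_def\<close>)
    ultimately show "(case (T + T', w) of (T, w) \<Rightarrow> w (?g T)) = (case (T, w) of (T, w) \<Rightarrow> w (?g T)) + (case (T', w) of (T, w) \<Rightarrow> w (?g T)) \<and>
       (case (fscale c T, w) of (T, w) \<Rightarrow> w (?g T)) = c * (case (T, w) of (T, w) \<Rightarrow> w (?g T)) \<and>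
       (case (T, w + w') of (T, w) \<Rightarrow> w (?g T)) = (case (T, w) of (T, w) \<Rightarrow> w (?g T)) + (case (T, w') of (T, w) \<Rightarrow> w (?g T)) \<and>
       (case (T, fscale c w) of (T, w) \<Rightarrow> w (?g T)) = c * (case (T, w) of (T, w) \<Rightarrow> w (?g T))"
      by (simp add: fscale_def)
  qed
  from tensor_apply[OF this, of T w] show ?thesis using \<psi> by (simp add: canon_div_def)
qed

theorem canon_div_formula:
  assumes B: "module.subspace sB B" "vector_space sB"
    and a: "\<And>\<alpha>. \<alpha> \<in> I \<Longrightarrow> a \<alpha> \<in> tuples A m" and b: "\<And>\<beta>. \<beta> \<in> J \<Longrightarrow> b \<beta> \<in> tuples B m"
    and T: "T = (\<Sum>\<alpha>\<in>I. pure_tensor sA A (a \<alpha>))" "T \<in> div_power sA A m"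
    and w: "w = (\<Sum>\<beta>\<in>J. pure_tensor sB B (b \<beta>))"
  shows "canon_div sA A sB B m (tensor fscale (div_power sA A m) fscale (div_power sB B m) T w) =
         (\<Sum>\<beta>\<in>J. \<Sum>\<alpha>\<in>I. pure_tensor fscale (tensor_space sA A sB B) (map2 (tensor sA A sB B) (a \<alpha>) (b \<beta>)))"
proof
  fix \<psi>
  let ?t = "tensor sA A sB B"
  have lb: "length (b \<beta>) = m" if "\<beta> \<in> J" for \<beta> using b[OF that] by (simp add: tuples_def)
  have la: "length (a \<alpha>) = m" if "\<alpha> \<in> I" for \<alpha> using a[OF that] by (simp add: tuples_def)
  show "canon_div sA A sB B m (tensor fscale (div_power sA A m) fscale (div_power sB B m) T w) \<psi> =
         (\<Sum>\<beta>\<in>J. \<Sum>\<alpha>\<in>I. pure_tensor fscale (tensor_space sA A sB B) (map2 ?t (a \<alpha>) (b \<beta>))) \<psi>"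
  proof (cases "\<psi> \<in> mult_forms fscale (tensor_space sA A sB B) m")
    case True
    have T': "T \<in> tensor_power sA A m" using T(2) by (simp add: div_power_def)
    have "w (\<lambda>bs. T (\<lambda>as. \<psi> (map2 ?t as bs))) = (\<Sum>\<beta>\<in>J. T (\<lambda>as. \<psi> (map2 ?t as (b \<beta>))))"
      unfolding w sum_fun_apply using contract_mult[OF B T' True] lb by (intro sum.cong) (simp_all add: pure_tensor_def ev_def)
    also have "\<dots> = (\<Sum>\<beta>\<in>J. \<Sum>\<alpha>\<in>I. \<psi> (map2 ?t (a \<alpha>) (b \<beta>)))"
      unfolding T(1) sum_fun_apply using pull_left[OF True b] la by (intro sum.cong) (simp_all add: pure_tensor_def ev_def)
    finally show ?thesis using canon_div_tensor[OF B True, of T w] True la lb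
      by (simp add: sum_fun_apply pure_tensor_def ev_def)
  next
    case False
    then show ?thesis using la lb by (simp add: canon_div_def sum_fun_apply pure_tensor_def ev_def)
  qed
qed


lemma multilinear_on_map:
  assumes f: "\<And>a b. a \<in> V \<Longrightarrow> b \<in> V \<Longrightarrow> f (a + b) = f a + f b" "\<And>c a. a \<in> V \<Longrightarrow> f (s c a) = t c (f a)"
    and W: "\<And>a. a \<in> V \<Longrightarrow> f a \<in> W" and \<psi>: "multilinear_on t W m r \<psi>"
  shows "multilinear_on s V m r (\<lambda>vs. \<psi> (map f vs))"
  unfolding multilinear_on_def
proof (intro ballI allI impI)
  fix vs i a b c assume h: "vs \<in> tuples V m" "i < m" "a \<in> V" "b \<in> V"
  have "map f vs \<in> tuples W m" using h(1) W by (auto simp: tuples_def)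
  then have "\<psi> ((map f vs)[i := f a + f b]) = \<psi> ((map f vs)[i := f a]) + \<psi> ((map f vs)[i := f b]) \<and>
       \<psi> ((map f vs)[i := t c (f a)]) = r c (\<psi> ((map f vs)[i := f a]))"
    using \<psi> h W[OF h(3)] W[OF h(4)] unfolding multilinear_on_def by blast
  then show "\<psi> (map f (vs[i := a + b])) = \<psi> (map f (vs[i := a])) + \<psi> (map f (vs[i := b])) \<and>
       \<psi> (map f (vs[i := s c a])) = r c (\<psi> (map f (vs[i := a])))"
    using f h by (simp add: map_update)
qed

lemma ext_map_wedge:
  assumes f: "\<And>a b. a \<in> V \<Longrightarrow> b \<in> V \<Longrightarrow> f (a + b) = f a + f b" "\<And>c a. a \<in> V \<Longrightarrow> f (s c a) = t c (f a)"
    and W: "\<And>a. a \<in> V \<Longrightarrow> f a \<in> W" and vs: "vs \<in> tuples V m"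
  shows "ext_map t W m f (wedge s V vs) = wedge t W (map f vs)"
proof
  fix \<psi>
  have l: "length vs = m" using vs by (simp add: tuples_def)
  have m: "map f vs \<in> tuples W m" if "vs \<in> tuples V m" for vs using that W by (auto simp: tuples_def)
  have "(\<lambda>vs. \<psi> (map f vs)) \<in> alt_forms s V m" if "\<psi> \<in> alt_forms t W m"
    unfolding alt_forms_def alternating_on_def mem_Collect_eq
  proof (intro conjI ballI impI)
    show "multilinear_on s V m (*) (\<lambda>vs. \<psi> (map f vs))"
      by (rule multilinear_on_map[where V=V and f=f and s=s and t=t and W=W and \<psi>=\<psi>]) (use f W that in \<open>simp_all only: alt_forms_def alternating_on_def mem_Collect_eq\<close>)
    fix vs assume "vs \<in> tuples V m" "\<not> distinct vs"
    then show "\<psi> (map f vs) = 0"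
      using that m by (simp add: alt_forms_def alternating_on_def distinct_map)
  qed
  then show "ext_map t W m f (wedge s V vs) \<psi> = wedge t W (map f vs) \<psi>"
    using l by (simp add: ext_map_def wedge_def ev_def)
qed

lemma div_map_pure:
  assumes f: "\<And>a b. a \<in> V \<Longrightarrow> b \<in> V \<Longrightarrow> f (a + b) = f a + f b" "\<And>c a. a \<in> V \<Longrightarrow> f (s c a) = t c (f a)"
    and W: "\<And>a. a \<in> V \<Longrightarrow> f a \<in> W" and vs: "vs \<in> tuples V m"
  shows "div_map t W m f (pure_tensor s V vs) = pure_tensor t W (map f vs)"
proof
  fix \<psi>
  have l: "length vs = m" using vs by (simp add: tuples_def)
  have "(\<lambda>vs. \<psi> (map f vs)) \<in> mult_forms s V m" if "\<psi> \<in> mult_forms t W m"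
    unfolding mult_forms_def mem_Collect_eq
    by (rule multilinear_on_map[where V=V and f=f and s=s and t=t and W=W and \<psi>=\<psi>]) (use f W that in \<open>simp_all only: mult_forms_def mem_Collect_eq\<close>)
  then show "div_map t W m f (pure_tensor s V vs) \<psi> = pure_tensor t W (map f vs) \<psi>"
    using l by (simp add: div_map_def pure_tensor_def ev_def)
qed

lemma symmetric_on_mset:
  "symmetric_on s V m t f \<longleftrightarrow> multilinear_on s V m t f \<and>
     (\<forall>vs\<in>tuples V m. \<forall>ws. mset ws = mset vs \<longrightarrow> f ws = f vs)"
proof -
  have "(\<forall>\<sigma>. \<sigma> permutes {..<m} \<longrightarrow> f (permute_list \<sigma> vs) = f vs) \<longleftrightarrow>
        (\<forall>ws. mset ws = mset vs \<longrightarrow> f ws = f vs)" if "vs \<in> tuples V m" for vs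
  proof (intro iffI allI impI)
    fix ws assume a: "\<forall>\<sigma>. \<sigma> permutes {..<m} \<longrightarrow> f (permute_list \<sigma> vs) = f vs" and ws: "mset ws = mset vs"
    obtain \<sigma> where p: "\<sigma> permutes {..<length vs}" "permute_list \<sigma> vs = ws"
      using mset_eq_permutation[OF ws] .
    moreover have "length vs = m" using that by (simp add: tuples_def)
    ultimately show "f ws = f vs" using a by metis
  next
    fix \<sigma> assume "\<forall>ws. mset ws = mset vs \<longrightarrow> f ws = f vs" "\<sigma> permutes {..<m}"
    moreover from this(2) have "mset (permute_list \<sigma> vs) = mset vs"
      using that by (simp add: tuples_def)
    ultimately show "f (permute_list \<sigma> vs) = f vs" by blast
  qed
  then show ?thesis unfolding symmetric_on_def by blast
qed

lemma sym_forms_append: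
  assumes "\<phi> \<in> sym_forms s UNIV (a + b)"
  shows "length us = a \<Longrightarrow> (\<lambda>vs. \<phi> (us @ vs)) \<in> sym_forms s UNIV b"
    and "length vs = b \<Longrightarrow> (\<lambda>us. \<phi> (us @ vs)) \<in> sym_forms s UNIV a"
proof -
  have M: "multilinear_on s UNIV (a + b) (*) \<phi>"
    and S: "\<forall>vs\<in>tuples UNIV (a + b). \<forall>ws. mset ws = mset vs \<longrightarrow> \<phi> ws = \<phi> vs"
    using assms unfolding sym_forms_def symmetric_on_mset mem_Collect_eq by blast+
  have \<phi>: "\<phi> (vs[i := x + y]) = \<phi> (vs[i := x]) + \<phi> (vs[i := y])" "\<phi> (vs[i := s c x]) = c * \<phi> (vs[i := x])"
    if "length vs = a + b" "i < a + b" for vs i x y c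
  proof -
    have "vs \<in> tuples UNIV (a + b)" using that by (simp add: tuples_def)
    then show "\<phi> (vs[i := x + y]) = \<phi> (vs[i := x]) + \<phi> (vs[i := y])" "\<phi> (vs[i := s c x]) = c * \<phi> (vs[i := x])"
      using M[unfolded multilinear_on_def, rule_format, OF _ that(2) UNIV_I UNIV_I, of vs x y c] by simp_all
  qed
  have \<phi>s: "\<phi> ws = \<phi> vs" if "length vs = a + b" "mset ws = mset vs" for vs ws
  proof -
    have "vs \<in> tuples UNIV (a + b)" using that by (simp add: tuples_def)
    then show ?thesis using S that(2) by blast
  qed
  show "(\<lambda>vs. \<phi> (us @ vs)) \<in> sym_forms s UNIV b" if u: "length us = a"
    unfolding sym_forms_def symmetric_on_mset multilinear_on_def tuples_def mem_Collect_eq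
  proof (intro conjI ballI allI impI)
    fix vs :: "'a list" and i x y c assume "vs \<in> {vs. length vs = b \<and> set vs \<subseteq> UNIV}" "i < b"
    then show "\<phi> (us @ vs[i := x + y]) = \<phi> (us @ vs[i := x]) + \<phi> (us @ vs[i := y])"
      "\<phi> (us @ vs[i := s c x]) = c * \<phi> (us @ vs[i := x])"
      using \<phi>(1)[of "us @ vs" "a + i" x y] \<phi>(2)[of "us @ vs" "a + i" c x] u by (simp_all add: list_update_append)
  next
    fix vs ws :: "'a list" assume "vs \<in> {vs. length vs = b \<and> set vs \<subseteq> UNIV}" "mset ws = mset vs"
    then show "\<phi> (us @ ws) = \<phi> (us @ vs)" using \<phi>s[of "us @ vs" "us @ ws"] u by simp
  qed
  show "(\<lambda>us. \<phi> (us @ vs)) \<in> sym_forms s UNIV a" if v: "length vs = b"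
    unfolding sym_forms_def symmetric_on_mset multilinear_on_def tuples_def mem_Collect_eq
  proof (intro conjI ballI allI impI)
    fix us :: "'a list" and i x y c assume "us \<in> {vs. length vs = a \<and> set vs \<subseteq> UNIV}" "i < a"
    then show "\<phi> (us[i := x + y] @ vs) = \<phi> (us[i := x] @ vs) + \<phi> (us[i := y] @ vs)"
      "\<phi> (us[i := s c x] @ vs) = c * \<phi> (us[i := x] @ vs)"
      using \<phi>(1)[of "us @ vs" i x y] \<phi>(2)[of "us @ vs" i c x] v by (simp_all add: list_update_append)
  next
    fix us ws :: "'a list" assume "us \<in> {vs. length vs = a \<and> set vs \<subseteq> UNIV}" "mset ws = mset us"
    then show "\<phi> (ws @ vs) = \<phi> (us @ vs)" using \<phi>s[of "us @ vs" "ws @ vs"] v by simp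
  qed
qed

lemma sym_forms_lin:
  assumes "\<phi>1 \<in> sym_forms s V m" "\<phi>2 \<in> sym_forms s V m"
  shows "(\<lambda>x. c1 * \<phi>1 x + c2 * \<phi>2 x) \<in> sym_forms s V m"
  using assms unfolding sym_forms_def symmetric_on_def multilinear_on_def by (simp add: algebra_simps)

lemma sym_forms_contract:
  assumes \<phi>: "\<phi> \<in> sym_forms s UNIV (a + b)" and q: "q \<in> sym_power s UNIV b"
  shows "(\<lambda>us. q (\<lambda>vs. \<phi> (us @ vs))) \<in> sym_forms s UNIV a"
proof -
  have q': "q \<in> ev_span (sym_forms s UNIV b) (tuples UNIV b)" using q by (simp add: sym_power_def)
  note L = sym_forms_append(1)[OF \<phi>] and R = sym_forms_append(2)[OF \<phi>]
  let ?Q = "\<lambda>us. q (\<lambda>vs. \<phi> (us @ vs))"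
  show ?thesis
    unfolding sym_forms_def symmetric_on_mset multilinear_on_def mem_Collect_eq
  proof (intro conjI ballI allI impI)
    fix us :: "'a list" and i x y c assume us: "us \<in> tuples UNIV a" and i: "i < a"
    have f: "(\<lambda>vs. \<phi> (us[i := z] @ vs)) \<in> sym_forms s UNIV b" for z
      using L us by (simp add: tuples_def)
    have r: "\<phi> (us[i := x + y] @ vs) = \<phi> (us[i := x] @ vs) + \<phi> (us[i := y] @ vs)"
      "\<phi> (us[i := s c x] @ vs) = c * \<phi> (us[i := x] @ vs)" if "vs \<in> tuples UNIV b" for vs
    proof -
      have "multilinear_on s UNIV a (*) (\<lambda>us. \<phi> (us @ vs))"
        using R[of vs] that by (simp add: sym_forms_def symmetric_on_def tuples_def)
      from this[unfolded multilinear_on_def, rule_format, OF us i UNIV_I UNIV_I, of x y c]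
      show "\<phi> (us[i := x + y] @ vs) = \<phi> (us[i := x] @ vs) + \<phi> (us[i := y] @ vs)"
      "\<phi> (us[i := s c x] @ vs) = c * \<phi> (us[i := x] @ vs)" by simp_all
    qed
    have "?Q (us[i := x + y]) = 1 * ?Q (us[i := x]) + 1 * ?Q (us[i := y])"
      by (rule ev_span_forms[OF q' f f f]) (simp add: r)
    then show "?Q (us[i := x + y]) = ?Q (us[i := x]) + ?Q (us[i := y])" by simp
    have "?Q (us[i := s c x]) = c * ?Q (us[i := x]) + 0 * ?Q (us[i := y])"
      by (rule ev_span_forms[OF q' f f f]) (simp add: r)
    then show "?Q (us[i := s c x]) = c * ?Q (us[i := x])" by simp
  next
    fix us ws :: "'a list" assume us: "us \<in> tuples UNIV a" "mset ws = mset us"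
    have l: "length us = a" "length ws = a" using us by (auto simp: tuples_def dest: mset_eq_length)
    show "?Q ws = ?Q us"
    proof (rule ev_span_eq[OF q' L[OF l(2)] L[OF l(1)]])
      fix vs :: "'a list" assume "vs \<in> tuples UNIV b"
      then have "(\<lambda>us. \<phi> (us @ vs)) \<in> sym_forms s UNIV a" using R[of vs] by (simp add: tuples_def)
      then show "\<phi> (ws @ vs) = \<phi> (us @ vs)"
        using us unfolding sym_forms_def symmetric_on_mset mem_Collect_eq by blast
    qed
  qed
qed

theorem sym_mult_formula:
  assumes "length us = a" "length vs = b"
  shows "sym_mult s a b (tensor fscale (SymU s a) fscale (SymU s b) (sym_prod s UNIV us) (sym_prod s UNIV vs)) =
         sym_prod s UNIV (us @ vs)"
proof
  fix \<phi>
  show "sym_mult s a b (tensor fscale (SymU s a) fscale (SymU s b) (sym_prod s UNIV us) (sym_prod s UNIV vs)) \<phi> =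
         sym_prod s UNIV (us @ vs) \<phi>"
  proof (cases "\<phi> \<in> sym_forms s UNIV (a + b)")
    case True
    let ?g = "\<lambda>q us. q (\<lambda>vs. \<phi> (us @ vs))"
    note C = sym_forms_contract[OF True]
    have "bilinear_on fscale (SymU s a) fscale (SymU s b) (*) (\<lambda>(p, q). p (?g q))"
      unfolding bilinear_on_def
    proof (intro ballI allI)
      fix p p' q q' c assume h: "p \<in> SymU s a" "p' \<in> SymU s a" "q \<in> SymU s b" "q' \<in> SymU s b"
      have p: "p \<in> ev_span (sym_forms s UNIV a) (tuples UNIV a)" using h by (simp add: sym_power_def)
      have 1: "p (?g (q + q')) = 1 * p (?g q) + 1 * p (?g q')"
        by (rule ev_span_forms[OF p _ C[OF h(3)] C[OF h(4)]])
          (use sym_forms_lin[OF C[OF h(3)] C[OF h(4)], of 1 1] in simp_all)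
      have 2: "p (?g (fscale c q)) = c * p (?g q) + 0 * p (?g q')"
        by (rule ev_span_forms[OF p _ C[OF h(3)] C[OF h(4)]])
          (use sym_forms_lin[OF C[OF h(3)] C[OF h(4)], of c 0] in \<open>simp_all add: fscale_def\<close>)
      show "(case (p + p', q) of (p, q) \<Rightarrow> p (?g q)) = (case (p, q) of (p, q) \<Rightarrow> p (?g q)) + (case (p', q) of (p, q) \<Rightarrow> p (?g q)) \<and>
        (case (fscale c p, q) of (p, q) \<Rightarrow> p (?g q)) = c * (case (p, q) of (p, q) \<Rightarrow> p (?g q)) \<and>
        (case (p, q + q') of (p, q) \<Rightarrow> p (?g q)) = (case (p, q) of (p, q) \<Rightarrow> p (?g q)) + (case (p, q') of (p, q) \<Rightarrow> p (?g q)) \<and>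
        (case (p, fscale c q) of (p, q) \<Rightarrow> p (?g q)) = c * (case (p, q) of (p, q) \<Rightarrow> p (?g q))"
        using 1 2 by (simp add: fscale_def)
    qed
    from tensor_apply[OF this, of "sym_prod s UNIV us" "sym_prod s UNIV vs"] 
    have "sym_mult s a b (tensor fscale (SymU s a) fscale (SymU s b) (sym_prod s UNIV us) (sym_prod s UNIV vs)) \<phi> =
       sym_prod s UNIV us (?g (sym_prod s UNIV vs))" using True by (simp add: sym_mult_def)
    moreover have "sym_prod s UNIV vs \<in> SymU s b"
      using assms by (auto simp: power_spans tuples_def intro!: fs.span_base)
    moreover have ap: "sym_prod s UNIV ws \<phi>' = \<phi>' ws" if "\<phi>' \<in> sym_forms s UNIV (length ws)" for ws \<phi>'
      using that by (simp add: sym_prod_def ev_def)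
    ultimately show ?thesis
      using C sym_forms_append(1)[OF True, of us] assms True by (simp add: ap)
  next
    case False then show ?thesis using assms by (simp add: sym_mult_def sym_prod_def ev_def)
  qed
qed

theorem U_mult_formula:
  assumes "length vs = d"
  shows "U_mult s d (tensor s UNIV fscale (SymU s d) u (sym_prod s UNIV vs)) = sym_prod s UNIV (u # vs)"
proof
  fix \<phi>
  show "U_mult s d (tensor s UNIV fscale (SymU s d) u (sym_prod s UNIV vs)) \<phi> = sym_prod s UNIV (u # vs) \<phi>"
  proof (cases "\<phi> \<in> sym_forms s UNIV (Suc d)")
    case True
    then have True': "\<phi> \<in> sym_forms s UNIV (1 + d)" by simp
    let ?g = "\<lambda>u vs. \<phi> (u # vs)"
    have G: "?g u \<in> sym_forms s UNIV d" for u using sym_forms_append(1)[OF True', of "[u]"] by simp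
    have "bilinear_on s UNIV fscale (SymU s d) (*) (\<lambda>(u, q). q (?g u))"
      unfolding bilinear_on_def
    proof (intro ballI allI)
      fix u u' :: 'a and q q' c assume h: "q \<in> SymU s d" "q' \<in> SymU s d"
      have C: "(\<lambda>us. q (\<lambda>vs. \<phi> (us @ vs))) \<in> sym_forms s UNIV 1" by (rule sym_forms_contract[OF True' h(1)])
      have "([u] :: 'a list) \<in> tuples UNIV 1" by (simp add: tuples_def)
      then have "q (?g (u + u')) = q (?g u) + q (?g u') \<and> q (?g (s c u)) = c * q (?g u)"
        using C[unfolded sym_forms_def symmetric_on_def multilinear_on_def mem_Collect_eq, THEN conjunct1,
            rule_format, OF _ zero_less_one UNIV_I UNIV_I, of "[u]" u u' c] by simp
      then show "(case (u + u', q) of (u, q) \<Rightarrow> q (?g u)) = (case (u, q) of (u, q) \<Rightarrow> q (?g u)) + (case (u', q) of (u, q) \<Rightarrow> q (?g u)) \<and>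
        (case (s c u, q) of (u, q) \<Rightarrow> q (?g u)) = c * (case (u, q) of (u, q) \<Rightarrow> q (?g u)) \<and>
        (case (u, q + q') of (u, q) \<Rightarrow> q (?g u)) = (case (u, q) of (u, q) \<Rightarrow> q (?g u)) + (case (u, q') of (u, q) \<Rightarrow> q (?g u)) \<and>
        (case (u, fscale c q) of (u, q) \<Rightarrow> q (?g u)) = c * (case (u, q) of (u, q) \<Rightarrow> q (?g u))"
        by (simp add: fscale_def)
    qed
    from tensor_apply[OF this, of u "sym_prod s UNIV vs"] show ?thesis
      using True G assms by (simp add: U_mult_def sym_prod_def ev_def)
  next
    case False then show ?thesis using assms by (simp add: U_mult_def sym_prod_def ev_def)
  qed
qed

end

theory Submission
  imports Defs "HOL-Library.Poly_Mapping" "HOL-Library.FuncSet" "HOL-Computational_Algebra.Polynomial"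
begin

text \<open>
  In the basis of monomials a symmetric tensor in the m-th divided power of the symmetric power of degree d
  is a symmetric polynomial in m variables whose degree in each variable is at most d.  In these
  coordinates the action of the divided power of U on both graded modules is multiplication of
  polynomials, the generator of the first module is the staircase monomial, and \<alpha> is
  multiplication by this monomial followed by the passage from tensors to wedges.  Hence \<alpha> is a
  map of modules that sends generator to generator, which gives \<beta> \<circ> \<alpha> = \<gamma> as soon as
  \<alpha> and the inverse of \<gamma> are bijective.  Both are unitriangular if exponents are ordered by their
  sum of squares: \<alpha> takes the orbit sum of a partition a to the wedge indexed by a + stair m plus
  smaller terms, and a product of elementary symmetric polynomials has the conjugate partition as
  its leading exponent.
\<close>

section \<open>Symmetric polynomials of bounded degree in each variable\<close>

text \<open>Two choices answer this. Symmetric tensors are generated by sums over distinct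
  rearrangements, each with coefficient 1, rather than by symmetrised tensors. Alternating forms are
  built as explicit determinants, whose vanishing on repeated vectors is shown by pairing off terms.
  Triangularity arguments for partitions are usually run along the dominance order. The sum of
  squares replaces it by a natural number: it is blind to permutations of an exponent, while its
  cross term with the staircase measures how well the exponent is sorted. Bijectivity of the inverse
  of \<gamma> is a bounded form of the fundamental theorem on symmetric polynomials. Admitting the
  factor e_0 = 1 turns the condition "degree at most n - m in each variable" into "combination of
  products of exactly n - m elementary symmetric polynomials", which matches a symmetric power of
  the (m + 1)-dimensional divided power of U. For the exterior side no second such theorem is
  proved: the injectivity that \<beta> needs is transported along \<alpha>.\<close>

abbreviation "coef \<equiv> Poly_Mapping.lookup"
abbreviation "supp \<equiv> Poly_Mapping.keys"
abbreviation "mon \<equiv> Poly_Mapping.single"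

text \<open>The linear functional on polynomials with prescribed values \<open>g\<close> on
  monomials. The values of a multilinear form on tuples of basis vectors are such a
  \<open>g\<close>, so this is how a polynomial acts as a tensor.\<close>

definition pairing :: "('a \<Rightarrow>\<^sub>0 'k::comm_ring_1) \<Rightarrow> ('a \<Rightarrow> 'k) \<Rightarrow> 'k" where
  "pairing p g = (\<Sum>a\<in>supp p. coef p a * g a)"

lemma pairing_superset:
  assumes "finite A" "supp p \<subseteq> A"
  shows "pairing p g = (\<Sum>a\<in>A. coef p a * g a)"
  unfolding pairing_def using assms
  by (intro sum.mono_neutral_left) (auto simp: in_keys_iff)

lemma pairing_0 [simp]: "pairing 0 g = 0"
  by (simp add: pairing_def)

lemma pairing_add: "pairing (p + q) g = pairing p g + pairing q g"
proof -
  let ?A = "supp p \<union> supp q"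
  have "pairing (p + q) g = (\<Sum>a\<in>?A. coef (p + q) a * g a)"
    by (rule pairing_superset) (auto simp: keys_add)
  also have "\<dots> = (\<Sum>a\<in>?A. coef p a * g a) + (\<Sum>a\<in>?A. coef q a * g a)"
    by (simp add: lookup_add algebra_simps sum.distrib)
  finally show ?thesis by (simp add: pairing_superset[of ?A p] pairing_superset[of ?A q])
qed

lemma pairing_mon [simp]: "pairing (mon a c) g = c * g a"
  using pairing_superset[of "{a}" "mon a c" g] by simp

lemma pairing_sum: "pairing (\<Sum>i\<in>I. p i) g = (\<Sum>i\<in>I. pairing (p i) g)"
  by (induction I rule: infinite_finite_induct) (auto simp: pairing_add)

lemma pairing_diff: "pairing (p - q) g = pairing p g - pairing q g"
  using pairing_add[of "p - q" q g] by (simp add: algebra_simps)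

lemma mpoly_sum_mon: "p = (\<Sum>a\<in>supp p. mon a (coef p a))"
  by (rule poly_mapping_eqI)
    (auto simp: lookup_sum lookup_single when_def in_keys_iff)

text \<open>Multiplication of polynomials is dual to addition of exponents. This is what later
  matches the rule that basis vectors multiply by adding their indices.\<close>

lemma pairing_mult:
  fixes p q :: "'a::monoid_add \<Rightarrow>\<^sub>0 'k::comm_ring_1"
  shows "pairing (p * q) g = pairing p (\<lambda>a. pairing q (\<lambda>b. g (a + b)))"
proof -
  have "p * q = (\<Sum>a\<in>supp p. \<Sum>b\<in>supp q. mon (a + b) (coef p a * coef q b))"
    by (subst mpoly_sum_mon[of p], subst mpoly_sum_mon[of q])
      (simp add: sum_product mult_single)
  then show ?thesis
    by (simp add: pairing_sum) (simp add: pairing_def sum_distrib_left mult.assoc)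
qed

lemma pairing_delta: "pairing p (\<lambda>b. if b = a then 1 else 0) = coef p a"
  by (subst pairing_superset[of "insert a (supp p)"]) (auto simp: if_distrib in_keys_iff sum.If_cases cong: if_cong)

lemma pairing_cong: "(\<And>a. a \<in> supp p \<Longrightarrow> g a = h a) \<Longrightarrow> pairing p g = pairing p h"
  by (simp add: pairing_def)

text \<open>The constant polynomial \<open>mon 0 c\<close> plays the scalar c throughout, so scalar
  multiplication is an instance of the product.\<close>

lemma pairing_scale: "pairing (mon 0 c * p) g = c * pairing p g"
  for p :: "'a::monoid_add \<Rightarrow>\<^sub>0 'k::comm_ring_1"
  by (simp add: pairing_mult)

lemma pairing_one [simp]: "pairing 1 g = g 0"
  by (simp flip: single_one)

section \<open>Exponents in m variables and invariance under permutations\<close>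

definition exps :: "nat \<Rightarrow> nat \<Rightarrow> (nat \<Rightarrow> nat) set" where
  "exps m d = {a. (\<forall>i<m. a i \<le> d) \<and> (\<forall>i\<ge>m. a i = 0)}"

lemma finite_exps [simp]: "finite (exps m d)"
proof (rule finite_subset)
  show "exps m d \<subseteq> {a. \<forall>i. (i \<in> {..<m} \<longrightarrow> a i \<in> {..d}) \<and> (i \<notin> {..<m} \<longrightarrow> a i = 0)}"
    unfolding exps_def by (intro subsetI) simp
  show "finite {a. \<forall>i. (i \<in> {..<m} \<longrightarrow> a i \<in> {..d}) \<and> (i \<notin> {..<m} \<longrightarrow> a i = (0::nat))}"
    by (rule finite_set_of_finite_funs) auto
qed

lemma exps_add: "a \<in> exps m d \<Longrightarrow> b \<in> exps m d' \<Longrightarrow> a + b \<in> exps m (d + d')"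
  by (auto simp: exps_def intro: add_mono)

lemma exps_mult:
  fixes p q :: "(nat \<Rightarrow> nat) \<Rightarrow>\<^sub>0 'k::comm_ring_1"
  assumes "supp p \<subseteq> exps m d" "supp q \<subseteq> exps m d'"
  shows "supp (p * q) \<subseteq> exps m (d + d')"
proof -
  have "supp (p * q) \<subseteq> {a + b |a b. a \<in> supp p \<and> b \<in> supp q}"
    using keys_mult[of p q] by auto
  also have "\<dots> \<subseteq> exps m (d + d')"
    using assms exps_add by (auto simp: subset_iff)
  finally show ?thesis .
qed

lemma exps_perm: "a \<in> exps m d \<Longrightarrow> \<sigma> permutes {..<m} \<Longrightarrow> a \<circ> \<sigma> \<in> exps m d"
  using permutes_in_image[of \<sigma> "{..<m}"] by (auto simp: exps_def permutes_not_in)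

text \<open>Exponents are functions on all natural numbers that are forced to be 0 from m on, so
  agreement below m is equality.\<close>

lemma exps_ext: "a \<in> exps m d \<Longrightarrow> b \<in> exps m d' \<Longrightarrow> (\<And>i. i < m \<Longrightarrow> a i = b i) \<Longrightarrow> a = b"
proof (rule ext)
  fix i assume "a \<in> exps m d" "b \<in> exps m d'" "\<And>i. i < m \<Longrightarrow> a i = b i"
  then show "a i = b i" by (cases "i < m") (auto simp: exps_def)
qed

text \<open>Invariance is tested against all functionals instead of coefficient by coefficient: in
  this form closure under products follows from \<open>pairing_mult\<close> by moving the
  permutation past one factor at a time.\<close>

definition sym_polys :: "nat \<Rightarrow> nat \<Rightarrow> ((nat \<Rightarrow> nat) \<Rightarrow>\<^sub>0 'k::comm_ring_1) set" where
  "sym_polys m d = {p. supp p \<subseteq> exps m d \<and>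
     (\<forall>\<sigma> g. \<sigma> permutes {..<m} \<longrightarrow> pairing p (\<lambda>a. g (a \<circ> \<sigma>)) = pairing p g)}"

lemma sym_polys_supp: "p \<in> sym_polys m d \<Longrightarrow> a \<in> supp p \<Longrightarrow> a \<in> exps m d"
  by (auto simp: sym_polys_def)

lemma sym_polys_pairing:
  "p \<in> sym_polys m d \<Longrightarrow> \<sigma> permutes {..<m} \<Longrightarrow> pairing p (\<lambda>a. g (a \<circ> \<sigma>)) = pairing p g"
  by (auto simp: sym_polys_def)

lemma comp_perm_eq_iff:
  assumes "\<sigma> permutes S"
  shows "a \<circ> \<sigma> = b \<longleftrightarrow> a = b \<circ> inv \<sigma>"
  using permutes_inv_o[OF assms] by (metis comp_assoc comp_id)

text \<open>Invariance is applied to the indicator function of a single exponent.\<close>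

lemma sym_polys_coef:
  assumes "p \<in> sym_polys m d" "\<sigma> permutes {..<m}"
  shows "coef p (a \<circ> \<sigma>) = coef p a"
proof -
  have i: "inv \<sigma> permutes {..<m}" using assms(2) by (rule permutes_inv)
  have "coef p (a \<circ> \<sigma>) = pairing p (\<lambda>b. if b = a \<circ> \<sigma> then 1 else 0)" by (simp add: pairing_delta)
  also have "\<dots> = pairing p (\<lambda>b. (\<lambda>b. if b = a then 1 else 0) (b \<circ> inv \<sigma>))"
    by (simp add: comp_perm_eq_iff[OF i] permutes_inv_inv[OF assms(2)])
  also have "\<dots> = coef p a" by (subst sym_polys_pairing[OF assms(1) i]) (rule pairing_delta)
  finally show ?thesis .
qed

lemma sym_polysI:
  assumes "supp p \<subseteq> exps m d" and c: "\<And>\<sigma> a. \<sigma> permutes {..<m} \<Longrightarrow> a \<in> exps m d \<Longrightarrow> coef p (a \<circ> \<sigma>) = coef p a"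
  shows "p \<in> sym_polys m d"
proof -
  have "pairing p (\<lambda>a. g (a \<circ> \<sigma>)) = pairing p g" if s: "\<sigma> permutes {..<m}" for \<sigma> g
  proof -
    have i: "inv \<sigma> permutes {..<m}" using s by (rule permutes_inv)
    have "pairing p (\<lambda>a. g (a \<circ> \<sigma>)) = (\<Sum>a\<in>exps m d. coef p a * g (a \<circ> \<sigma>))"
      by (rule pairing_superset) (use assms in auto)
    also have "\<dots> = (\<Sum>a\<in>exps m d. coef p a * g a)"
      by (rule sum.reindex_bij_witness[of _ "\<lambda>a. a \<circ> inv \<sigma>" "\<lambda>a. a \<circ> \<sigma>"])
        (auto simp: c[OF s] exps_perm[OF _ s] exps_perm[OF _ i] comp_assoc permutes_inv_o[OF s])
    also have "\<dots> = pairing p g" by (rule pairing_superset[symmetric]) (use assms in auto)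
    finally show ?thesis .
  qed
  then show ?thesis using assms(1) by (simp add: sym_polys_def)
qed

lemma sym_polys_mult:
  assumes "p \<in> sym_polys m d" "q \<in> sym_polys m d'"
  shows "p * q \<in> sym_polys m (d + d')"
proof -
  have "supp (p * q) \<subseteq> exps m (d + d')"
    using assms by (intro exps_mult) (simp_all add: sym_polys_def)
  moreover have "pairing (p * q) (\<lambda>a. g (a \<circ> \<sigma>)) = pairing (p * q) g" if s: "\<sigma> permutes {..<m}" for \<sigma> g
  proof -
    have e: "(a + b) \<circ> \<sigma> = (a \<circ> \<sigma>) + (b \<circ> \<sigma>)" for a b :: "nat \<Rightarrow> nat" by (simp add: fun_eq_iff)
    let ?h = "\<lambda>a. pairing q (\<lambda>b. g (a + b))"
    have "pairing (p * q) (\<lambda>a. g (a \<circ> \<sigma>)) = pairing p (\<lambda>a. pairing q (\<lambda>b. g ((a \<circ> \<sigma>) + (b \<circ> \<sigma>))))"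
      by (simp add: pairing_mult e)
    also have "\<dots> = pairing p (\<lambda>a. ?h (a \<circ> \<sigma>))"
    proof (rule pairing_cong)
      fix a show "pairing q (\<lambda>b. g ((a \<circ> \<sigma>) + (b \<circ> \<sigma>))) = ?h (a \<circ> \<sigma>)"
        by (rule sym_polys_pairing[OF assms(2) s, of "\<lambda>b. g ((a \<circ> \<sigma>) + b)"])
    qed
    also have "\<dots> = pairing (p * q) g"
      by (subst sym_polys_pairing[OF assms(1) s]) (simp add: pairing_mult)
    finally show ?thesis .
  qed
  ultimately show ?thesis by (simp add: sym_polys_def)
qed

lemma sym_polys_add: "p \<in> sym_polys m d \<Longrightarrow> q \<in> sym_polys m d \<Longrightarrow> p + q \<in> sym_polys m d"
  using keys_add[of p q] by (auto simp: sym_polys_def pairing_add)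

lemma sym_polys_const: "mon 0 c \<in> sym_polys m 0"
proof -
  have z: "(0 :: nat \<Rightarrow> nat) \<circ> \<sigma> = 0" for \<sigma> by (simp add: fun_eq_iff)
  show ?thesis by (auto simp: sym_polys_def exps_def z)
qed

lemma sym_polys_one: "1 \<in> sym_polys m 0"
  using sym_polys_const[of 1 m] by simp

lemma sym_polys_scale: "p \<in> sym_polys m d \<Longrightarrow> mon 0 c * p \<in> sym_polys m d"
  using sym_polys_mult[OF sym_polys_const, of p m d c] by simp

lemma sym_polys_0: "0 \<in> sym_polys m d"
  by (simp add: sym_polys_def)

lemma sym_polys_sum: "(\<And>i. i \<in> I \<Longrightarrow> p i \<in> sym_polys m d) \<Longrightarrow> (\<Sum>i\<in>I. p i) \<in> sym_polys m d"
  by (induction I rule: infinite_finite_induct) (auto intro: sym_polys_add sym_polys_0)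

lemma sym_polys_diff:
  assumes "p \<in> sym_polys m d" "q \<in> sym_polys m d"
  shows "p - q \<in> sym_polys m d"
proof -
  have "p - q = p + mon 0 (-1) * q" by (simp add: single_uminus)
  then show ?thesis using assms by (simp only: sym_polys_add sym_polys_scale)
qed

lemma sym_polys_prod_list:
  "(\<And>p. p \<in> set ps \<Longrightarrow> p \<in> sym_polys m d) \<Longrightarrow> prod_list ps \<in> sym_polys m (length ps * d)"
  by (induction ps) (auto intro: sym_polys_one sym_polys_mult)

section \<open>Sorting exponents\<close>

definition decr :: "nat \<Rightarrow> (nat \<Rightarrow> nat) \<Rightarrow> bool" where
  "decr m a \<longleftrightarrow> (\<forall>i k. i < k \<longrightarrow> k < m \<longrightarrow> a k \<le> a i)"

definition sqsum :: "nat \<Rightarrow> (nat \<Rightarrow> nat) \<Rightarrow> nat" where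
  "sqsum m a = (\<Sum>i<m. (a i)\<^sup>2)"

text \<open>The vector often called rho: adding it turns weakly decreasing exponents into strictly
  decreasing ones.\<close>

definition stair :: "nat \<Rightarrow> nat \<Rightarrow> nat" where
  "stair m = (\<lambda>i. if i < m then m - 1 - i else 0)"

lemma stair_exps: "stair m \<in> exps m (m - 1)"
  by (auto simp: stair_def exps_def)

lemma decr_perm_exists: "\<exists>\<sigma>. \<sigma> permutes {..<m} \<and> decr m (a \<circ> \<sigma>)"
proof -
  let ?xs = "map a [0..<m]"
  let ?ys = "rev (sort ?xs)"
  have "mset ?ys = mset ?xs" by simp
  then obtain \<sigma> where \<sigma>: "\<sigma> permutes {..<length ?xs}" "permute_list \<sigma> ?xs = ?ys"
    by (rule mset_eq_permutation)
  have p: "\<sigma> permutes {..<m}" using \<sigma>(1) by simp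
  have nth: "(a \<circ> \<sigma>) i = ?ys ! i" if "i < m" for i
  proof -
    have "\<sigma> i < m" using permutes_in_image[OF p, of i] that by simp
    then show ?thesis
      using permute_list_nth[OF \<sigma>(1), of i] that unfolding \<sigma>(2)[symmetric] by simp
  qed
  have "(a \<circ> \<sigma>) k \<le> (a \<circ> \<sigma>) i" if "i < k" "k < m" for i k
    unfolding nth[OF that(2)] nth[OF less_trans[OF that]]
    by (rule sorted_rev_nth_mono) (use that in simp_all)
  then show ?thesis using p unfolding decr_def by blast
qed

text \<open>Read backwards, both exponents are sorted lists with the same multiset of
  entries.\<close>

lemma decr_perm_unique:
  assumes "\<sigma> permutes {..<m}" "decr m a" "decr m (a \<circ> \<sigma>)"
  shows "a \<circ> \<sigma> = a"
proof -
  have s: "sorted (rev (map b [0..<m]))" if "decr m b" for b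
    using that unfolding sorted_rev_iff_nth_mono decr_def
    by (auto simp: le_less)
  have "map (a \<circ> \<sigma>) [0..<m] = permute_list \<sigma> (map a [0..<m])"
    using permutes_in_image[OF assms(1)]
    by (intro nth_equalityI) (auto simp: permute_list_nth assms(1))
  then have "mset (map (a \<circ> \<sigma>) [0..<m]) = mset (map a [0..<m])"
    using assms(1) by (metis length_map length_upt minus_nat.diff_0 mset_permute_list)
  then have "mset (rev (map (a \<circ> \<sigma>) [0..<m])) = mset (rev (map a [0..<m]))" by simp
  from properties_for_sort[OF this s[OF assms(3)]]
  have "rev (map (a \<circ> \<sigma>) [0..<m]) = rev (map a [0..<m])"
    using sorted_sort_id[OF s[OF assms(2)]] by simp
  then have "\<forall>i<m. (a \<circ> \<sigma>) i = a i" by simp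
  moreover have "(a \<circ> \<sigma>) i = a i" if "\<not> i < m" for i
    using permutes_not_in[OF assms(1), of i] that by simp
  ultimately show ?thesis by (intro ext) blast
qed

lemma sqsum_perm: "\<sigma> permutes {..<m} \<Longrightarrow> sqsum m (a \<circ> \<sigma>) = sqsum m a"
  using sum.permute[of \<sigma> "{..<m}" "\<lambda>i. (a i)\<^sup>2"] by (simp add: sqsum_def o_def)

text \<open>The rearrangement inequality for one transposition. Only the cross terms change, and the
  gain is 2 (a k - a i) (stair i - stair k), a product of positive differences.\<close>

lemma sqsum_swap_stair:
  assumes ik: "i < k" "k < m" "a i < a k"
  shows "sqsum m (a + stair m) < sqsum m ((a \<circ> transpose i k) + stair m)"
proof -
  have split: "sqsum m b = (b i)\<^sup>2 + (b k)\<^sup>2 + (\<Sum>l\<in>{..<m} - {i, k}. (b l)\<^sup>2)" for b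
  proof -
    have "{..<m} - {i} - {k} = {..<m} - {i, k}" by auto
    then show ?thesis
      using ik sum.remove[of "{..<m}" i "\<lambda>l. (b l)\<^sup>2"] sum.remove[of "{..<m} - {i}" k "\<lambda>l. (b l)\<^sup>2"]
      by (simp add: sqsum_def)
  qed
  have rest: "(\<Sum>l\<in>{..<m} - {i, k}. (((a \<circ> transpose i k) + stair m) l)\<^sup>2) = (\<Sum>l\<in>{..<m} - {i, k}. ((a + stair m) l)\<^sup>2)"
    by (intro sum.cong) (auto simp: transpose_def)
  \<comment> \<open>Writing both differences as u + 1 and v + 1 avoids truncated subtraction; the
    gain becomes 2 (u + 1) (v + 1).\<close>
  obtain u where u: "a k = a i + u + 1" using ik(3) less_iff_Suc_add by auto
  have "stair m k < stair m i" using ik by (simp add: stair_def)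
  then obtain v where v: "stair m i = stair m k + v + 1" using less_iff_Suc_add by auto
  show ?thesis
    unfolding split rest using ik
    by (simp add: u v power2_eq_square algebra_simps)
qed

text \<open>An ascent could be swapped to give a larger value within \<open>A\<close>.\<close>

lemma decr_if_max:
  assumes "a \<in> A" "\<And>\<sigma> a. \<sigma> permutes {..<m} \<Longrightarrow> a \<in> A \<Longrightarrow> a \<circ> \<sigma> \<in> A"
    and "\<And>b. b \<in> A \<Longrightarrow> sqsum m (b + stair m) \<le> sqsum m (a + stair m)"
  shows "decr m a"
  unfolding decr_def
proof (intro allI impI, rule ccontr)
  fix i k assume h: "i < k" "k < m" "\<not> a k \<le> a i"
  have "transpose i k permutes {..<m}" using h by (intro permutes_swap_id) auto
  then have "a \<circ> transpose i k \<in> A" using assms by blast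
  then show False using assms(3) sqsum_swap_stair[OF h(1,2), of a] h(3) by (meson leD not_le_imp_less)
qed

text \<open>The orbit is finite, so a maximum is attained. Any maximum is decreasing by
  \<open>decr_if_max\<close>, and the orbit has only one decreasing member, namely a; so the maximum
  is attained at a alone.\<close>

lemma sqsum_orbit_less:
  assumes s: "\<sigma> permutes {..<m}" and d: "decr m a" and ne: "a \<circ> \<sigma> \<noteq> a"
  shows "sqsum m ((a \<circ> \<sigma>) + stair m) < sqsum m (a + stair m)"
proof -
  define O' where "O' = (\<lambda>\<tau>. a \<circ> \<tau>) ` {\<tau>. \<tau> permutes {..<m}}"
  let ?f = "\<lambda>b. sqsum m (b + stair m)"
  have fin: "finite O'" unfolding O'_def by (simp add: finite_permutations)
  have mem: "b \<circ> \<tau> \<in> O'" if "\<tau> permutes {..<m}" "b \<in> O'" for \<tau> b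
    using that permutes_compose[OF that(1)] by (auto simp: O'_def comp_assoc)
  have dec: "b = a" if "b \<in> O'" "\<And>c. c \<in> O' \<Longrightarrow> ?f c \<le> ?f b" for b
  proof -
    have "decr m b" by (rule decr_if_max[OF that(1) mem that(2)])
    then show ?thesis using that(1) decr_perm_unique[OF _ d] by (auto simp: O'_def)
  qed
  have sO: "a \<circ> \<sigma> \<in> O'" using s by (auto simp: O'_def)
  then have "Max (?f ` O') \<in> ?f ` O'" using fin by (intro Max_in) auto
  then obtain b where b: "b \<in> O'" "?f b = Max (?f ` O')" by auto
  have max: "?f c \<le> ?f b" if "c \<in> O'" for c using that fin b(2) by simp
  have ba: "b = a" using dec[OF b(1) max] .
  have "?f (a \<circ> \<sigma>) \<noteq> ?f a"
    using dec[OF sO] max ne unfolding ba by force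
  then show ?thesis using max[OF sO] unfolding ba by simp
qed

section \<open>Alternants and the Vandermonde determinant\<close>

lemma increasing_perm_id:
  fixes m :: nat
  assumes p: "\<sigma> permutes {..<m}" and inc: "\<And>i k. i < k \<Longrightarrow> k < m \<Longrightarrow> \<sigma> i < \<sigma> k"
  shows "\<sigma> = id"
proof (rule permutes_natset_ge[OF p], rule ballI)
  fix i assume "i \<in> {..<m}"
  then show "i \<le> \<sigma> i"
  proof (induction i)
    case (Suc i) then show ?case using inc[of i "Suc i"] by fastforce
  qed simp
qed

text \<open>The determinant of the 0/1 matrix that records where \<open>c i = b k\<close>, that is,
  the value on the basis vectors with indices c of the alternating form dual to the wedge with
  indices b. \<open>alternant_form\<close> realises it.\<close>

definition alternant :: "nat \<Rightarrow> (nat \<Rightarrow> nat) \<Rightarrow> (nat \<Rightarrow> nat) \<Rightarrow> 'k::comm_ring_1" where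
  "alternant m b c = (\<Sum>\<sigma> | \<sigma> permutes {..<m}. of_int (sign \<sigma>) * (if \<forall>i<m. c i = b (\<sigma> i) then 1 else 0))"

text \<open>Multiplication by the Vandermonde determinant is injective: an exponent a of p for which the
  sum of squares of a + stair m is maximal contributes a term that cannot cancel.\<close>

lemma alternant_nonzero:
  fixes p :: "(nat \<Rightarrow> nat) \<Rightarrow>\<^sub>0 'k::comm_ring_1"
  assumes p: "p \<in> sym_polys m d" "p \<noteq> 0"
  shows "\<exists>b\<in>exps m (d + (m - 1)). pairing p (\<lambda>a. alternant m b (a + stair m)) \<noteq> 0"
proof -
  let ?f = "\<lambda>b. sqsum m (b + stair m)"
  have ne: "supp p \<noteq> {}" using p(2) by (metis keys_eq_empty)
  have "Max (?f ` supp p) \<in> ?f ` supp p" using ne by (intro Max_in) auto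
  then obtain a where a: "a \<in> supp p" "?f a = Max (?f ` supp p)" by auto
  have max: "?f c \<le> ?f a" if "c \<in> supp p" for c using that a(2) by simp
  have mem: "b \<circ> \<sigma> \<in> supp p" if "\<sigma> permutes {..<m}" "b \<in> supp p" for \<sigma> b
    using sym_polys_coef[OF p(1) that(1)] that(2) by (simp add: in_keys_iff)
  have dec: "decr m c" if "c \<in> supp p" "?f c = ?f a" for c
    by (rule decr_if_max[OF that(1) mem]) (use that max in auto)
  let ?b = "a + stair m"
  have strict: "(c + stair m) k < (c + stair m) i" if "decr m c" "i < k" "k < m" for c i k
  proof -
    have "c k \<le> c i" using that by (simp add: decr_def)
    then show ?thesis using that(2,3) by (simp add: stair_def)
  qed
  \<comment> \<open>If c + stair is a rearrangement of a + stair, then c is maximal too and hence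
    decreasing. Both sums are then strictly decreasing, which leaves only the identity permutation
    and c = a.\<close>
  have alt: "alternant m ?b (c + stair m) = (if c = a then 1 else (0::'k))" if c: "c \<in> supp p" for c
  proof -
    have "\<sigma> = id \<and> c = a" if s: "\<sigma> permutes {..<m}" and e: "\<forall>i<m. (c + stair m) i = ?b (\<sigma> i)" for \<sigma>
    proof -
      have "?f c = sqsum m (?b \<circ> \<sigma>)" using e by (simp add: sqsum_def)
      then have "decr m c" using dec[OF c] sqsum_perm[OF s] by simp
      have inc: "\<sigma> i < \<sigma> k" if ik: "i < k" "k < m" for i k
      proof (rule ccontr)
        assume "\<not> \<sigma> i < \<sigma> k"
        then have "\<sigma> k \<le> \<sigma> i" by simp
        moreover have "\<sigma> i < m" using permutes_in_image[OF s, of i] ik by simp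
        ultimately have "?b (\<sigma> i) \<le> ?b (\<sigma> k)"
          using strict[OF dec[OF a(1) refl], of "\<sigma> k" "\<sigma> i"] by (cases "\<sigma> k = \<sigma> i") auto
        then show False using strict[OF \<open>decr m c\<close> ik] e ik by auto
      qed
      have "\<sigma> = id" using increasing_perm_id[OF s inc] .
      moreover from this have "c = a"
        using e by (intro exps_ext[OF sym_polys_supp[OF p(1) c] sym_polys_supp[OF p(1) a(1)]]) simp
      ultimately show ?thesis by blast
    qed
    then have "alternant m ?b (c + stair m) = (\<Sum>\<sigma> | \<sigma> permutes {..<m}. if \<sigma> = id \<and> c = a then 1 else (0::'k))"
      unfolding alternant_def by (intro sum.cong) (auto simp: sign_id)
    also have "\<dots> = (if c = a then 1 else 0)"
      by (simp add: finite_permutations permutes_id)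
    finally show ?thesis .
  qed
  have "pairing p (\<lambda>c. alternant m ?b (c + stair m)) = pairing p (\<lambda>c. if c = a then 1 else 0)"
    by (rule pairing_cong) (rule alt)
  then have "pairing p (\<lambda>c. alternant m ?b (c + stair m)) \<noteq> 0"
    using a(1) by (simp add: pairing_delta in_keys_iff)
  moreover have "?b \<in> exps m (d + (m - 1))"
    using exps_add[OF sym_polys_supp[OF p(1) a(1)] stair_exps] .
  ultimately show ?thesis by blast
qed

text \<open>The sum runs over the set of rearrangements, not over permutations: the latter would
  multiply every term by the order of the stabiliser of a, which may be 0 in the field.\<close>

definition orbit_sum :: "nat \<Rightarrow> (nat \<Rightarrow> nat) \<Rightarrow> (nat \<Rightarrow> nat) \<Rightarrow>\<^sub>0 'k::comm_ring_1" where
  "orbit_sum m a = (\<Sum>b\<in>(\<lambda>\<sigma>. a \<circ> \<sigma>) ` {\<sigma>. \<sigma> permutes {..<m}}. mon b 1)"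

lemma orbit_sum_sym:
  assumes a: "a \<in> exps m d"
  shows "(orbit_sum m a :: _ \<Rightarrow>\<^sub>0 'k::comm_ring_1) \<in> sym_polys m d"
proof -
  let ?O = "(\<lambda>\<sigma>. a \<circ> \<sigma>) ` {\<sigma>. \<sigma> permutes {..<m}}"
  have mem: "b \<circ> \<sigma> \<in> ?O" if "\<sigma> permutes {..<m}" "b \<in> ?O" for \<sigma> b
    using that permutes_compose[OF that(1)] by (auto simp: comp_assoc)
  have "supp (orbit_sum m a :: _ \<Rightarrow>\<^sub>0 'k) \<subseteq> ?O"
    unfolding orbit_sum_def using keys_sum by (rule order_trans) (auto split: if_splits)
  then have 1: "supp (orbit_sum m a :: _ \<Rightarrow>\<^sub>0 'k) \<subseteq> exps m d" using exps_perm[OF a] by auto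
  have "pairing (orbit_sum m a) (\<lambda>b. g (b \<circ> \<sigma>)) = pairing (orbit_sum m a) g"
    if s: "\<sigma> permutes {..<m}" for \<sigma> and g :: "_ \<Rightarrow> 'k"
  proof -
    have i: "inv \<sigma> permutes {..<m}" using s by (rule permutes_inv)
    have "(\<Sum>b\<in>?O. g (b \<circ> \<sigma>)) = (\<Sum>b\<in>?O. g b)"
      by (rule sum.reindex_bij_witness[of _ "\<lambda>a. a \<circ> inv \<sigma>" "\<lambda>a. a \<circ> \<sigma>"])
        (use mem[OF s] mem[OF i] in \<open>simp_all only: comp_assoc permutes_inv_o[OF s] comp_id\<close>)
    then show ?thesis by (simp add: orbit_sum_def pairing_sum)
  qed
  with 1 show ?thesis by (simp add: sym_polys_def)
qed

section \<open>Products of elementary symmetric polynomials\<close>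

definition ind :: "nat set \<Rightarrow> nat \<Rightarrow> nat" where
  "ind S = (\<lambda>i. if i \<in> S then 1 else 0)"

lemma ind_inject: "ind S = ind T \<longleftrightarrow> S = T"
  by (auto simp: ind_def fun_eq_iff split: if_splits)

definition elem_sym :: "nat \<Rightarrow> nat \<Rightarrow> (nat \<Rightarrow> nat) \<Rightarrow>\<^sub>0 'k::comm_ring_1" where
  "elem_sym m r = (\<Sum>S | S \<subseteq> {..<m} \<and> card S = r. mon (ind S) 1)"

lemma finite_subsets_card [simp]: "finite {S. S \<subseteq> {..<m::nat} \<and> card S = r}"
  by (rule finite_subset[of _ "Pow {..<m}"]) auto

lemma elem_sym_sym: "(elem_sym m r :: _ \<Rightarrow>\<^sub>0 'k::comm_ring_1) \<in> sym_polys m 1"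
proof -
  let ?A = "{S. S \<subseteq> {..<m} \<and> card S = r}"
  have "supp (elem_sym m r :: _ \<Rightarrow>\<^sub>0 'k) \<subseteq> ind ` ?A"
    unfolding elem_sym_def using keys_sum by (rule order_trans) (auto split: if_splits)
  also have "\<dots> \<subseteq> exps m 1" by (auto simp: ind_def exps_def)
  finally have 1: "supp (elem_sym m r :: _ \<Rightarrow>\<^sub>0 'k) \<subseteq> exps m 1" .
  have "pairing (elem_sym m r) (\<lambda>b. g (b \<circ> \<sigma>)) = pairing (elem_sym m r) g"
    if s: "\<sigma> permutes {..<m}" for \<sigma> and g :: "_ \<Rightarrow> 'k"
  proof -
    have i: "inv \<sigma> permutes {..<m}" using s by (rule permutes_inv)
    have e: "ind S \<circ> \<sigma> = ind (inv \<sigma> ` S)" for S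
    proof
      fix i
      have "\<sigma> i \<in> S \<longleftrightarrow> i \<in> inv \<sigma> ` S"
        using permutes_inverses[OF s] by (metis image_iff)
      then show "(ind S \<circ> \<sigma>) i = ind (inv \<sigma> ` S) i" by (simp add: ind_def)
    qed
    have mem: "\<tau> ` S \<in> ?A" if "\<tau> permutes {..<m}" "S \<in> ?A" for \<tau> S
      using that permutes_image[OF that(1)] card_image[OF permutes_inj_on[OF that(1)], of S] by auto
    have "(\<Sum>S\<in>?A. g (ind S \<circ> \<sigma>)) = (\<Sum>S\<in>?A. g (ind S))"
      by (rule sum.reindex_bij_witness[of _ "\<lambda>S. \<sigma> ` S" "\<lambda>S. inv \<sigma> ` S"])
        (use mem[OF s] mem[OF i] in \<open>simp_all only: e image_image permutes_inverses[OF s] image_ident\<close>)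
    then show ?thesis by (simp add: elem_sym_def pairing_sum)
  qed
  with 1 show ?thesis by (simp add: sym_polys_def)
qed

lemma coef_scale: "coef (mon 0 c * p) a = c * coef p a"
  for p :: "'a::monoid_add \<Rightarrow>\<^sub>0 'k::comm_ring_1"
  using pairing_scale[of c p "\<lambda>b. if b = a then 1 else 0"] by (simp add: pairing_delta)

text \<open>The coefficients at initial segments are thus dual to the elementary symmetric
  polynomials and serve as coordinates in \<open>coords_DU\<close>.\<close>

lemma coef_elem_sym_initial:
  assumes "r' \<le> m"
  shows "coef (elem_sym m r) (ind {..<r'}) = (if r = r' then 1 else 0)"
proof -
  have "coef (elem_sym m r) (ind {..<r'}) =
      (\<Sum>S | S \<subseteq> {..<m} \<and> card S = r. if S = {..<r'} then 1 else 0)"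
    unfolding elem_sym_def lookup_sum
    by (intro sum.cong) (auto simp: lookup_single when_def ind_inject)
  then show ?thesis using assms by (auto simp: sum.delta')
qed

text \<open>The difference of both sides has no coefficient at an initial segment, and every
  exponent with entries 0 and 1 is a rearrangement of one. Hence the divided power of U has the
  elementary symmetric tensors as a basis.\<close>

lemma sym_polys_1_expand:
  fixes p :: "(nat \<Rightarrow> nat) \<Rightarrow>\<^sub>0 'k::comm_ring_1"
  assumes p: "p \<in> sym_polys m 1"
  shows "p = (\<Sum>r\<le>m. mon 0 (coef p (ind {..<r})) * elem_sym m r)"
proof -
  define q where "q = p - (\<Sum>r\<le>m. mon 0 (coef p (ind {..<r})) * elem_sym m r)"
  have q: "q \<in> sym_polys m 1"
    unfolding q_def by (intro sym_polys_diff p sym_polys_sum sym_polys_scale elem_sym_sym)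
  have q0: "coef q (ind {..<r}) = 0" if "r \<le> m" for r
  proof -
    have "(\<Sum>r'\<le>m. coef p (ind {..<r'}) * coef (elem_sym m r') (ind {..<r})) =
        (\<Sum>r'\<le>m. if r' = r then coef p (ind {..<r'}) else 0)"
      using that by (intro sum.cong) (simp_all add: coef_elem_sym_initial)
    then show ?thesis using that by (simp add: q_def lookup_minus lookup_sum coef_scale)
  qed
  have "coef q a = 0" for a
  proof (cases "a \<in> exps m 1")
    case True
    obtain \<sigma> where s: "\<sigma> permutes {..<m}" "decr m (a \<circ> \<sigma>)" using decr_perm_exists by blast
    define b where "b = a \<circ> \<sigma>"
    have b: "b \<in> exps m 1" using exps_perm[OF True s(1)] by (simp add: b_def)
    have b01: "b i = 0 \<or> b i = 1" "i \<ge> m \<Longrightarrow> b i = 0" for i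
      using b unfolding exps_def by (cases "i < m"; force simp: le_Suc_eq)+
    \<comment> \<open>The length of the leading run of ones. It is at most m because the exponent
      vanishes at m.\<close>
    define r where "r = (LEAST i. b i = 0)"
    have "b m = 0" using b01 by simp
    then have r: "b r = 0" "r \<le> m" unfolding r_def by (auto intro: LeastI Least_le)
    have "b i = ind {..<r} i" for i
    proof (cases "i < r")
      case True
      then have "b i \<noteq> 0" unfolding r_def by (rule not_less_Least)
      then show ?thesis using True b01(1)[of i] by (simp add: ind_def)
    next
      case False
      have "b i = 0"
      proof (cases "i < m")
        case True
        then have "b i \<le> b r" using s(2) False unfolding b_def[symmetric] decr_def by (cases "r = i") auto
        then show ?thesis using r by simp
      qed (use b01 in simp)
      then show ?thesis using False by (simp add: ind_def)
    qed
    then have "b = ind {..<r}" by blast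
    then show ?thesis using q0[OF r(2)] sym_polys_coef[OF q s(1), of a] by (simp add: b_def)
  qed (use sym_polys_supp[OF q] in \<open>auto simp: in_keys_iff\<close>)
  then have "q = 0" by (intro poly_mapping_eqI) simp
  then show ?thesis by (simp add: q_def)
qed

text \<open>Sorted lists stand for multisets of size j. The entry 0 is allowed: e_0 = 1 fills up a
  product of fewer than j nonconstant factors.\<close>

definition indices :: "nat \<Rightarrow> nat \<Rightarrow> nat list set" where
  "indices m j = {R. length R = j \<and> sorted R \<and> set R \<subseteq> {..m}}"

lemma finite_indices [simp]: "finite (indices m j)"
  by (rule finite_subset[OF _ finite_lists_length_eq[of "{..m}" j]]) (auto simp: indices_def)

definition elem_prod :: "nat \<Rightarrow> nat list \<Rightarrow> (nat \<Rightarrow> nat) \<Rightarrow>\<^sub>0 'k::comm_ring_1" where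
  "elem_prod m R = prod_list (map (elem_sym m) R)"

lemma elem_prod_sym: "elem_prod m R \<in> sym_polys m (length R)"
  using sym_polys_prod_list[of "map (elem_sym m) R" m 1] elem_sym_sym by (auto simp: elem_prod_def)

definition conj_part :: "nat list \<Rightarrow> nat \<Rightarrow> nat" where
  "conj_part R = (\<lambda>i. length (filter (\<lambda>r. i < r) R))"

text \<open>The sum of squares of the conjugate partition (see \<open>sqsum_conj_part\<close>),
  expressed through R alone: two initial segments of lengths r and r' meet in min r r'
  elements.\<close>

definition overlap :: "nat list \<Rightarrow> nat" where
  "overlap R = (\<Sum>k<length R. \<Sum>l<length R. min (R ! k) (R ! l))"

lemma conj_part_sum: "conj_part R = (\<Sum>k<length R. ind {..<R ! k})"
proof
  fix i
  have "(\<Sum>k<length R. ind {..<R ! k}) i = (\<Sum>k<length R. if i < R ! k then 1 else 0)"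
    unfolding sum_fun_apply by (simp add: ind_def)
  also have "\<dots> = card {k. k < length R \<and> i < R ! k}"
    by (simp add: sum.If_cases lessThan_def Int_def)
  finally show "conj_part R i = (\<Sum>k<length R. ind {..<R ! k}) i"
    by (simp add: conj_part_def length_filter_conv_card)
qed

text \<open>Squaring the sum produces products of indicators, and summing such a product over the
  variables counts the common elements of two subsets.\<close>

lemma sqsum_ind:
  assumes "\<And>k. k < j \<Longrightarrow> S k \<subseteq> {..<m}"
  shows "sqsum m (\<Sum>k<j. ind (S k)) = (\<Sum>k<j. \<Sum>l<j. card (S k \<inter> S l))"
proof -
  have c: "(\<Sum>i<m. ind (S k) i * ind (S l) i) = card (S k \<inter> S l)" if "k < j" "l < j" for k l
  proof -
    have "(\<Sum>i<m. ind (S k) i * ind (S l) i) = (\<Sum>i<m. if i \<in> S k \<inter> S l then 1 else 0)"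
      by (intro sum.cong) (auto simp: ind_def)
    also have "\<dots> = card ({..<m} \<inter> (S k \<inter> S l))" by (simp add: sum.If_cases Int_def)
    also have "{..<m} \<inter> (S k \<inter> S l) = S k \<inter> S l" using assms that by blast
    finally show ?thesis .
  qed
  have "sqsum m (\<Sum>k<j. ind (S k)) = (\<Sum>i<m. \<Sum>k<j. \<Sum>l<j. ind (S k) i * ind (S l) i)"
    by (simp add: sqsum_def sum_fun_apply power2_eq_square sum_product)
  also have "\<dots> = (\<Sum>k<j. \<Sum>i<m. \<Sum>l<j. ind (S k) i * ind (S l) i)" by (rule sum.swap)
  also have "\<dots> = (\<Sum>k<j. \<Sum>l<j. \<Sum>i<m. ind (S k) i * ind (S l) i)"
    by (intro sum.cong refl sum.swap)
  also have "\<dots> = (\<Sum>k<j. \<Sum>l<j. card (S k \<inter> S l))"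
    by (intro sum.cong refl c) auto
  finally show ?thesis .
qed

lemma card_Int_le_min:
  assumes "finite S" "finite T"
  shows "card (S \<inter> T) \<le> min (card S) (card T)"
    and "card (S \<inter> T) = min (card S) (card T) \<Longrightarrow> S \<subseteq> T \<or> T \<subseteq> S"
proof -
  show "card (S \<inter> T) \<le> min (card S) (card T)" using assms by (simp add: card_mono)
  assume "card (S \<inter> T) = min (card S) (card T)"
  then have "card (S \<inter> T) = card S \<or> card (S \<inter> T) = card T" by (auto simp: min_def)
  then have "S \<inter> T = S \<or> S \<inter> T = T"
    using assms card_subset_eq[of S "S \<inter> T"] card_subset_eq[of T "S \<inter> T"] by auto
  then show "S \<subseteq> T \<or> T \<subseteq> S" by auto
qed

text \<open>The sum of squares of the exponent of a term in a product of elementary symmetric polynomials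
  is maximal when the chosen subsets form a chain; if the exponent is also weakly decreasing,
  then the subsets are initial segments.\<close>

lemma sqsum_ind_bound:
  assumes S: "\<And>k. k < length R \<Longrightarrow> S k \<subseteq> {..<m} \<and> card (S k) = R ! k"
  defines "a \<equiv> (\<Sum>k<length R. ind (S k))"
  shows "sqsum m a \<le> overlap R"
    and "\<lbrakk>overlap R \<le> sqsum m a; decr m a; k < length R\<rbrakk> \<Longrightarrow> S k = {..<R ! k}"
proof -
  let ?j = "length R"
  have fin: "finite (S k)" if "k < ?j" for k using S[OF that] finite_subset by blast
  have n: "sqsum m a = (\<Sum>k<?j. \<Sum>l<?j. card (S k \<inter> S l))"
    unfolding a_def using S by (intro sqsum_ind) blast
  have le: "card (S k \<inter> S l) \<le> min (R ! k) (R ! l)" if "k < ?j" "l < ?j" for k l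
    using card_Int_le_min(1)[OF fin[OF that(1)] fin[OF that(2)]] S that by metis
  show "sqsum m a \<le> overlap R"
    unfolding n overlap_def by (intro sum_mono le) auto
  assume h: "overlap R \<le> sqsum m a" and d: "decr m a" and k: "k < ?j"
  \<comment> \<open>A single pair of subsets that is not nested already makes the double sum
    strictly smaller than \<open>overlap R\<close>.\<close>
  have chain: "S k \<subseteq> S l \<or> S l \<subseteq> S k" if l: "l < ?j" for l
  proof (rule ccontr)
    assume "\<not> ?thesis"
    then have "card (S k \<inter> S l) \<noteq> min (R ! k) (R ! l)"
      using card_Int_le_min(2)[OF fin[OF k] fin[OF l]] S k l by metis
    then have lt: "card (S k \<inter> S l) < min (R ! k) (R ! l)" using le[OF k l] by (rule le_neq_trans[rotated])
    have "(\<Sum>k<?j. \<Sum>l<?j. card (S k \<inter> S l)) < (\<Sum>k<?j. \<Sum>l<?j. min (R ! k) (R ! l))"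
    proof (rule sum_strict_mono_ex1)
      show "\<forall>k\<in>{..<?j}. (\<Sum>l<?j. card (S k \<inter> S l)) \<le> (\<Sum>l<?j. min (R ! k) (R ! l))"
        by (intro ballI sum_mono le) auto
      show "\<exists>k\<in>{..<?j}. (\<Sum>l<?j. card (S k \<inter> S l)) < (\<Sum>l<?j. min (R ! k) (R ! l))"
        by (rule bexI[of _ k], rule sum_strict_mono_ex1) (use le k l lt in auto)
    qed simp
    then show False using h n by (simp add: overlap_def)
  qed
  have val: "a i = card {l. l < ?j \<and> i \<in> S l}" for i
  proof -
    have "a i = (\<Sum>l<?j. if i \<in> S l then 1 else 0)"
      unfolding a_def sum_fun_apply by (simp add: ind_def)
    then show ?thesis by (simp add: sum.If_cases lessThan_def Int_def)
  qed
  \<comment> \<open>By nestedness, every subset that contains i contains \<open>S k\<close> and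
    therefore i', while \<open>S k\<close> itself contains only i'. So the entry at i would be
    smaller than the entry at i', against monotonicity.\<close>
  have down: "i \<in> S k" if i: "i < i'" "i' \<in> S k" for i i'
  proof (rule ccontr)
    assume ni: "i \<notin> S k"
    have "{l. l < ?j \<and> i \<in> S l} \<subset> {l. l < ?j \<and> i' \<in> S l}"
      using chain ni i k by blast
    then have "a i < a i'" unfolding val by (intro psubset_card_mono) auto
    moreover have "i' < m" using S[OF k] i by blast
    ultimately show False using d i(1) by (auto simp: decr_def not_less[symmetric])
  qed
  show "S k = {..<R ! k}"
  proof (cases "S k = {}")
    case True then show ?thesis using S[OF k] by simp
  next
    case False
    then have "Max (S k) \<in> S k" using fin[OF k] by simp
    then have "i \<in> S k" if "i \<le> Max (S k)" for i
      using down[of i "Max (S k)"] that by (cases "i = Max (S k)") auto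
    then have "S k = {..Max (S k)}"
      using fin[OF k] by auto
    then have "S k = {..<Suc (Max (S k))}" by (simp only: lessThan_Suc_atMost)
    then show ?thesis using S[OF k] by (metis card_lessThan)
  qed
qed

section \<open>Unitriangularity of the products of elementary symmetric polynomials\<close>

lemma elem_prod_expand:
  "elem_prod m R = (\<Sum>f\<in>PiE {..<length R} (\<lambda>k. {S. S \<subseteq> {..<m} \<and> card S = R ! k}).
     mon (\<Sum>k<length R. ind (f k)) (1::'k::comm_ring_1))"
proof -
  have p: "(\<Prod>k\<in>A. mon (ind (f k)) 1) = mon (\<Sum>k\<in>A. ind (f k)) (1::'k)" if "finite A" for A :: "nat set" and f
    using that
  proof (induction A)
    case empty show ?case by (simp only: prod.empty sum.empty single_one)
  next
    case (insert x A) then show ?case by (simp only: prod.insert[OF insert(1,2)] sum.insert[OF insert(1,2)] mult_single mult_1_right)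
  qed
  have "elem_prod m R = (\<Prod>k\<in>{..<length R}. elem_sym m (R ! k) :: _ \<Rightarrow>\<^sub>0 'k)"
    unfolding elem_prod_def prod.list_conv_set_nth by (simp add: atLeast0LessThan)
  also have "\<dots> = (\<Sum>f\<in>PiE {..<length R} (\<lambda>k. {S. S \<subseteq> {..<m} \<and> card S = R ! k}).
      \<Prod>k<length R. mon (ind (f k)) 1)"
    unfolding elem_sym_def by (rule prod_sum_PiE) auto
  finally show ?thesis by (simp add: p)
qed

lemma elem_prod_supp:
  assumes "a \<in> supp (elem_prod m R :: _ \<Rightarrow>\<^sub>0 'k::comm_ring_1)"
  shows "sqsum m a \<le> overlap R"
proof -
  let ?F = "PiE {..<length R} (\<lambda>k. {S. S \<subseteq> {..<m} \<and> card S = R ! k})"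
  have "supp (elem_prod m R :: _ \<Rightarrow>\<^sub>0 'k) \<subseteq> (\<lambda>f. \<Sum>k<length R. ind (f k)) ` ?F"
    unfolding elem_prod_expand using keys_sum by (rule order_trans) (auto split: if_splits)
  then obtain f where "f \<in> ?F" "a = (\<Sum>k<length R. ind (f k))" using assms by blast
  then show ?thesis using sqsum_ind_bound(1)[of R f m] by (auto simp: PiE_def Pi_def)
qed

text \<open>At such an exponent \<open>sqsum_ind_bound\<close> forces every chosen subset to be an
  initial segment, so at most one term of the expanded product contributes. The statement covers
  both the leading coefficient 1 and the vanishing at other decreasing exponents of the same or a
  higher level.\<close>

lemma elem_prod_coef:
  assumes R: "set R \<subseteq> {..m}" and a: "decr m a" "overlap R \<le> sqsum m a"
  shows "coef (elem_prod m R) a = (if a = conj_part R then 1 else 0 :: 'k::comm_ring_1)"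
proof -
  let ?F = "PiE {..<length R} (\<lambda>k. {S. S \<subseteq> {..<m} \<and> card S = R ! k})"
  let ?f = "restrict (\<lambda>k. {..<R ! k}) {..<length R}"
  have "R ! k \<le> m" if "k < length R" for k using R nth_mem[OF that] by auto
  then have f0: "?f \<in> ?F" by auto
  have c: "(\<Sum>k<length R. ind (?f k)) = conj_part R"
    unfolding conj_part_sum by (intro sum.cong) auto
  have e: "(\<Sum>k<length R. ind (f k)) = a \<longleftrightarrow> f = ?f \<and> a = conj_part R" if f: "f \<in> ?F" for f
  proof
    assume s: "(\<Sum>k<length R. ind (f k)) = a"
    have fS: "f k \<subseteq> {..<m} \<and> card (f k) = R ! k" if "k < length R" for k
      using f that by (auto simp: PiE_def Pi_def)
    have "f k = {..<R ! k}" if "k < length R" for k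
      by (rule sqsum_ind_bound(2)[where S=f and m=m]) (use fS a s that in auto)
    then have "f = ?f" using f by (intro extensionalityI[of f "{..<length R}"]) (auto simp: PiE_def)
    then show "f = ?f \<and> a = conj_part R" using s c by simp
  next
    assume "f = ?f \<and> a = conj_part R"
    then show "(\<Sum>k<length R. ind (f k)) = a" using c by simp
  qed
  have fin: "finite ?F" by (intro finite_PiE) auto
  have "coef (elem_prod m R) a = (\<Sum>f\<in>?F. if f = ?f then if a = conj_part R then 1 else 0 else (0::'k))"
    unfolding elem_prod_expand lookup_sum
    by (intro sum.cong refl) (simp add: lookup_single when_def e)
  then show ?thesis using f0 fin by (simp add: sum.delta')
qed

lemma decr_conj_part: "decr m (conj_part R)"
  unfolding decr_def conj_part_def
proof (intro allI impI)
  fix i k :: nat assume "i < k"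
  then show "length (filter (\<lambda>r. k < r) R) \<le> length (filter (\<lambda>r. i < r) R)"
    by (induction R) auto
qed

lemma sqsum_conj_part:
  assumes "set R \<subseteq> {..m}"
  shows "sqsum m (conj_part R) = overlap R"
proof -
  have "sqsum m (conj_part R) = (\<Sum>k<length R. \<Sum>l<length R. card ({..<R ! k} \<inter> {..<R ! l}))"
    unfolding conj_part_sum using assms by (intro sqsum_ind) (meson atMost_iff lessThan_subset_iff nth_mem subsetD)
  also have "\<dots> = overlap R"
  proof -
    have "{..<x} \<inter> {..<y} = {..<min x y}" for x y :: nat by auto
    then show ?thesis by (simp add: overlap_def)
  qed
  finally show ?thesis .
qed

text \<open>The multiplicity of a positive entry is the difference of two successive values of the
  conjugate partition. Entries 0 leave no trace there; their number follows from the common length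
  j.\<close>

lemma conj_part_inject:
  assumes R: "R \<in> indices m j" "R' \<in> indices m j" and eq: "conj_part R = conj_part R'"
  shows "R = R'"
proof -
  have "length (filter (\<lambda>r. r = i) R) = length (filter (\<lambda>r. r = i) R')" for i
  proof (cases i)
    case 0
    have "length (filter (\<lambda>r. r = 0) xs) + conj_part xs 0 = length xs" for xs
      unfolding conj_part_def by (induction xs) auto
    from this[of R] this[of R'] show ?thesis using R eq 0 by (simp add: indices_def)
  next
    case (Suc l)
    have "length (filter (\<lambda>r. r = Suc l) xs) + conj_part xs (Suc l) = conj_part xs l" for xs
      unfolding conj_part_def by (induction xs) auto
    from this[of R] this[of R'] show ?thesis using eq Suc by simp
  qed
  then have "mset R = mset R'"
    by (intro multiset_eqI) (simp add: count_mset count_list_eq_length_filter eq_commute)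
  then show ?thesis using R by (metis (no_types, lifting) indices_def mem_Collect_eq properties_for_sort sorted_sort_id)
qed

text \<open>Conjugation of partitions is an involution, so R is the conjugate \<open>h\<close> of a.
  Since the entries of a are at most j, the first j values of \<open>h\<close> are enough.\<close>

lemma conj_part_surj:
  assumes a: "a \<in> exps m j" "decr m a"
  shows "\<exists>R\<in>indices m j. conj_part R = a"
proof -
  define h where "h k = card {i. i < m \<and> k < a i}" for k
  have hm: "h k \<le> m" for k unfolding h_def using card_mono[of "{..<m}" "{i. i < m \<and> k < a i}"] by auto
  \<comment> \<open>As a is decreasing, the positions with value above k form an initial segment,
    and \<open>h k\<close> is its length.\<close>
  have ih: "i < h k \<longleftrightarrow> k < a i" if "i < m" for i k
  proof
    assume ki: "k < a i"
    have "{..i} \<subseteq> {i. i < m \<and> k < a i}"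
    proof
      fix l assume "l \<in> {..i}"
      then have "a i \<le> a l" "l < m" using a(2) that by (cases "l = i"; simp add: decr_def)+
      then show "l \<in> {i. i < m \<and> k < a i}" using ki by simp
    qed
    then have "card {..i} \<le> h k" unfolding h_def by (intro card_mono) auto
    then show "i < h k" by simp
  next
    assume "i < h k"
    show "k < a i"
    proof (rule ccontr)
      assume "\<not> k < a i"
      have "{i. i < m \<and> k < a i} \<subseteq> {..<i}"
      proof
        fix l assume l: "l \<in> {i. i < m \<and> k < a i}"
        have "l < i"
        proof (rule ccontr)
          assume "\<not> l < i"
          then have "a l \<le> a i" using a(2) l by (cases "l = i"; simp add: decr_def)
          then show False using l \<open>\<not> k < a i\<close> by simp
        qed
        then show "l \<in> {..<i}" by simp
      qed
      then have "h k \<le> card {..<i}" unfolding h_def by (intro card_mono) auto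
      then show False using \<open>i < h k\<close> by simp
    qed
  qed
  define R where "R = sort (map h [0..<j])"
  have "R \<in> indices m j" using hm by (auto simp: R_def indices_def)
  moreover have "conj_part R i = a i" for i
  proof -
    have "conj_part R i = length (filter (\<lambda>r. i < r) (map h [0..<j]))"
    proof -
      have "mset (filter (\<lambda>r. i < r) R) = mset (filter (\<lambda>r. i < r) (map h [0..<j]))"
        by (simp add: R_def)
      then show ?thesis unfolding conj_part_def by (rule mset_eq_length)
    qed
    also have "\<dots> = card {k. k < j \<and> i < h k}"
      unfolding length_filter_conv_card by (rule arg_cong[of _ _ card]) auto
    also have "{k. k < j \<and> i < h k} = {..<a i}"
    proof (cases "i < m")
      case True
      then have "a i \<le> j" using a(1) by (simp add: exps_def)
      then have "{k. k < j \<and> k < a i} = {..<a i}" by auto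
      then show ?thesis by (simp only: ih[OF True])
    next
      case False
      then have "a i = 0" using a(1) by (simp add: exps_def)
      moreover have "\<not> i < h k" for k using hm[of k] False by simp
      ultimately show ?thesis by simp
    qed
    finally show ?thesis by simp
  qed
  ultimately show ?thesis by blast
qed

lemma indices_set: "R \<in> indices m j \<Longrightarrow> set R \<subseteq> {..m}"
  by (simp add: indices_def)

text \<open>Among the lists with nonzero coefficient pick Q of maximal overlap; at the leading
  exponent of Q no other product contributes.\<close>

lemma elem_prod_independent:
  fixes c :: "nat list \<Rightarrow> 'k::comm_ring_1"
  assumes z: "(\<Sum>R\<in>indices m j. mon 0 (c R) * elem_prod m R) = 0" and R0: "R0 \<in> indices m j"
  shows "c R0 = 0"
proof (rule ccontr)
  assume "c R0 \<noteq> 0"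
  define A where "A = {R \<in> indices m j. c R \<noteq> 0}"
  have "finite A" "A \<noteq> {}" using R0 \<open>c R0 \<noteq> 0\<close> by (auto simp: A_def)
  then have "Max (overlap ` A) \<in> overlap ` A" by (intro Max_in) auto
  then obtain Q where Q: "Q \<in> A" "overlap Q = Max (overlap ` A)" by auto
  have max: "overlap R \<le> overlap Q" if "R \<in> A" for R using that Q(2) \<open>finite A\<close> by simp
  have Qi: "Q \<in> indices m j" using Q(1) by (simp add: A_def)
  have "c R * coef (elem_prod m R) (conj_part Q) = (if R = Q then c Q else 0)" if R: "R \<in> indices m j" for R
  proof (cases "R \<in> A")
    case True
    have "coef (elem_prod m R) (conj_part Q) = (if conj_part Q = conj_part R then 1 else 0 :: 'k)"
      by (rule elem_prod_coef[OF indices_set[OF R] decr_conj_part])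
        (simp add: sqsum_conj_part[OF indices_set[OF Qi]] max[OF True])
    then show ?thesis using conj_part_inject[OF Qi R] by auto
  next
    case False
    then show ?thesis using R Q(1) by (auto simp: A_def)
  qed
  then have "coef (\<Sum>R\<in>indices m j. mon 0 (c R) * elem_prod m R) (conj_part Q) = (\<Sum>R\<in>indices m j. if R = Q then c Q else 0)"
    unfolding lookup_sum coef_scale by (intro sum.cong) auto
  then show False using z Qi Q(1) by (simp add: A_def)
qed

text \<open>Induction on a strict bound K for the sums of squares of the exponents: the terms on the
  top level are removed by products whose leading exponents lie on that level.\<close>

lemma elem_prod_span:
  fixes p :: "(nat \<Rightarrow> nat) \<Rightarrow>\<^sub>0 'k::comm_ring_1"
  assumes "p \<in> sym_polys m j"
  shows "\<exists>c. p = (\<Sum>R\<in>indices m j. mon 0 (c R) * elem_prod m R)"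
proof -
  have "\<exists>c. p = (\<Sum>R\<in>indices m j. mon 0 (c R) * elem_prod m R)"
    if "p \<in> sym_polys m j" "\<And>a. a \<in> supp p \<Longrightarrow> sqsum m a < K" for K and p :: "(nat \<Rightarrow> nat) \<Rightarrow>\<^sub>0 'k"
    using that
  proof (induction K arbitrary: p)
    case 0
    then have "p = 0" by (metis all_not_in_conv keys_eq_empty not_less_zero)
    then show ?case by (intro exI[of _ "\<lambda>_. 0"]) simp
  next
    case (Suc K)
    \<comment> \<open>On decreasing exponents of level K the products of that level have a 0/1
      diagonal coefficient matrix, so their multipliers can be read off from p.\<close>
    define c where "c R = (if overlap R = K then coef p (conj_part R) else 0)" for R
    define e where "e = (\<Sum>R\<in>indices m j. mon 0 (c R) * elem_prod m R)"
    have e: "e \<in> sym_polys m j"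
      unfolding e_def using elem_prod_sym by (intro sym_polys_sum sym_polys_scale) (auto simp: indices_def)
    have ce: "coef e a = (\<Sum>R\<in>indices m j. c R * coef (elem_prod m R) a)" for a
      by (simp add: e_def lookup_sum coef_scale)
    have pe: "p - e \<in> sym_polys m j" by (intro sym_polys_diff Suc.prems e)
    have dec: "coef (p - e) a = 0" if a: "a \<in> exps m j" "decr m a" "sqsum m a = K" for a
    proof -
      obtain Q where Q: "Q \<in> indices m j" "conj_part Q = a" using conj_part_surj[OF a(1,2)] by blast
      have oQ: "overlap Q = K" using sqsum_conj_part[OF indices_set[OF Q(1)]] Q(2) a(3) by simp
      have "c R * coef (elem_prod m R) a = (if R = Q then coef p a else 0)" if R: "R \<in> indices m j" for R
      proof (cases "overlap R = K")
        case True
        have "coef (elem_prod m R) a = (if a = conj_part R then 1 else 0 :: 'k)"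
          by (rule elem_prod_coef[OF indices_set[OF R] a(2)]) (simp add: True a(3))
        moreover have "a = conj_part R \<longleftrightarrow> R = Q"
          using conj_part_inject[OF R Q(1)] Q(2) by metis
        ultimately show ?thesis using True Q(2) by (simp add: c_def)
      next
        case False
        then have "R \<noteq> Q" using oQ by blast
        then show ?thesis using False by (simp add: c_def)
      qed
      then have "coef e a = (\<Sum>R\<in>indices m j. if R = Q then coef p a else 0)"
        unfolding ce by (intro sum.cong) auto
      then show ?thesis using Q(1) by (simp add: lookup_minus)
    qed
    have "sqsum m a < K" if a: "a \<in> supp (p - e)" for a
    proof -
      have "sqsum m a \<le> K"
      proof (rule ccontr)
        assume h: "\<not> sqsum m a \<le> K"
        then have "coef p a = 0" using Suc.prems(2)[of a] by (cases "a \<in> supp p") (simp_all add: in_keys_iff)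
        moreover have "c R * coef (elem_prod m R) a = 0" for R
        proof (cases "overlap R = K")
          case True
          then have "a \<notin> supp (elem_prod m R :: _ \<Rightarrow>\<^sub>0 'k)" using elem_prod_supp h by blast
          then show ?thesis by (simp add: in_keys_iff)
        qed (simp add: c_def)
        ultimately show False using a by (simp add: in_keys_iff lookup_minus ce)
      qed
      \<comment> \<open>Symmetry extends the cancellation from decreasing exponents to their whole
        orbits.\<close>
      moreover have "sqsum m a \<noteq> K"
      proof
        assume aK: "sqsum m a = K"
        obtain \<sigma> where s: "\<sigma> permutes {..<m}" "decr m (a \<circ> \<sigma>)" using decr_perm_exists by blast
        have "coef (p - e) (a \<circ> \<sigma>) = 0"
          by (rule dec[OF exps_perm[OF sym_polys_supp[OF pe a] s(1)] s(2)]) (simp add: sqsum_perm[OF s(1)] aK)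
        then show False using sym_polys_coef[OF pe s(1)] a by (simp add: in_keys_iff)
      qed
      ultimately show ?thesis by simp
    qed
    from Suc.IH[OF pe this] obtain c' where c': "p - e = (\<Sum>R\<in>indices m j. mon 0 (c' R) * elem_prod m R)" by blast
    have "p = (\<Sum>R\<in>indices m j. mon 0 (c' R + c R) * elem_prod m R)"
      using c' by (simp add: e_def single_add algebra_simps sum.distrib)
    then show ?case by (intro exI[of _ "\<lambda>R. c' R + c R"])
  qed
  \<comment> \<open>For p = 0 this is a maximum over the empty set, but then the bound is demanded
    of no exponent.\<close>
  from this[OF assms, of "Suc (Max (sqsum m ` supp p))"] show ?thesis
    by (simp add: le_imp_less_Suc)
qed

section \<open>Coordinates on tensor and exterior powers\<close>

text \<open>Because of the default 0 in \<open>ev\<close>, two elements of such a space are equal as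
  functions once they agree on the forms.\<close>

lemma ev_span_off: "w \<in> ev_span \<Phi> X \<Longrightarrow> \<phi> \<notin> \<Phi> \<Longrightarrow> w \<phi> = 0"
  unfolding ev_span_def
proof (induction rule: fs.span_induct_alt)
  case base then show ?case by simp
next
  case (step c b y)
  then show ?case by (auto simp: fscale_def ev_def)
qed

lemma mult_forms_sum:
  assumes sp: "vector_space s" "module.subspace s V" and f: "\<phi> \<in> mult_forms s V m"
    and v: "vs \<in> tuples V m" "i < m" and fin: "finite I" and e: "\<And>l. l \<in> I \<Longrightarrow> e l \<in> V"
  shows "\<phi> (vs[i := \<Sum>l\<in>I. s (c l) (e l)]) = (\<Sum>l\<in>I. c l * \<phi> (vs[i := e l]))"
  using fin e
proof (induction I rule: finite_induct)
  case empty
  interpret vector_space s by fact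
  have "\<phi> (vs[i := s 0 0]) = 0 * \<phi> (vs[i := 0])"
    using f v subspace_0[OF sp(2)] unfolding mult_forms_def multilinear_on_def by blast
  then show ?case by simp
next
  case (insert l I)
  interpret vector_space s by fact
  have 1: "s (c l) (e l) \<in> V" "(\<Sum>l\<in>I. s (c l) (e l)) \<in> V"
    using insert.prems sp(2) by (auto intro!: subspace_scale subspace_sum)
  have 2: "\<phi> (vs[i := s (c l) (e l) + (\<Sum>l\<in>I. s (c l) (e l))]) =
      \<phi> (vs[i := s (c l) (e l)]) + \<phi> (vs[i := (\<Sum>l\<in>I. s (c l) (e l))])"
    using f v 1 unfolding mult_forms_def multilinear_on_def by blast
  have "\<phi> (vs[i := s (c l) (e l)]) = c l * \<phi> (vs[i := e l])"
    using f v insert.prems unfolding mult_forms_def multilinear_on_def by blast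
  then show ?case using insert 2 by simp
qed

definition btup :: "(nat \<Rightarrow> 'v) \<Rightarrow> nat \<Rightarrow> (nat \<Rightarrow> nat) \<Rightarrow> 'v list" where
  "btup e m a = map (\<lambda>i. e (a i)) [0..<m]"

lemma length_btup [simp]: "length (btup e m a) = m"
  by (simp add: btup_def)

lemma nth_btup [simp]: "i < m \<Longrightarrow> btup e m a ! i = e (a i)"
  by (simp add: btup_def)

lemma btup_permute:
  assumes "\<sigma> permutes {..<m}"
  shows "permute_list \<sigma> (btup e m a) = btup e m (a \<circ> \<sigma>)"
  using permutes_in_image[OF assms] assms by (intro nth_equalityI) (auto simp: permute_list_nth)

lemma alt_mult_forms: "\<psi> \<in> alt_forms s V m \<Longrightarrow> \<psi> \<in> mult_forms s V m"
  by (simp add: alt_forms_def mult_forms_def alternating_on_def)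

lemma alt_forms_nondistinct: "\<psi> \<in> alt_forms s V m \<Longrightarrow> vs \<in> tuples V m \<Longrightarrow> \<not> distinct vs \<Longrightarrow> \<psi> vs = 0"
  by (simp add: alt_forms_def alternating_on_def)

text \<open>The form is expanded with a + b in both slots, where it vanishes; the two diagonal terms
  vanish as well.\<close>

lemma alt_forms_swap:
  assumes sp: "vector_space s" "module.subspace s V" and \<psi>: "\<psi> \<in> alt_forms s V m"
    and v: "vs \<in> tuples V m" and pq: "p < m" "q < m" "p \<noteq> q" and ab: "a \<in> V" "b \<in> V"
  shows "\<psi> (vs[p := a, q := b]) = - \<psi> (vs[p := b, q := a])"
proof -
  interpret vector_space s by fact
  have m: "multilinear_on s V m (*) \<psi>" using \<psi> by (simp add: alt_forms_def alternating_on_def)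
  let ?G = "\<lambda>x y. \<psi> (vs[p := x, q := y])"
  have z: "?G x x = 0" if "x \<in> V" for x
  proof (rule alt_forms_nondistinct[OF \<psi>])
    show "vs[p := x, q := x] \<in> tuples V m" using v that by (intro tuples_update)
    show "\<not> distinct (vs[p := x, q := x])"
      using pq v unfolding distinct_conv_nth tuples_def by (auto simp: nth_list_update)
  qed
  have ad2: "?G x (y + y') = ?G x y + ?G x y'" if "x \<in> V" "y \<in> V" "y' \<in> V" for x y y'
    using m pq that tuples_update[OF v that(1), of p] unfolding multilinear_on_def by blast
  have ad1: "?G (x + x') y = ?G x y + ?G x' y" if "x \<in> V" "x' \<in> V" "y \<in> V" for x x' y
    using m pq that tuples_update[OF v that(3), of q] list_update_swap[OF pq(3), of vs]
    unfolding multilinear_on_def by metis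
  have "a + b \<in> V" using ab sp(2) subspace_add by blast
  then have "0 = ?G (a + b) (a + b)" using z by simp
  also have "\<dots> = (?G a a + ?G a b) + (?G b a + ?G b b)" using ab \<open>a + b \<in> V\<close> by (simp only: ad1 ad2 add_ac)
  also have "\<dots> = ?G a b + ?G b a" using z[OF ab(1)] z[OF ab(2)] by simp
  finally show ?thesis by (simp add: eq_neg_iff_add_eq_0)
qed

lemma sign_comp_transpose:
  assumes "finite S" "\<sigma> permutes S" "p \<in> S" "q \<in> S" "p \<noteq> q"
  shows "sign (\<sigma> \<circ> transpose p q) = - sign \<sigma>"
  using assms by (simp add: sign_compose permutation_permutes[THEN iffD2] permutation_swap_id sign_swap_id exI[of _ S])

text \<open>A space with a basis \<open>e\<close> numbered from 0 to d and its coordinate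
  functionals. It is used for U, for the symmetric powers of U and for the divided power of U. The
  functionals are linear on the whole type, which spares membership conditions when forms are built
  from them.\<close>

locale coords =
  fixes s :: "'k::field \<Rightarrow> 'v::ab_group_add \<Rightarrow> 'v" and V :: "'v set" and d :: nat
    and e :: "nat \<Rightarrow> 'v" and \<kappa> :: "nat \<Rightarrow> 'v \<Rightarrow> 'k"
  assumes vs: "vector_space s" and sub: "module.subspace s V"
    and e_in: "i \<le> d \<Longrightarrow> e i \<in> V"
    and \<kappa>_add: "\<kappa> i (v + w) = \<kappa> i v + \<kappa> i w" and \<kappa>_scale: "\<kappa> i (s c v) = c * \<kappa> i v"
    and \<kappa>_e: "i \<le> d \<Longrightarrow> l \<le> d \<Longrightarrow> \<kappa> i (e l) = (if i = l then 1 else 0)"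
    and expand: "v \<in> V \<Longrightarrow> v = (\<Sum>i\<le>d. s (\<kappa> i v) (e i))"
begin

lemma btup_tuples: "a \<in> exps m d \<Longrightarrow> btup e m a \<in> tuples V m"
  using e_in by (auto simp: tuples_def exps_def btup_def)

definition cform :: "nat \<Rightarrow> (nat \<Rightarrow> nat) \<Rightarrow> 'v list \<Rightarrow> 'k" where
  "cform m a vs = (\<Prod>i<m. \<kappa> (a i) (vs ! i))"

lemma cform_mult_form: "cform m a \<in> mult_forms s V m"
  unfolding mult_forms_def multilinear_on_def mem_Collect_eq
proof (intro ballI allI impI)
  fix vs i u w c assume h: "vs \<in> tuples V m" "i < m"
  have l: "length vs = m" using h by (simp add: tuples_def)
  have "cform m a (vs[i := v]) = \<kappa> (a i) v * (\<Prod>l\<in>{..<m} - {i}. \<kappa> (a l) (vs ! l))" for v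
    unfolding cform_def using h l by (subst prod.remove[of _ i]) auto
  then show "cform m a (vs[i := u + w]) = cform m a (vs[i := u]) + cform m a (vs[i := w]) \<and>
      cform m a (vs[i := s c u]) = c * cform m a (vs[i := u])"
    by (simp add: \<kappa>_add \<kappa>_scale algebra_simps)
qed

lemma cform_btup:
  assumes "a \<in> exps m d" "b \<in> exps m d"
  shows "cform m a (btup e m b) = (if \<forall>i<m. b i = a i then 1 else 0)"
proof (cases "\<forall>i<m. b i = a i")
  case True
  then show ?thesis using assms by (auto simp: cform_def \<kappa>_e exps_def intro!: prod.neutral)
next
  case False
  then obtain i where "i < m" "b i \<noteq> a i" by blast
  then have "\<exists>i\<in>{..<m}. \<kappa> (a i) (btup e m b ! i) = 0"
    using assms by (intro bexI[of _ i]) (auto simp: \<kappa>_e exps_def)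
  then show ?thesis using False unfolding cform_def by (subst prod_zero) auto
qed

text \<open>The slots are expanded from left to right: after k steps the first k entries are basis
  vectors and the rest of the tuple is untouched.\<close>

lemma form_expand:
  assumes \<phi>: "\<phi> \<in> mult_forms s V m" and v: "vs \<in> tuples V m"
  shows "\<phi> vs = (\<Sum>a\<in>exps m d. cform m a vs * \<phi> (btup e m a))"
proof -
  have l: "length vs = m" using v by (simp add: tuples_def)
  have "\<phi> vs = (\<Sum>a\<in>exps k d. cform k a vs * \<phi> (btup e k a @ drop k vs))" if "k \<le> m" for k
    using that
  proof (induction k)
    case 0
    have "exps 0 d = {0}" by (auto simp: exps_def fun_eq_iff)
    then show ?case by (simp add: cform_def btup_def)
  next
    case (Suc k)
    have st: "\<phi> (btup e k a @ drop k vs) = (\<Sum>i\<le>d. \<kappa> i (vs ! k) * \<phi> (btup e (Suc k) (a(k := i)) @ drop (Suc k) vs))"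
      if a: "a \<in> exps k d" for a
    proof -
      let ?L = "btup e k a @ drop k vs"
      have kl: "k < m" using Suc.prems by simp
      have "set (btup e k a) \<subseteq> V" using btup_tuples[OF a] by (simp add: tuples_def)
      moreover have "set (drop k vs) \<subseteq> V" using v set_drop_subset[of k vs] by (auto simp: tuples_def)
      ultimately have L: "?L \<in> tuples V m" using l kl by (simp add: tuples_def)
      have u: "?L[k := w] = btup e k a @ w # drop (Suc k) vs" for w
        using kl l by (simp add: list_update_append Cons_nth_drop_Suc[symmetric])
      have b: "btup e (Suc k) (a(k := i)) = btup e k a @ [e i]" for i
        unfolding btup_def by simp
      have "?L[k := vs ! k] = ?L" using u kl l by (simp add: Cons_nth_drop_Suc)
      then have "\<phi> ?L = \<phi> (?L[k := \<Sum>i\<le>d. s (\<kappa> i (vs ! k)) (e i)])"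
        using expand[OF tuples_nth[OF v kl]] by metis
      also have "\<dots> = (\<Sum>i\<le>d. \<kappa> i (vs ! k) * \<phi> (?L[k := e i]))"
        by (rule mult_forms_sum[OF vs sub \<phi> L kl]) (auto intro: e_in)
      finally show ?thesis by (simp add: u b)
    qed
    have "\<phi> vs = (\<Sum>a\<in>exps k d. \<Sum>i\<le>d. cform k a vs * (\<kappa> i (vs ! k) * \<phi> (btup e (Suc k) (a(k := i)) @ drop (Suc k) vs)))"
      using Suc by (simp add: st sum_distrib_left)
    also have "\<dots> = (\<Sum>(a, i)\<in>exps k d \<times> {..d}. cform k a vs * (\<kappa> i (vs ! k) * \<phi> (btup e (Suc k) (a(k := i)) @ drop (Suc k) vs)))"
      by (rule sum.cartesian_product)
    also have "\<dots> = (\<Sum>b\<in>exps (Suc k) d. cform (Suc k) b vs * \<phi> (btup e (Suc k) b @ drop (Suc k) vs))"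
    \<comment> \<open>An exponent in k + 1 variables splits into its entry at k and the exponent
      with that entry reset to 0, the value prescribed from k on.\<close>
    proof (rule sum.reindex_bij_witness[of _ "\<lambda>b. (b(k := 0), b k)" "\<lambda>(a, i). a(k := i)"])
      fix x assume "x \<in> exps k d \<times> {..d}"
      then obtain a i where x: "x = (a, i)" "a \<in> exps k d" "i \<le> d" by blast
      then have ak: "a k = 0" by (simp add: exps_def)
      show "((case x of (a, i) \<Rightarrow> a(k := i))(k := 0), (case x of (a, i) \<Rightarrow> a(k := i)) k) = x"
        using x ak fun_upd_triv[of a k] by simp
      show "(case x of (a, i) \<Rightarrow> a(k := i)) \<in> exps (Suc k) d"
        using x by (auto simp: exps_def)
      have "cform (Suc k) (a(k := i)) vs = cform k a vs * \<kappa> i (vs ! k)"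
        by (simp add: cform_def)
      then show "cform (Suc k) (case x of (a, i) \<Rightarrow> a(k := i)) vs * \<phi> (btup e (Suc k) (case x of (a, i) \<Rightarrow> a(k := i)) @ drop (Suc k) vs) =
        (case x of (a, i) \<Rightarrow> cform k a vs * (\<kappa> i (vs ! k) * \<phi> (btup e (Suc k) (a(k := i)) @ drop (Suc k) vs)))"
        using x by simp
    next
      fix b assume b: "b \<in> exps (Suc k) d"
      show "(case (b(k := 0), b k) of (a, i) \<Rightarrow> a(k := i)) = b" by simp
      have "(b(k := 0)) i = 0" if "k \<le> i" for i using b that by (cases "i = k") (auto simp: exps_def)
      then show "(b(k := 0), b k) \<in> exps k d \<times> {..d}" using b by (auto simp: exps_def)
    qed
    finally show ?case .
  qed
  from this[of m] show ?thesis using l by simp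
qed

section \<open>Tensors and wedges written as polynomials\<close>

definition pol :: "nat \<Rightarrow> ('v, 'k) power_elem \<Rightarrow> (nat \<Rightarrow> nat) \<Rightarrow>\<^sub>0 'k" where
  "pol m T = (\<Sum>a\<in>exps m d. mon a (T (cform m a)))"

definition tens :: "nat \<Rightarrow> ((nat \<Rightarrow> nat) \<Rightarrow>\<^sub>0 'k) \<Rightarrow> ('v, 'k) power_elem" where
  "tens m p = (\<lambda>\<psi>. if \<psi> \<in> mult_forms s V m then pairing p (\<lambda>a. \<psi> (btup e m a)) else 0)"

definition wed :: "nat \<Rightarrow> ((nat \<Rightarrow> nat) \<Rightarrow>\<^sub>0 'k) \<Rightarrow> ('v, 'k) power_elem" where
  "wed m p = (\<lambda>\<psi>. if \<psi> \<in> alt_forms s V m then pairing p (\<lambda>a. \<psi> (btup e m a)) else 0)"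

lemma coef_pol: "coef (pol m T) a = (if a \<in> exps m d then T (cform m a) else 0)"
  unfolding pol_def lookup_sum by (auto simp: lookup_single when_def)

lemma supp_pol: "supp (pol m T) \<subseteq> exps m d"
  by (auto simp: in_keys_iff coef_pol split: if_splits)

lemma pol_add: "pol m (T + T') = pol m T + pol m T'"
  by (rule poly_mapping_eqI) (simp add: coef_pol lookup_add)

lemma pol_scale: "pol m (fscale c T) = mon 0 c * pol m T"
  by (rule poly_mapping_eqI) (simp add: coef_pol coef_scale fscale_def)

lemma tens_add: "tens m (p + q) = tens m p + tens m q"
  by (auto simp: tens_def fun_eq_iff pairing_add)

lemma tens_scale: "tens m (mon 0 c * p) = fscale c (tens m p)"
  by (auto simp: tens_def fun_eq_iff fscale_def pairing_scale)

lemma tens_0: "tens m 0 = 0"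
  by (auto simp: tens_def fun_eq_iff)

lemma tens_sum: "tens m (\<Sum>i\<in>I. p i) = (\<Sum>i\<in>I. tens m (p i))"
  by (induction I rule: infinite_finite_induct) (auto simp: tens_0 tens_add simp del: zero_fun_apply plus_fun_apply)

text \<open>Both sides are linear in T, and on pure tensors the identity is
  \<open>form_expand\<close>.\<close>

lemma tensor_power_expand:
  assumes T: "T \<in> tensor_power s V m" and \<phi>: "\<phi> \<in> mult_forms s V m"
  shows "T \<phi> = pairing (pol m T) (\<lambda>a. \<phi> (btup e m a))"
proof -
  have "T \<phi> = (\<Sum>a\<in>exps m d. T (cform m a) * \<phi> (btup e m a))"
    using T unfolding tensor_power_def ev_span_def
  proof (induction rule: fs.span_induct_alt)
    case base then show ?case by simp
  next
    case (step c b y)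
    then obtain x where x: "x \<in> tuples V m" "b = ev (mult_forms s V m) x" by blast
    have "b \<phi> = (\<Sum>a\<in>exps m d. b (cform m a) * \<phi> (btup e m a))"
      using form_expand[OF \<phi> x(1)] \<phi> cform_mult_form by (simp add: x(2) ev_def)
    then show ?case using step
      by (simp add: fscale_def sum_distrib_left algebra_simps sum.distrib)
  qed
  also have "\<dots> = pairing (pol m T) (\<lambda>a. \<phi> (btup e m a))"
    by (subst pairing_superset[OF finite_exps supp_pol]) (simp add: coef_pol)
  finally show ?thesis .
qed

lemma tens_pol: "T \<in> tensor_power s V m \<Longrightarrow> tens m (pol m T) = T"
  by (rule ext) (auto simp: tens_def tensor_power_expand tensor_power_def ev_span_off)

lemma pol_tens:
  assumes "supp p \<subseteq> exps m d"
  shows "pol m (tens m p) = p"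
proof (rule poly_mapping_eqI)
  fix a
  show "coef (pol m (tens m p)) a = coef p a"
  proof (cases "a \<in> exps m d")
    case True
    have "tens m p (cform m a) = pairing p (\<lambda>b. if b = a then 1 else 0)"
    proof -
      have "cform m a (btup e m b) = (if b = a then 1 else 0)" if "b \<in> supp p" for b
        using that assms True exps_ext[of b m d a d] by (subst cform_btup) auto
      then show ?thesis using cform_mult_form[of m a] by (simp add: tens_def cong: pairing_cong)
    qed
    then show ?thesis using True by (simp add: coef_pol pairing_delta)
  next
    case False then show ?thesis using assms by (auto simp: coef_pol in_keys_iff)
  qed
qed

lemma pure_btup: "a \<in> exps m d \<Longrightarrow> pure_tensor s V (btup e m a) = tens m (mon a 1)"
  by (auto simp: pure_tensor_def ev_def tens_def fun_eq_iff)

lemma wedge_btup: "wedge s V (btup e m a) = wed m (mon a 1)"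
  by (auto simp: wedge_def ev_def wed_def fun_eq_iff)

lemma tens_tensor_power:
  assumes "supp p \<subseteq> exps m d"
  shows "tens m p \<in> tensor_power s V m"
proof -
  have "tens m p = (\<Sum>a\<in>supp p. fscale (coef p a) (pure_tensor s V (btup e m a)))"
  proof -
    have "tens m p = tens m (\<Sum>a\<in>supp p. mon 0 (coef p a) * mon a 1)"
      using mpoly_sum_mon[of p] by (simp add: mult_single)
    also have "\<dots> = (\<Sum>a\<in>supp p. fscale (coef p a) (tens m (mon a 1)))"
      by (simp only: tens_sum tens_scale)
    also have "\<dots> = (\<Sum>a\<in>supp p. fscale (coef p a) (pure_tensor s V (btup e m a)))"
      using assms by (intro sum.cong refl) (simp add: pure_btup subset_iff)
    finally show ?thesis .
  qed
  also have "\<dots> \<in> tensor_power s V m"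
    unfolding power_spans using assms btup_tuples
    by (intro fs.span_sum fs.span_scale fs.span_base) blast
  finally show ?thesis .
qed

lemma tens_div_power:
  assumes p: "p \<in> sym_polys m d"
  shows "tens m p \<in> div_power s V m"
proof -
  have "perm_tensor \<sigma> (tens m p) = tens m p" if s: "\<sigma> permutes {..<m}" for \<sigma>
  proof
    fix \<psi>
    \<comment> \<open>\<open>perm_tensor\<close> acts on arguments of every kind, so invariance is
      also needed where \<psi> is no form. There both sides are 0, because permuting slots cannot
      turn a function that is not multilinear into a multilinear one.\<close>
    have form: "\<psi> \<in> mult_forms s V m" if h: "(\<lambda>vs. \<psi> (permute_list \<sigma> vs)) \<in> mult_forms s V m"
    proof -
      have i: "inv \<sigma> permutes {..<m}" using s by (rule permutes_inv)
      have "multilinear_on s V m (*) \<psi>"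
        unfolding multilinear_on_def
      proof (intro ballI allI impI)
        fix vs k a b c assume v: "vs \<in> tuples V m" "k < m" "a \<in> V" "b \<in> V"
        have l: "length vs = m" using v by (simp add: tuples_def)
        have inv: "permute_list \<sigma> (permute_list (inv \<sigma>) (vs[k := x])) = vs[k := x]" for x
          using permute_list_compose[of \<sigma> "vs[k := x]" "inv \<sigma>"] s l i permutes_inv_o[OF s]
          by (simp add: permute_list_compose[symmetric])
        have u: "permute_list (inv \<sigma>) (vs[k := x]) = (permute_list (inv \<sigma>) vs)[\<sigma> k := x]" for x
          using permute_list_update[OF i l v(2)] permutes_inv_inv[OF s] by simp
        have "permute_list (inv \<sigma>) vs \<in> tuples V m" "\<sigma> k < m"
          using permute_list_tuples[OF i v(1)] permutes_in_image[OF s, of k] v by auto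
        then show "\<psi> (vs[k := a + b]) = \<psi> (vs[k := a]) + \<psi> (vs[k := b]) \<and> \<psi> (vs[k := s c a]) = c * \<psi> (vs[k := a])"
          using h v inv unfolding mult_forms_def multilinear_on_def mem_Collect_eq u by metis
      qed
      then show ?thesis by (simp add: mult_forms_def)
    qed
    show "perm_tensor \<sigma> (tens m p) \<psi> = tens m p \<psi>"
    proof (cases "\<psi> \<in> mult_forms s V m")
      case True
      then show ?thesis
        using sym_polys_pairing[OF p s, of "\<lambda>a. \<psi> (btup e m a)"]
        by (simp add: perm_tensor_def tens_def mult_forms_permute[OF s] btup_permute[OF s])
    next
      case False
      then show ?thesis using form by (auto simp: perm_tensor_def tens_def)
    qed
  qed
  then show ?thesis
    using tens_tensor_power[of p m] p by (auto simp: div_power_def sym_polys_def)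
qed

lemma pol_sym_polys:
  assumes T: "T \<in> div_power s V m"
  shows "pol m T \<in> sym_polys m d"
proof (rule sym_polysI[OF supp_pol])
  fix \<sigma> a assume s: "\<sigma> permutes {..<m}" and a: "a \<in> exps m d"
  have i: "inv \<sigma> permutes {..<m}" using s by (rule permutes_inv)
  have "T (cform m a) = T (\<lambda>vs. cform m a (permute_list (inv \<sigma>) vs))"
  proof -
    have "perm_tensor (inv \<sigma>) T = T" using T i by (simp add: div_power_def)
    then show ?thesis unfolding perm_tensor_def by (rule fun_cong[OF sym])
  qed
  also have "\<dots> = T (cform m (a \<circ> \<sigma>))"
  proof (rule ev_span_eq[of T "mult_forms s V m" "tuples V m"])
    show "T \<in> ev_span (mult_forms s V m) (tuples V m)"
      using T by (simp add: div_power_def tensor_power_def)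
    show "(\<lambda>vs. cform m a (permute_list (inv \<sigma>) vs)) \<in> mult_forms s V m"
      by (rule mult_forms_permute[OF i cform_mult_form])
    show "cform m (a \<circ> \<sigma>) \<in> mult_forms s V m" by (rule cform_mult_form)
    fix vs assume "vs \<in> tuples V m"
    then have l: "length vs = m" by (simp add: tuples_def)
    have "cform m a (permute_list (inv \<sigma>) vs) = (\<Prod>l<m. \<kappa> (a l) (vs ! inv \<sigma> l))"
      unfolding cform_def using i l by (intro prod.cong) (auto simp: permute_list_nth)
    also have "\<dots> = (\<Prod>l<m. \<kappa> (a (\<sigma> l)) (vs ! l))"
      using prod.permute[OF s, of "\<lambda>l. \<kappa> (a l) (vs ! inv \<sigma> l)"] permutes_inverses[OF s] by (simp add: o_def)
    finally show "cform m a (permute_list (inv \<sigma>) vs) = cform m (a \<circ> \<sigma>) vs" by (simp add: cform_def)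
  qed
  finally show "coef (pol m T) (a \<circ> \<sigma>) = coef (pol m T) a"
    using a exps_perm[OF a s] by (simp add: coef_pol)
qed

lemma div_power_iff: "T \<in> div_power s V m \<longleftrightarrow> (\<exists>p\<in>sym_polys m d. T = tens m p)"
proof
  assume T: "T \<in> div_power s V m"
  then have "T \<in> tensor_power s V m" by (simp add: div_power_def)
  then show "\<exists>p\<in>sym_polys m d. T = tens m p"
    using pol_sym_polys[OF T] tens_pol by metis
qed (use tens_div_power in blast)

lemma pol_tens_sym: "p \<in> sym_polys m d \<Longrightarrow> pol m (tens m p) = p"
  by (rule pol_tens) (simp add: sym_polys_def)

lemma tens_inject: "p \<in> sym_polys m d \<Longrightarrow> q \<in> sym_polys m d \<Longrightarrow> tens m p = tens m q \<longleftrightarrow> p = q"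
  using pol_tens_sym by metis

lemma subspace_div_power: "fs.subspace (div_power s V m)"
proof (rule fs.subspaceI)
  show "0 \<in> div_power s V m" using sym_polys_0 tens_0 div_power_iff by metis
  show "T + T' \<in> div_power s V m" if "T \<in> div_power s V m" "T' \<in> div_power s V m" for T T'
    using that sym_polys_add tens_add unfolding div_power_iff by metis
  show "fscale c T \<in> div_power s V m" if "T \<in> div_power s V m" for c T
    using that sym_polys_scale tens_scale unfolding div_power_iff by metis
qed

lemma wed_add: "wed m (p + q) = wed m p + wed m q"
  by (auto simp: wed_def fun_eq_iff pairing_add)

lemma wed_scale: "wed m (mon 0 c * p) = fscale c (wed m p)"
  by (auto simp: wed_def fun_eq_iff fscale_def pairing_scale)

lemma wed_0: "wed m 0 = 0"
  by (auto simp: wed_def fun_eq_iff)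

lemma wed_sum: "wed m (\<Sum>i\<in>I. p i) = (\<Sum>i\<in>I. wed m (p i))"
  by (induction I rule: infinite_finite_induct) (auto simp: wed_0 wed_add simp del: zero_fun_apply plus_fun_apply)

lemma wed_ext_power:
  assumes "supp p \<subseteq> exps m d"
  shows "wed m p \<in> ext_power s V m"
proof -
  have "wed m p = wed m (\<Sum>a\<in>supp p. mon 0 (coef p a) * mon a 1)"
    using mpoly_sum_mon[of p] by (simp add: mult_single)
  also have "\<dots> = (\<Sum>a\<in>supp p. fscale (coef p a) (wedge s V (btup e m a)))"
    by (simp only: wed_sum wed_scale wedge_btup)
  also have "\<dots> \<in> ext_power s V m"
    unfolding power_spans using assms btup_tuples
    by (intro fs.span_sum fs.span_scale fs.span_base) blast
  finally show ?thesis .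
qed

text \<open>The form is the determinant of the coordinates with indices b; it is the test form for
  the injectivity of \<alpha>.\<close>

lemma alternant_form:
  assumes b: "b \<in> exps m d"
  shows "\<exists>\<psi>\<in>alt_forms s V m. \<forall>c\<in>exps m d. \<psi> (btup e m c) = alternant m b c"
proof
  define \<psi> where "\<psi> vs = (\<Sum>\<sigma> | \<sigma> permutes {..<m}. of_int (sign \<sigma>) * cform m (b \<circ> \<sigma>) vs)" for vs
  show "\<forall>c\<in>exps m d. \<psi> (btup e m c) = alternant m b c"
    unfolding \<psi>_def alternant_def
    by (auto intro!: sum.cong simp: cform_btup exps_perm[OF b])
  have mult: "multilinear_on s V m (*) \<psi>"
    using cform_mult_form[of m] unfolding \<psi>_def mult_forms_def multilinear_on_def
    by (simp add: sum.distrib[symmetric] sum_distrib_left algebra_simps)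
  have "\<psi> vs = 0" if v: "vs \<in> tuples V m" "\<not> distinct vs" for vs
  proof -
    have l: "length vs = m" using v by (simp add: tuples_def)
    obtain p q where pq: "p < m" "q < m" "p \<noteq> q" "vs ! p = vs ! q"
      using v(2) l by (auto simp: distinct_conv_nth)
    let ?\<tau> = "transpose p q"
    have t: "?\<tau> permutes {..<m}" using pq by (intro permutes_swap_id) auto
    have tt: "\<sigma> \<circ> ?\<tau> \<circ> ?\<tau> = \<sigma>" for \<sigma> :: "nat \<Rightarrow> nat" by (simp add: comp_assoc)
    have F: "cform m (b \<circ> (\<sigma> \<circ> ?\<tau>)) vs = cform m (b \<circ> \<sigma>) vs" for \<sigma>
    proof -
      have "cform m (b \<circ> \<sigma>) vs = (\<Prod>i<m. \<kappa> (b (\<sigma> (?\<tau> i))) (vs ! ?\<tau> i))"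
        using prod.permute[OF t, of "\<lambda>i. \<kappa> (b (\<sigma> i)) (vs ! i)"] by (simp add: cform_def o_def)
      also have "\<dots> = cform m (b \<circ> (\<sigma> \<circ> ?\<tau>)) vs"
        unfolding cform_def using pq(4) by (intro prod.cong) (auto simp: transpose_def)
      finally show ?thesis by simp
    qed
    let ?P = "{\<sigma>. \<sigma> permutes {..<m}}"
    let ?g = "\<lambda>\<sigma>. of_int (sign \<sigma>) * cform m (b \<circ> \<sigma>) vs :: 'k"
    have fin: "finite ?P" by (simp add: finite_permutations)
    \<comment> \<open>Composition with the transposition matches even with odd permutations and the
      terms cancel in pairs. Deducing the vanishing from \<psi> vs = - \<psi> vs would fail in
      characteristic 2.\<close>
    have "\<psi> vs = sum ?g {\<sigma>\<in>?P. evenperm \<sigma>} + sum ?g {\<sigma>\<in>?P. \<not> evenperm \<sigma>}"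
      unfolding \<psi>_def using fin by (subst sum.union_disjoint[symmetric]) (auto intro!: sum.cong)
    also have "sum ?g {\<sigma>\<in>?P. evenperm \<sigma>} = (\<Sum>\<sigma>\<in>{\<sigma>\<in>?P. \<not> evenperm \<sigma>}. - ?g \<sigma>)"
    proof (rule sum.reindex_bij_witness[of _ "\<lambda>\<sigma>. \<sigma> \<circ> ?\<tau>" "\<lambda>\<sigma>. \<sigma> \<circ> ?\<tau>"])
      fix \<sigma> :: "nat \<Rightarrow> nat"
      have sg: "sign (\<sigma> \<circ> ?\<tau>) = - sign \<sigma>" if "\<sigma> \<in> ?P"
        using that sign_comp_transpose[of "{..<m}" \<sigma> p q] pq by simp
      have mem: "\<sigma> \<circ> ?\<tau> \<in> ?P" if "\<sigma> \<in> ?P" using that permutes_compose[OF t] by simp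
      show "\<sigma> \<circ> ?\<tau> \<circ> ?\<tau> = \<sigma>" "\<sigma> \<circ> ?\<tau> \<circ> ?\<tau> = \<sigma>" by (fact tt)+
      show "\<sigma> \<circ> ?\<tau> \<in> {\<sigma>\<in>?P. \<not> evenperm \<sigma>}" if "\<sigma> \<in> {\<sigma>\<in>?P. evenperm \<sigma>}"
        using that mem sg by (auto simp: sign_def split: if_splits)
      show "\<sigma> \<circ> ?\<tau> \<in> {\<sigma>\<in>?P. evenperm \<sigma>}" if "\<sigma> \<in> {\<sigma>\<in>?P. \<not> evenperm \<sigma>}"
        using that mem sg by (auto simp: sign_def split: if_splits)
      show "- ?g (\<sigma> \<circ> ?\<tau>) = ?g \<sigma>" if "\<sigma> \<in> {\<sigma>\<in>?P. evenperm \<sigma>}"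
        using that sg F by simp
    qed
    finally show ?thesis by (simp only: sum_negf add.left_inverse)
  qed
  then show "\<psi> \<in> alt_forms s V m" using mult by (simp add: alt_forms_def alternating_on_def)
qed

section \<open>Generators of the exterior power\<close>

lemma ext_power_span_btup:
  "ext_power s V m = fs.span ((\<lambda>b. wedge s V (btup e m b)) ` exps m d)"
proof
  show "fs.span ((\<lambda>b. wedge s V (btup e m b)) ` exps m d) \<subseteq> ext_power s V m"
    unfolding power_spans using btup_tuples by (intro fs.span_mono) blast
  have "wedge s V vs \<in> fs.span ((\<lambda>b. wedge s V (btup e m b)) ` exps m d)" if v: "vs \<in> tuples V m" for vs
  proof -
    have l: "length vs = m" using v by (simp add: tuples_def)
    have "wedge s V vs = (\<Sum>a\<in>exps m d. fscale (cform m a vs) (wedge s V (btup e m a)))"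
    proof
      fix \<phi>
      show "wedge s V vs \<phi> = (\<Sum>a\<in>exps m d. fscale (cform m a vs) (wedge s V (btup e m a))) \<phi>"
      proof (cases "\<phi> \<in> alt_forms s V m")
        case True
        then show ?thesis using form_expand[OF alt_mult_forms[OF True] v] l
          by (simp add: wedge_def ev_def sum_fun_apply fscale_def)
      next
        case False
        then show ?thesis using l by (simp add: wedge_def ev_def sum_fun_apply fscale_def)
      qed
    qed
    then show ?thesis by (simp only:) (intro fs.span_sum fs.span_scale fs.span_base imageI)
  qed
  then show "ext_power s V m \<subseteq> fs.span ((\<lambda>b. wedge s V (btup e m b)) ` exps m d)"
    unfolding power_spans by (intro fs.span_minimal) (auto simp: fs.subspace_span)
qed

lemma wedge_btup_swap:
  assumes b: "b \<in> exps m d" and ik: "i < m" "k < m" "i \<noteq> k"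
  shows "wedge s V (btup e m (b \<circ> transpose i k)) = fscale (-1) (wedge s V (btup e m b))"
proof -
  let ?L = "btup e m b"
  have V: "e (b i) \<in> V" "e (b k) \<in> V" using b ik by (auto simp: exps_def intro: e_in)
  have 1: "btup e m (b \<circ> transpose i k) = ?L[i := e (b k), k := e (b i)]"
    using ik by (intro nth_equalityI) (auto simp: nth_list_update transpose_def)
  have 2: "?L = ?L[i := e (b i), k := e (b k)]"
    using ik by (intro nth_equalityI) (auto simp: nth_list_update)
  have "\<psi> (btup e m (b \<circ> transpose i k)) = - \<psi> ?L" if "\<psi> \<in> alt_forms s V m" for \<psi>
    using alt_forms_swap[OF vs sub that btup_tuples[OF b] ik V(2,1)] 1 2 by simp
  then show ?thesis by (auto simp: wedge_def ev_def fscale_def fun_eq_iff)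
qed

text \<open>Modulo terms with a smaller sum of squares, the wedge of basis vectors with strictly decreasing
  indices a + stair m is the product of the orbit sum of a with the Vandermonde generator.\<close>

lemma wedge_btup_mem:
  assumes dd: "d = d' + (m - 1)" and W: "fs.subspace W"
    and gen: "\<And>a. a \<in> exps m d' \<Longrightarrow> wed m (mon (stair m) 1 * orbit_sum m a) \<in> W"
    and b: "b \<in> exps m d"
  shows "wedge s V (btup e m b) \<in> W"
  using b
\<comment> \<open>Sorting the indices does not change the sum of squares, so a second measure is
  needed for it: the sum of i * b i drops by (k - i) (b k - b i) when an ascent is swapped.\<close>
proof (induction b rule: wf_induct[OF wf_measures[of "[sqsum m, \<lambda>b. \<Sum>i<m. i * b i]"]])
  case (1 b)
  note IH = 1(1)[rule_format] and b = 1(2)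
  show ?case
  proof (cases "\<forall>i k. i < k \<longrightarrow> k < m \<longrightarrow> b k < b i")
    case False
    then obtain i k where ik: "i < k" "k < m" "b i \<le> b k" by (auto simp: not_less)
    show ?thesis
    proof (cases "b i = b k")
      case True
      then have "\<not> distinct (btup e m b)"
        using ik nth_eq_iff_index_eq[of "btup e m b" i k] by auto
      then have "wedge s V (btup e m b) = 0"
        using alt_forms_nondistinct btup_tuples[OF b] by (auto simp: wedge_def ev_def fun_eq_iff)
      then show ?thesis using fs.subspace_0[OF W] by (simp only:)
    next
      case ne: False
      let ?c = "b \<circ> transpose i k"
      have t: "transpose i k permutes {..<m}" using ik by (intro permutes_swap_id) auto
      have c: "?c \<in> exps m d" by (rule exps_perm[OF b t])
      have split: "(\<Sum>l<m. l * f l) = i * f i + k * f k + (\<Sum>l\<in>{..<m} - {i, k}. l * f l)" for f :: "nat \<Rightarrow> nat"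
      proof -
        have "{..<m} - {i} - {k} = {..<m} - {i, k}" by auto
        then show ?thesis
          using ik sum.remove[of "{..<m}" i "\<lambda>l. l * f l"] sum.remove[of "{..<m} - {i}" k "\<lambda>l. l * f l"]
          by simp
      qed
      have rest: "(\<Sum>l\<in>{..<m} - {i, k}. l * ?c l) = (\<Sum>l\<in>{..<m} - {i, k}. l * b l)"
        by (intro sum.cong) (auto simp: transpose_def)
      obtain u where u: "k = i + u + 1" using ik(1) less_iff_Suc_add by auto
      have "b i < b k" using ik(3) ne by simp
      then obtain v where v: "b k = b i + v + 1" using less_iff_Suc_add by auto
      have "(\<Sum>l<m. l * ?c l) < (\<Sum>l<m. l * b l)"
        unfolding split rest using v by (simp add: u algebra_simps)
      then have "wedge s V (btup e m ?c) \<in> W"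
        using sqsum_perm[OF t, of b] c by (intro IH) simp_all
      moreover have "wedge s V (btup e m b) = fscale (-1) (wedge s V (btup e m ?c))"
        using wedge_btup_swap[OF b, of i k] ik by (simp add: fscale_def fun_eq_iff)
      ultimately show ?thesis using fs.subspace_scale[OF W] by metis
    qed
  next
    case True
    \<comment> \<open>Strictly decreasing integers drop by at least 1 per step. Comparison with the
      last and with the first entry shows that subtracting the staircase leaves entries between 0
      and d'.\<close>
    have gap: "b (i + l) + l \<le> b i" if "i + l < m" for i l
      using that
    proof (induction l)
      case (Suc l)
      then have "b (Suc (i + l)) < b (i + l)" using True by simp
      then show ?case using Suc by simp
    qed simp
    have lo: "stair m i \<le> b i" for i
      using gap[of i "m - 1 - i"] by (cases "i < m") (auto simp: stair_def)
    have up: "b i \<le> d - i" if "i < m" for i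
    proof -
      have "b 0 \<le> d" using b that by (auto simp: exps_def)
      then show ?thesis using gap[of 0 i] that by simp
    qed
    define a where "a i = b i - stair m i" for i
    have ab: "a + stair m = b" using lo by (simp add: a_def fun_eq_iff)
    have "a i \<le> d'" if "i < m" for i
      using up[OF that] that by (simp add: a_def stair_def dd)
    moreover have "a i = 0" if "m \<le> i" for i
      using b that by (simp add: a_def exps_def)
    ultimately have a: "a \<in> exps m d'" by (simp add: exps_def)
    have da: "decr m a"
      unfolding decr_def
    proof (intro allI impI)
      fix i k assume "i < k" "k < m"
      then show "a k \<le> a i" using gap[of i "k - i"] by (simp add: a_def stair_def)
    qed
    let ?O = "(\<lambda>\<sigma>. a \<circ> \<sigma>) ` {\<sigma>. \<sigma> permutes {..<m}}"
    have fin: "finite ?O" by (simp add: finite_permutations)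
    have aO: "a \<in> ?O" using permutes_id by (intro image_eqI[of _ _ id]) auto
    have "wed m (mon (stair m) 1 * orbit_sum m a) = (\<Sum>c\<in>?O. wedge s V (btup e m (stair m + c)))"
      by (simp add: orbit_sum_def sum_distrib_left mult_single wed_sum wedge_btup)
    also have "\<dots> = wedge s V (btup e m b) + (\<Sum>c\<in>?O - {a}. wedge s V (btup e m (stair m + c)))"
      by (subst sum.remove[OF fin aO]) (simp only: ab add.commute[of "stair m"])
    finally have "wedge s V (btup e m b) =
        wed m (mon (stair m) 1 * orbit_sum m a) - (\<Sum>c\<in>?O - {a}. wedge s V (btup e m (stair m + c)))"
      by simp
    \<comment> \<open>Every rearrangement other than a has a smaller sum of squares once the
      staircase is added, so the induction hypothesis applies.\<close>
    moreover have mem: "wedge s V (btup e m (stair m + c)) \<in> W" if c: "c \<in> ?O - {a}" for c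
    proof -
      obtain \<sigma> where s: "c = a \<circ> \<sigma>" "\<sigma> permutes {..<m}" "a \<circ> \<sigma> \<noteq> a" using c by auto
      have "sqsum m (stair m + c) < sqsum m b"
        using sqsum_orbit_less[OF s(2) da s(3)] by (simp only: s(1) ab add.commute[of "stair m"])
      moreover have "stair m + c \<in> exps m d"
        using exps_add[OF exps_perm[OF a s(2)] stair_exps] by (simp add: s(1) dd add.commute)
      ultimately show ?thesis by (intro IH) simp_all
    qed
    ultimately show ?thesis
      using fs.subspace_diff[OF W gen[OF a] fs.subspace_sum[OF W mem]] by (simp only:)
  qed
qed

end

section \<open>Generators of symmetric powers, and multiplication maps in coordinates\<close>

lemma span_image_finite:
  assumes "w \<in> fs.span (g ` A)" "finite A"
  shows "\<exists>c. w = (\<Sum>a\<in>A. fscale (c a) (g a))"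
  using assms(1)
proof (induction rule: fs.span_induct_alt)
  case base
  show ?case by (intro exI[of _ "\<lambda>_. 0"]) (simp add: fs.scale_zero_left del: zero_fun_apply)
next
  case (step k b y)
  then obtain a c where a: "a \<in> A" "b = g a" and c: "y = (\<Sum>a\<in>A. fscale (c a) (g a))" by blast
  have "(\<Sum>l\<in>A - {a}. fscale ((c(a := c a + k)) l) (g l)) = (\<Sum>l\<in>A - {a}. fscale (c l) (g l))"
    by (intro sum.cong) auto
  then have "(\<Sum>l\<in>A. fscale ((c(a := c a + k)) l) (g l)) = fscale (c a + k) (g a) + (\<Sum>l\<in>A - {a}. fscale (c l) (g l))"
    using sum.remove[OF assms(2) a(1), of "\<lambda>l. fscale ((c(a := c a + k)) l) (g l)"]
    by (simp only: fun_upd_same)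
  also have "\<dots> = fscale k b + y"
    using sum.remove[OF assms(2) a(1), of "\<lambda>l. fscale (c l) (g l)"]
    by (simp only: c a(2) fs.scale_left_distrib add_ac)
  finally show ?case by metis
qed

lemma sym_prod_mset:
  assumes "mset us = mset vs" "set vs \<subseteq> V"
  shows "sym_prod s V us = sym_prod s V vs"
proof -
  have "vs \<in> tuples V (length vs)" using assms(2) by (simp add: tuples_def)
  then show ?thesis
    using sym_prod_symmetric[of s V "length vs"] assms(1) unfolding symmetric_on_mset by blast
qed

lemma sym_mult_forms: "\<psi> \<in> sym_forms s V m \<Longrightarrow> \<psi> \<in> mult_forms s V m"
  by (simp add: sym_forms_def mult_forms_def symmetric_on_def)

text \<open>Forms are functions on all lists, but only their values at tuples over V are
  constrained. \<open>comb_pairing\<close> needs this, since the iterated action is computed only at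
  such tuples.\<close>

lemma sym_forms_cong:
  assumes "\<And>vs. vs \<in> tuples V m \<Longrightarrow> f vs = g vs" "g \<in> sym_forms s V m" "module.subspace s V" "vector_space s"
  shows "f \<in> sym_forms s V m"
proof -
  interpret vector_space s by fact
  have V: "a + b \<in> V" "s c a \<in> V" if "a \<in> V" "b \<in> V" for a b c
    using that assms(3) subspace_add subspace_scale by blast+
  show ?thesis
    using assms(2) unfolding sym_forms_def symmetric_on_def multilinear_on_def
    by (simp add: assms(1) tuples_update permute_list_tuples V)
qed

lemma alt_forms_map:
  assumes f: "\<And>a b. a \<in> V \<Longrightarrow> b \<in> V \<Longrightarrow> f (a + b) = f a + f b" "\<And>c a. a \<in> V \<Longrightarrow> f (s c a) = t c (f a)"
    and W: "\<And>a. a \<in> V \<Longrightarrow> f a \<in> W" and \<psi>: "\<psi> \<in> alt_forms t W m"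
  shows "(\<lambda>vs. \<psi> (map f vs)) \<in> alt_forms s V m"
  unfolding alt_forms_def alternating_on_def mem_Collect_eq
proof (intro conjI ballI impI)
  show "multilinear_on s V m (*) (\<lambda>vs. \<psi> (map f vs))"
    by (rule multilinear_on_map[where V=V and f=f and s=s and t=t and W=W and \<psi>=\<psi>])
      (use f W \<psi> in \<open>simp_all only: alt_forms_def alternating_on_def mem_Collect_eq\<close>)
  fix vs assume v: "vs \<in> tuples V m" "\<not> distinct vs"
  then have "map f vs \<in> tuples W m" using W by (auto simp: tuples_def)
  then show "\<psi> (map f vs) = 0"
    using v \<psi> by (simp add: alt_forms_def alternating_on_def distinct_map)
qed

context coords
begin

lemma coords_induct [consumes 1, case_names basis step]:
  assumes v: "v \<in> V" and P: "\<And>i. i \<le> d \<Longrightarrow> P (e i)"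
    and st: "\<And>c v w. v \<in> V \<Longrightarrow> w \<in> V \<Longrightarrow> P v \<Longrightarrow> P w \<Longrightarrow> P (s c v + w)"
  shows "P v"
proof -
  interpret vector_space s by (rule vs)
  have P0: "P 0"
    \<comment> \<open>The zero vector is reached as (-1) e_0 + e_0, so the induction rule needs no
      case for it.\<close>
    using st[OF e_in e_in P P, of 0 0 "-1"] by simp
  have "P (\<Sum>i\<in>I. s (\<kappa> i v) (e i)) \<and> (\<Sum>i\<in>I. s (\<kappa> i v) (e i)) \<in> V" if "finite I" "I \<subseteq> {..d}" for I
    using that
  proof (induction I)
    case empty then show ?case using P0 subspace_0[OF sub] by simp
  next
    case (insert i I)
    then have i: "e i \<in> V" "P (e i)" using e_in P by auto
    then show ?case
      using insert st subspace_add[OF sub] subspace_scale[OF sub] by simp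
  qed
  from this[of "{..d}"] show ?thesis using expand[OF v] by simp
qed

text \<open>Spanning suffices: where injectivity on these products matters, it is read off from
  their images by \<open>elem_prod_independent\<close>.\<close>

lemma sym_power_span:
  "sym_power s V j = fs.span ((\<lambda>R. sym_prod s V (map e R)) ` indices d j)"
proof
  have "map e R \<in> tuples V j" if "R \<in> indices d j" for R
    using that e_in by (auto simp: indices_def tuples_def)
  then show "fs.span ((\<lambda>R. sym_prod s V (map e R)) ` indices d j) \<subseteq> sym_power s V j"
    unfolding power_spans by (intro fs.span_mono) blast
  have "sym_prod s V ts \<in> fs.span ((\<lambda>R. sym_prod s V (map e R)) ` indices d j)" if t: "ts \<in> tuples V j" for ts
  proof -
    have l: "length ts = j" using t by (simp add: tuples_def)
    have "sym_prod s V ts = (\<Sum>a\<in>exps j d. fscale (cform j a ts) (sym_prod s V (btup e j a)))"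
    proof
      fix \<phi>
      show "sym_prod s V ts \<phi> = (\<Sum>a\<in>exps j d. fscale (cform j a ts) (sym_prod s V (btup e j a))) \<phi>"
      proof (cases "\<phi> \<in> sym_forms s V j")
        case True
        then show ?thesis using form_expand[OF sym_mult_forms[OF True] t] l
          by (simp add: sym_prod_def ev_def sum_fun_apply fscale_def)
      next
        case False
        then show ?thesis using l by (simp add: sym_prod_def ev_def sum_fun_apply fscale_def)
      qed
    qed
    moreover have "sym_prod s V (btup e j a) \<in> (\<lambda>R. sym_prod s V (map e R)) ` indices d j" if a: "a \<in> exps j d" for a
    proof
      let ?R = "sort (map a [0..<j])"
      show "?R \<in> indices d j" using a by (auto simp: indices_def exps_def)
      have "mset (map e ?R) = image_mset e (mset (map a [0..<j]))" by simp
      also have "\<dots> = mset (map e (map a [0..<j]))" by (simp only: mset_map)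
      also have "map e (map a [0..<j]) = btup e j a" by (simp add: btup_def)
      finally show "sym_prod s V (btup e j a) = sym_prod s V (map e ?R)"
        using a e_in by (intro sym_prod_mset) (auto simp: exps_def)
    qed
    ultimately show ?thesis by (simp only:) (intro fs.span_sum fs.span_scale fs.span_base)
  qed
  then show "sym_power s V j \<subseteq> fs.span ((\<lambda>R. sym_prod s V (map e R)) ` indices d j)"
    unfolding power_spans by (intro fs.span_minimal) (auto simp: fs.subspace_span)
qed

end

text \<open>A linear map out of a tensor product under which the indices of basis vectors add. Both
  \<open>sym_mult\<close> and \<open>U_mult\<close> are of this kind, so \<alpha> and the two
  actions share one computation.\<close>

locale coords_mult =
  A: coords sA VA dA eA \<kappa>A + B: coords sB VB dB eB \<kappa>B + C: coords fscale VC dC eC \<kappa>C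
  for sA :: "'k::field \<Rightarrow> 'a::ab_group_add \<Rightarrow> 'a" and VA dA eA \<kappa>A
    and sB :: "'k \<Rightarrow> 'b::ab_group_add \<Rightarrow> 'b" and VB dB eB \<kappa>B
    and VC :: "('c \<Rightarrow> 'k) set" and dC eC \<kappa>C +
  fixes F :: "('a, 'b, 'k) tensor_elem \<Rightarrow> 'c \<Rightarrow> 'k"
  assumes dC: "dC = dA + dB"
    and F_add: "F (z + z') = F z + F z'" and F_scale: "F (fscale c z) = fscale c (F z)"
    and F_e: "i \<le> dA \<Longrightarrow> l \<le> dB \<Longrightarrow> F (tensor sA VA sB VB (eA i) (eB l)) = eC (i + l)"
begin

lemma F_tensor_mem:
  assumes "a \<in> VA" "b \<in> VB"
  shows "F (tensor sA VA sB VB a b) \<in> VC"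
proof -
  have tl: "tensor sA VA sB VB (sA c a + a') b = fscale c (tensor sA VA sB VB a b) + tensor sA VA sB VB a' b"
    if "a \<in> VA" "a' \<in> VA" "b \<in> VB" for a a' b c
  proof -
    interpret a: vector_space sA by (rule A.vs)
    have "sA c a \<in> VA" using that(1) by (rule a.subspace_scale[OF A.sub])
    then show ?thesis using that tensor_bilinear[of sA VA sB VB] unfolding bilinear_on_def by auto
  qed
  have tr: "tensor sA VA sB VB a (sB c b + b') = fscale c (tensor sA VA sB VB a b) + tensor sA VA sB VB a b'"
    if "a \<in> VA" "b \<in> VB" "b' \<in> VB" for a b b' c
  proof -
    interpret b: vector_space sB by (rule B.vs)
    have "sB c b \<in> VB" using that(2) by (rule b.subspace_scale[OF B.sub])
    then show ?thesis using that tensor_bilinear[of sA VA sB VB] unfolding bilinear_on_def by auto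
  qed
  have cl: "fscale c u + v \<in> VC" if "u \<in> VC" "v \<in> VC" for c u v
    using that fs.subspace_add[OF C.sub] fs.subspace_scale[OF C.sub] by blast
  show ?thesis
    using assms(1)
  proof (induction rule: A.coords_induct)
    case (basis i)
    show ?case
      using assms(2)
    proof (induction rule: B.coords_induct)
      case (basis l)
      then show ?case using \<open>i \<le> dA\<close> by (simp add: F_e dC C.e_in)
    next
      case (step c v w)
      then show ?case using A.e_in[OF \<open>i \<le> dA\<close>] by (simp only: tr F_add F_scale cl)
    qed
  next
    case (step c v w)
    then show ?case using assms(2) by (simp only: tl F_add F_scale cl)
  qed
qed

lemma F_mem: "z \<in> tensor_space sA VA sB VB \<Longrightarrow> F z \<in> VC"
  unfolding power_spans
proof (induction rule: fs.span_induct_alt)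
  case base
  have "F (fscale 0 0) = fscale 0 (F 0)" by (rule F_scale)
  then show ?case using fs.subspace_0[OF C.sub] by (simp only: fs.scale_zero_left)
next
  case (step c b y)
  then have "F b \<in> VC" using F_tensor_mem by auto
  then show ?case using step fs.subspace_add[OF C.sub] fs.subspace_scale[OF C.sub] by (simp only: F_add F_scale)
qed

lemma map_F_btup:
  assumes "a \<in> exps m dA" "b \<in> exps m dB"
  shows "map F (map2 (tensor sA VA sB VB) (btup eA m a) (btup eB m b)) = btup eC m (a + b)"
  using assms by (intro nth_equalityI) (auto simp: exps_def F_e)

text \<open>Basis vectors multiply slot by slot with indices added (\<open>map_F_btup\<close>),
  which is the multiplication of monomials; \<open>pairing_mult\<close> extends this to
  polynomials.\<close>

lemma div_product:
  assumes p: "p \<in> sym_polys m dA" and q: "q \<in> sym_polys m dB"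
  shows "div_map fscale VC m F (canon_div sA VA sB VB m
    (tensor fscale (div_power sA VA m) fscale (div_power sB VB m) (A.tens m p) (B.tens m q))) = C.tens m (p * q)"
proof
  fix \<psi>
  show "div_map fscale VC m F (canon_div sA VA sB VB m
    (tensor fscale (div_power sA VA m) fscale (div_power sB VB m) (A.tens m p) (B.tens m q))) \<psi> = C.tens m (p * q) \<psi>"
  proof (cases "\<psi> \<in> mult_forms fscale VC m")
    case True
    let ?\<psi> = "\<lambda>vs. \<psi> (map F vs)"
    have \<psi>: "?\<psi> \<in> mult_forms fscale (tensor_space sA VA sB VB) m"
      unfolding mult_forms_def mem_Collect_eq
      by (rule multilinear_on_map[where W=VC and t=fscale]) (use F_add F_scale F_mem True in \<open>simp_all only: mult_forms_def mem_Collect_eq\<close>)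
    have Ap: "A.tens m p \<in> tensor_power sA VA m" using A.tens_div_power[OF p] by (simp add: div_power_def)
    have "div_map fscale VC m F (canon_div sA VA sB VB m
      (tensor fscale (div_power sA VA m) fscale (div_power sB VB m) (A.tens m p) (B.tens m q))) \<psi> =
      B.tens m q (\<lambda>bs. A.tens m p (\<lambda>as. ?\<psi> (map2 (tensor sA VA sB VB) as bs)))"
      using True by (simp add: div_map_def canon_div_tensor[OF B.sub B.vs \<psi>])
    also have "\<dots> = pairing q (\<lambda>b. A.tens m p (\<lambda>as. ?\<psi> (map2 (tensor sA VA sB VB) as (btup eB m b))))"
      using contract_mult[OF B.sub B.vs Ap \<psi>] by (simp add: B.tens_def)
    also have "\<dots> = pairing q (\<lambda>b. pairing p (\<lambda>a. \<psi> (btup eC m (b + a))))"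
    proof (intro pairing_cong)
      fix b assume "b \<in> supp q"
      then have b: "b \<in> exps m dB" using sym_polys_supp[OF q] by blast
      have "A.tens m p (\<lambda>as. ?\<psi> (map2 (tensor sA VA sB VB) as (btup eB m b))) =
          pairing p (\<lambda>a. ?\<psi> (map2 (tensor sA VA sB VB) (btup eA m a) (btup eB m b)))"
        using pull_left[OF \<psi> B.btup_tuples[OF b]] by (simp add: A.tens_def)
      also have "\<dots> = pairing p (\<lambda>a. \<psi> (btup eC m (b + a)))"
        by (intro pairing_cong) (simp only: map_F_btup[OF sym_polys_supp[OF p] b] add.commute)
      finally show "A.tens m p (\<lambda>as. ?\<psi> (map2 (tensor sA VA sB VB) as (btup eB m b))) =
          pairing p (\<lambda>a. \<psi> (btup eC m (b + a)))" .
    qed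
    also have "\<dots> = C.tens m (p * q) \<psi>" using True by (simp add: C.tens_def pairing_mult mult.commute[of p])
    finally show ?thesis .
  next
    case False then show ?thesis by (simp add: div_map_def C.tens_def)
  qed
qed

text \<open>Symmetry is asked of p only, where it makes the contraction alternating
  (\<open>contract_alt\<close>). The factor q must be allowed to be asymmetric, as the staircase
  monomial is.\<close>

lemma ext_product:
  assumes p: "p \<in> sym_polys m dA" and q: "supp q \<subseteq> exps m dB"
  shows "ext_map fscale VC m F (canon_ext sA VA sB VB m
    (tensor fscale (div_power sA VA m) fscale (ext_power sB VB m) (A.tens m p) (B.wed m q))) = C.wed m (p * q)"
proof
  fix \<psi>
  show "ext_map fscale VC m F (canon_ext sA VA sB VB m
    (tensor fscale (div_power sA VA m) fscale (ext_power sB VB m) (A.tens m p) (B.wed m q))) \<psi> = C.wed m (p * q) \<psi>"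
  proof (cases "\<psi> \<in> alt_forms fscale VC m")
    case True
    let ?\<psi> = "\<lambda>vs. \<psi> (map F vs)"
    have \<psi>: "?\<psi> \<in> alt_forms fscale (tensor_space sA VA sB VB) m"
      by (rule alt_forms_map[where W=VC and t=fscale]) (use F_add F_scale F_mem True in \<open>simp_all only:\<close>)
    have "ext_map fscale VC m F (canon_ext sA VA sB VB m
      (tensor fscale (div_power sA VA m) fscale (ext_power sB VB m) (A.tens m p) (B.wed m q))) \<psi> =
      B.wed m q (\<lambda>bs. A.tens m p (\<lambda>as. ?\<psi> (map2 (tensor sA VA sB VB) as bs)))"
      using True by (simp add: ext_map_def canon_ext_tensor[OF A.sub A.vs B.sub B.vs \<psi>])
    also have "\<dots> = pairing q (\<lambda>b. A.tens m p (\<lambda>as. ?\<psi> (map2 (tensor sA VA sB VB) as (btup eB m b))))"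
      using contract_alt[OF A.sub A.vs B.sub B.vs A.tens_div_power[OF p] \<psi>] by (simp add: B.wed_def)
    also have "\<dots> = pairing q (\<lambda>b. pairing p (\<lambda>a. \<psi> (btup eC m (b + a))))"
    proof (intro pairing_cong)
      fix b assume "b \<in> supp q"
      then have b: "b \<in> exps m dB" using q by blast
      have "A.tens m p (\<lambda>as. ?\<psi> (map2 (tensor sA VA sB VB) as (btup eB m b))) =
          pairing p (\<lambda>a. ?\<psi> (map2 (tensor sA VA sB VB) (btup eA m a) (btup eB m b)))"
        using pull_left[OF alt_mult_forms[OF \<psi>] B.btup_tuples[OF b]] by (simp add: A.tens_def)
      also have "\<dots> = pairing p (\<lambda>a. \<psi> (btup eC m (b + a)))"
        by (intro pairing_cong) (simp only: map_F_btup[OF sym_polys_supp[OF p] b] add.commute)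
      finally show "A.tens m p (\<lambda>as. ?\<psi> (map2 (tensor sA VA sB VB) as (btup eB m b))) =
          pairing p (\<lambda>a. \<psi> (btup eC m (b + a)))" .
    qed
    also have "\<dots> = C.wed m (p * q) \<psi>" using True by (simp add: C.wed_def pairing_mult mult.commute[of p])
    finally show ?thesis .
  next
    case False then show ?thesis by (simp add: ext_map_def C.wed_def)
  qed
qed

end

section \<open>The symmetric powers of a plane\<close>

locale plane =
  fixes s :: "'k::field \<Rightarrow> 'u::ab_group_add \<Rightarrow> 'u" and one x :: 'u
  assumes vsU: "vector_space s" and one_x: "one \<noteq> x"
    and indep: "\<not> module.dependent s {one, x}" and spanU: "module.span s {one, x} = UNIV"
begin

interpretation U: vector_space s by (rule vsU)

definition bU :: "nat \<Rightarrow> 'u" where "bU i = (if i = 0 then one else x)"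

definition lin :: "'u \<Rightarrow> 'k poly" where
  "lin u = [:U.representation {one, x} u one, U.representation {one, x} u x:]"

lemma lin_add: "lin (u + v) = lin u + lin v"
  using U.representation_add[OF indep] spanU by (simp add: lin_def)

lemma lin_scale: "lin (s c u) = smult c (lin u)"
  using U.representation_scale[OF indep] spanU by (simp add: lin_def)

lemma lin_basis: "lin one = 1" "lin x = monom 1 1"
  using one_x U.representation_basis[OF indep] by (simp_all add: lin_def monom_altdef one_pCons)

lemma coords_U: "coords s UNIV 1 bU (\<lambda>i u. coeff (lin u) i)"
proof
  show "U.subspace UNIV" by (simp add: U.subspace_UNIV)
  show "coeff (lin (v + w)) i = coeff (lin v) i + coeff (lin w) i" for i v w by (simp add: lin_add)
  show "coeff (lin (s c v)) i = c * coeff (lin v) i" for i c v by (simp add: lin_scale)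
  show "coeff (lin (bU l)) i = (if i = l then 1 else 0)" if "i \<le> 1" "l \<le> 1" for i l
    using that by (auto simp: bU_def lin_basis le_Suc_eq)
  fix v
  have "(\<Sum>b\<in>{one, x}. s (U.representation {one, x} v b) b) = v"
    by (rule U.sum_representation_eq[OF indep]) (auto simp: spanU)
  then show "v = (\<Sum>i\<le>1. s (coeff (lin v) i) (bU i))"
    using one_x by (simp add: lin_def bU_def)
qed (auto intro: vsU)

text \<open>A product of linear polynomials is multilinear and symmetric in its factors, hence so is
  each of its coefficients. These forms are the coordinates dual to the basis
  \<open>xpow\<close>.\<close>

definition xform :: "nat \<Rightarrow> 'u list \<Rightarrow> 'k" where
  "xform i us = coeff (prod_list (map lin us)) i"

lemma xform_sym: "xform i \<in> sym_forms s UNIV d"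
  unfolding sym_forms_def symmetric_on_mset mem_Collect_eq
proof (intro conjI ballI allI impI)
  have upd: "prod_list (map lin (us[k := u])) = lin u * prod_list (map lin (take k us @ drop (Suc k) us))"
    if "us \<in> tuples UNIV d" "k < d" for us k u
    using that by (simp add: tuples_def upd_conv_take_nth_drop algebra_simps)
  show "multilinear_on s UNIV d (*) (xform i)"
    unfolding multilinear_on_def xform_def by (simp add: upd lin_add lin_scale algebra_simps del: map_append)
  fix us ws :: "'u list" assume "mset ws = mset us"
  then have "mset (map lin ws) = mset (map lin us)" by simp
  then show "xform i ws = xform i us" unfolding xform_def by (metis prod_mset_prod_list)
qed

definition std :: "nat \<Rightarrow> nat \<Rightarrow> 'u list" where
  "std d i = replicate i x @ replicate (d - i) one"

lemma xpow_std: "xpow s one x d i = sym_prod s UNIV (std d i)"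
  by (simp add: xpow_def std_def)

lemma length_std: "i \<le> d \<Longrightarrow> length (std d i) = d"
  by (simp add: std_def)

lemma xform_std: "xform i (std d l) = (if i = l then 1 else 0)"
  by (auto simp: xform_def std_def lin_basis prod_list_replicate monom_power)

lemma mset_std:
  assumes "set us \<subseteq> {one, x}"
  shows "mset us = mset (std (length us) (count_list us x))" "count_list us x \<le> length us"
proof -
  show le: "count_list us x \<le> length us" by (rule count_le_length)
  have "mset us = replicate_mset (count_list us x) x + replicate_mset (length us - count_list us x) one"
    using assms
  proof (induction us)
    case (Cons u us)
    then show ?case using count_le_length[of us x] one_x by (auto simp: Suc_diff_le)
  qed simp
  then show "mset us = mset (std (length us) (count_list us x))" by (simp add: std_def)
qed

text \<open>Both sides are expanded in the basis of U. On a tuple of basis vectors a symmetric form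
  depends only on the number of entries x, and \<open>xform i\<close> is 1 or 0 according to whether
  that number is i.\<close>

lemma sym_form_expand:
  assumes \<phi>: "\<phi> \<in> sym_forms s UNIV d" and l: "length us = d"
  shows "\<phi> us = (\<Sum>i\<le>d. xform i us * \<phi> (std d i))"
proof -
  interpret U1: coords s UNIV 1 bU "\<lambda>i u. coeff (lin u) i" by (rule coords_U)
  let ?n = "\<lambda>a. count_list (btup bU d a) x"
  have us: "us \<in> tuples UNIV d" using l by (simp add: tuples_def)
  have st: "\<psi> (btup bU d a) = \<psi> (std d (?n a))" "?n a \<le> d" if "\<psi> \<in> sym_forms s UNIV d" for \<psi> :: "'u list \<Rightarrow> 'k" and a
  proof -
    have "set (btup bU d a) \<subseteq> {one, x}" by (auto simp: btup_def bU_def)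
    from mset_std[OF this] have m: "mset (btup bU d a) = mset (std d (?n a))" "?n a \<le> d" by simp_all
    then show "?n a \<le> d" by simp
    have "std d (?n a) \<in> tuples UNIV d" using m(2) by (simp add: tuples_def length_std)
    then show "\<psi> (btup bU d a) = \<psi> (std d (?n a))"
      using that m(1) unfolding sym_forms_def symmetric_on_mset by blast
  qed
  have x: "xform i us = (\<Sum>a\<in>exps d 1. U1.cform d a us * (if i = ?n a then 1 else 0))" for i
    using U1.form_expand[OF sym_mult_forms[OF xform_sym[of i d]] us] by (simp add: st[OF xform_sym] xform_std)
  have "(\<Sum>i\<le>d. xform i us * \<phi> (std d i)) =
      (\<Sum>i\<le>d. \<Sum>a\<in>exps d 1. U1.cform d a us * (if i = ?n a then \<phi> (std d i) else 0))"
    unfolding x sum_distrib_right by (intro sum.cong) auto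
  also have "\<dots> = (\<Sum>a\<in>exps d 1. \<Sum>i\<le>d. U1.cform d a us * (if i = ?n a then \<phi> (std d i) else 0))"
    by (rule sum.swap)
  also have "\<dots> = (\<Sum>a\<in>exps d 1. U1.cform d a us * \<phi> (std d (?n a)))"
    using st(2)[OF \<phi>] by (simp add: sum_distrib_left[symmetric] sum.delta)
  also have "\<dots> = \<phi> us"
    using U1.form_expand[OF sym_mult_forms[OF \<phi>] us] by (simp add: st[OF \<phi>])
  finally show ?thesis by simp
qed

lemma xpow_in: "i \<le> d \<Longrightarrow> xpow s one x d i \<in> SymU s d"
  unfolding xpow_std power_spans by (intro fs.span_base imageI) (simp add: tuples_def length_std)

lemma coords_Sym: "coords fscale (SymU s d) d (xpow s one x d) (\<lambda>i w. w (xform i))"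
proof
  show "fs.subspace (SymU s d)" unfolding power_spans by (rule fs.subspace_span)
  show "xpow s one x d i \<in> SymU s d" if "i \<le> d" for i using that by (rule xpow_in)
  show "(v + w) (xform i) = v (xform i) + w (xform i)" for i and v w :: "('u, 'k) power_elem" by simp
  show "fscale c v (xform i) = c * v (xform i)" for c i and v :: "('u, 'k) power_elem" by (simp add: fscale_def)
  show "xpow s one x d l (xform i) = (if i = l then 1 else 0)" if "i \<le> d" "l \<le> d" for i l
    using xform_sym that by (simp add: xpow_std sym_prod_def ev_def length_std xform_std)
  fix v assume "v \<in> SymU s d"
  then have v: "v \<phi> = (\<Sum>i\<le>d. v (xform i) * xpow s one x d i \<phi>)" for \<phi>
    unfolding power_spans
  proof (induction rule: fs.span_induct_alt)
    case base then show ?case by simp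
  next
    case (step c b y)
    then obtain us where us: "length us = d" "b = sym_prod s UNIV us" by (auto simp: tuples_def)
    have X: "xpow s one x d i \<phi> = (if \<phi> \<in> sym_forms s UNIV d then \<phi> (std d i) else 0)" if "i \<le> d" for i
      using that by (simp add: xpow_std sym_prod_def ev_def length_std)
    have "b \<phi> = (\<Sum>i\<le>d. b (xform i) * xpow s one x d i \<phi>)"
    proof (cases "\<phi> \<in> sym_forms s UNIV d")
      case True
      then show ?thesis
        using sym_form_expand[OF True us(1)] us xform_sym
        by (simp add: sym_prod_def ev_def X)
    next
      case False
      then show ?thesis using us by (simp add: sym_prod_def ev_def X)
    qed
    then show ?case using step by (simp add: fscale_def sum_distrib_left algebra_simps sum.distrib)
  qed
  show "v = (\<Sum>i\<le>d. fscale (v (xform i)) (xpow s one x d i))"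
  proof
    fix \<phi>
    show "v \<phi> = (\<Sum>i\<le>d. fscale (v (xform i)) (xpow s one x d i)) \<phi>"
      unfolding sum_fun_apply fscale_def by (rule v)
  qed
qed

lemma mult_Sym:
  "coords_mult fscale (SymU s a) a (xpow s one x a) (\<lambda>i w. w (xform i))
     fscale (SymU s b) b (xpow s one x b) (\<lambda>i w. w (xform i))
     (SymU s (a + b)) (a + b) (xpow s one x (a + b)) (\<lambda>i w. w (xform i)) (sym_mult s a b)"
  unfolding coords_mult_def coords_mult_axioms_def
proof (intro conjI coords_Sym allI impI)
  show "sym_mult s a b (z + z') = sym_mult s a b z + sym_mult s a b z'" for z z'
    by (auto simp: sym_mult_def fun_eq_iff)
  show "sym_mult s a b (fscale c z) = fscale c (sym_mult s a b z)" for c z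
    by (auto simp: sym_mult_def fun_eq_iff fscale_def)
  fix i l assume il: "i \<le> a" "l \<le> b"
  have "mset (std a i @ std b l) = mset (std (a + b) (i + l))"
    by (rule multiset_eqI) (use il one_x in \<open>auto simp: std_def\<close>)
  then show "sym_mult s a b (tensor fscale (SymU s a) fscale (SymU s b) (xpow s one x a i) (xpow s one x b l)) =
      xpow s one x (a + b) (i + l)"
    unfolding xpow_std by (subst sym_mult_formula) (auto simp: length_std il intro: sym_prod_mset)
qed simp

lemma mult_U:
  "coords_mult s UNIV 1 bU (\<lambda>i u. coeff (lin u) i)
     fscale (SymU s d) d (xpow s one x d) (\<lambda>i w. w (xform i))
     (SymU s (Suc d)) (Suc d) (xpow s one x (Suc d)) (\<lambda>i w. w (xform i)) (U_mult s d)"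
  unfolding coords_mult_def coords_mult_axioms_def
proof (intro conjI coords_Sym coords_U allI impI)
  show "U_mult s d (z + z') = U_mult s d z + U_mult s d z'" for z z'
    by (auto simp: U_mult_def fun_eq_iff)
  show "U_mult s d (fscale c z) = fscale c (U_mult s d z)" for c z
    by (auto simp: U_mult_def fun_eq_iff fscale_def)
  fix i l :: nat assume il: "i \<le> 1" "l \<le> d"
  have "mset (bU i # std d l) = mset (std (Suc d) (i + l))"
    using il by (auto simp: bU_def std_def le_Suc_eq Suc_diff_le)
  then show "U_mult s d (tensor s UNIV fscale (SymU s d) (bU i) (xpow s one x d l)) = xpow s one x (Suc d) (i + l)"
    unfolding xpow_std by (subst U_mult_formula) (auto simp: length_std il intro: sym_prod_mset)
qed simp

end

section \<open>The two module structures in polynomial coordinates\<close>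

context plane
begin

text \<open>The degree 1 of U is a parameter of the coordinate maps; keeping it from becoming
  \<open>Suc 0\<close> lets their terms match.\<close>

context
  notes One_nat_def [simp del]
begin

abbreviation "tensU m \<equiv> coords.tens s UNIV bU m"
abbreviation "polU m \<equiv> coords.pol 1 (\<lambda>i u. coeff (lin u) i) m"
abbreviation "tensS d m \<equiv> coords.tens fscale (SymU s d) (xpow s one x d) m"
abbreviation "wedS d m \<equiv> coords.wed fscale (SymU s d) (xpow s one x d) m"
abbreviation "DU m \<equiv> div_power s UNIV m"

lemma polU_sym: "t \<in> DU m \<Longrightarrow> polU m t \<in> sym_polys m 1"
  by (rule coords.pol_sym_polys[OF coords_U])

lemma tensU_polU: "t \<in> DU m \<Longrightarrow> tensU m (polU m t) = t"
  by (rule coords.tens_pol[OF coords_U]) (simp add: div_power_def)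

lemma div_act_tens:
  assumes "t \<in> DU m" "q \<in> sym_polys m d"
  shows "div_act s m d t (tensS d m q) = tensS (Suc d) m (polU m t * q)"
  using coords_mult.div_product[OF mult_U polU_sym[OF assms(1)] assms(2)]
  by (simp add: div_act_def tensU_polU[OF assms(1)])

lemma ext_act_wed:
  assumes "t \<in> DU m" "supp q \<subseteq> exps m d"
  shows "ext_act s m d t (wedS d m q) = wedS (Suc d) m (polU m t * q)"
  using coords_mult.ext_product[OF mult_U polU_sym[OF assms(1)] assms(2)]
  by (simp add: ext_act_def tensU_polU[OF assms(1)])

lemma act_list_div:
  assumes "set ts \<subseteq> DU m" "q \<in> sym_polys m d"
  shows "act_list (div_act s m) d ts (tensS d m q) = tensS (d + length ts) m (prod_list (map (polU m) ts) * q)"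
  using assms
proof (induction ts arbitrary: d q)
  case (Cons t ts)
  then have t: "t \<in> DU m" by simp
  have "polU m t * q \<in> sym_polys m (Suc d)"
    using sym_polys_mult[OF polU_sym[OF t] Cons.prems(2)] by (simp only: plus_1_eq_Suc)
  then show ?case
    using Cons by (simp add: div_act_tens mult_ac)
qed simp

lemma act_list_ext:
  assumes "set ts \<subseteq> DU m" "supp q \<subseteq> exps m d"
  shows "act_list (ext_act s m) d ts (wedS d m q) = wedS (d + length ts) m (prod_list (map (polU m) ts) * q)"
  using assms
proof (induction ts arbitrary: d q)
  case (Cons t ts)
  then have t: "t \<in> DU m" by simp
  have "supp (polU m t * q) \<subseteq> exps m (Suc d)"
    using exps_mult[of "polU m t" m 1 q d, unfolded plus_1_eq_Suc] polU_sym[OF t] Cons.prems(2)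
    by (simp add: sym_polys_def)
  then show ?case
    using Cons by (simp add: ext_act_wed mult_ac)
qed simp

lemma wedge_gen_wed:
  assumes "1 \<le> m"
  shows "wedge_gen s one x m = wedS (m - 1) m (mon (stair m) 1)"
proof -
  have "map (xpow s one x (m - 1)) (rev [0..<m]) = btup (xpow s one x (m - 1)) m (stair m)"
    by (rule nth_equalityI) (auto simp: rev_nth stair_def One_nat_def)
  then show ?thesis by (simp add: wedge_gen_def coords.wedge_btup[OF coords_Sym])
qed

lemma div_gen_tens: "div_gen s m = tensS 0 m 1"
proof -
  have "replicate m (sym_prod s UNIV []) = btup (xpow s one x 0) m 0"
    by (rule nth_equalityI) (simp_all add: xpow_def)
  moreover have "(0 :: nat \<Rightarrow> nat) \<in> exps m 0" by (simp add: exps_def)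
  ultimately show ?thesis
    by (simp add: div_gen_def coords.pure_btup[OF coords_Sym] del: zero_fun_apply flip: single_one)
qed

lemma alpha_tens:
  assumes mn: "1 \<le> m" "m \<le> n" and p: "p \<in> sym_polys m (n - m)"
  shows "alpha s one x n m (tensS (n - m) m p) = wedS (n - 1) m (mon (stair m) 1 * p)"
proof -
  have n: "n - m + (m - 1) = n - 1" using mn by simp
  have "supp (mon (stair m) (1::'k)) \<subseteq> exps m (m - 1)" using stair_exps by simp
  from coords_mult.ext_product[OF mult_Sym p this] show ?thesis
    by (simp add: alpha_def wedge_gen_wed[OF mn(1)] n mult.commute)
qed

abbreviation "elemU m r \<equiv> tensU m (elem_sym m r)"

lemma polU_elemU: "polU m (elemU m r) = elem_sym m r"
  by (rule coords.pol_tens_sym[OF coords_U elem_sym_sym])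

text \<open>The coordinate of index r is the coefficient at \<open>ind {..<r}\<close>; completeness
  of the basis is \<open>sym_polys_1_expand\<close>.\<close>

lemma coords_DU:
  "coords fscale (DU m) m (elemU m) (\<lambda>r t. t (coords.cform (\<lambda>i u. coeff (lin u) i) m (ind {..<r})))"
proof -
  interpret U: coords s UNIV 1 bU "\<lambda>i u. coeff (lin u) i" by (rule coords_U)
  have k: "t (U.cform m (ind {..<r})) = coef (U.pol m t) (ind {..<r})" if "r \<le> m" for r t
  proof -
    have "ind {..<r} \<in> exps m 1" using that by (simp add: exps_def ind_def)
    then show ?thesis by (simp add: U.coef_pol)
  qed
  show ?thesis
  proof
    show "fs.subspace (DU m)" by (rule U.subspace_div_power)
    show "elemU m i \<in> DU m" for i by (intro U.tens_div_power elem_sym_sym)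
    show "(v + w) (U.cform m (ind {..<i})) = v (U.cform m (ind {..<i})) + w (U.cform m (ind {..<i}))"
      for i and v w :: "('u, 'k) power_elem" by simp
    show "fscale c v (U.cform m (ind {..<i})) = c * v (U.cform m (ind {..<i}))"
      for i c and v :: "('u, 'k) power_elem" by (simp add: fscale_def)
    show "elemU m l (U.cform m (ind {..<i})) = (if i = l then 1 else 0)" if "i \<le> m" "l \<le> m" for i l
      using that by (simp add: k polU_elemU coef_elem_sym_initial)
    fix t assume t: "t \<in> DU m"
    have "t = U.tens m (\<Sum>r\<le>m. mon 0 (coef (U.pol m t) (ind {..<r})) * elem_sym m r)"
      using tensU_polU[OF t] sym_polys_1_expand[OF polU_sym[OF t]] by simp
    also have "\<dots> = (\<Sum>r\<le>m. fscale (coef (U.pol m t) (ind {..<r})) (elemU m r))"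
      by (simp only: U.tens_sum U.tens_scale)
    also have "\<dots> = (\<Sum>r\<le>m. fscale (t (U.cform m (ind {..<r}))) (elemU m r))"
      by (intro sum.cong refl) (simp add: k)
    finally show "t = (\<Sum>r\<le>m. fscale (t (U.cform m (ind {..<r}))) (elemU m r))" .
  qed
qed

text \<open>An element of a symmetric power has meaningful values only on symmetric forms, so the
  functions that the star maps feed to it must be recognised as such. Symmetry is commutativity of
  polynomial multiplication.\<close>

lemma sym_form_pairing:
  "(\<lambda>ts. pairing (prod_list (map (polU m) ts) * q) g) \<in> sym_forms fscale (DU m) j"
  unfolding sym_forms_def symmetric_on_mset mem_Collect_eq
proof (intro conjI ballI allI impI)
  interpret U: coords s UNIV 1 bU "\<lambda>i u. coeff (lin u) i" by (rule coords_U)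
  have upd: "prod_list (map (polU m) (ts[k := t])) * q = polU m t * (prod_list (map (polU m) (take k ts @ drop (Suc k) ts)) * q)"
    if "ts \<in> tuples (DU m) j" "k < j" for ts k t
    using that by (simp add: tuples_def upd_conv_take_nth_drop mult_ac)
  show "multilinear_on fscale (DU m) j (*) (\<lambda>ts. pairing (prod_list (map (polU m) ts) * q) g)"
    unfolding multilinear_on_def
    by (simp add: upd U.pol_add U.pol_scale distrib_right pairing_add mult.assoc pairing_scale del: map_append plus_fun_apply)
  fix us ws :: "('u, 'k) power_elem list" assume "mset ws = mset us"
  then have "mset (map (polU m) ws) = mset (map (polU m) us)" by simp
  then have "prod_list (map (polU m) ws) = prod_list (map (polU m) us)" by (metis prod_mset_prod_list)
  then show "pairing (prod_list (map (polU m) ws) * q) g = pairing (prod_list (map (polU m) us) * q) g" by simp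
qed

text \<open>Corresponding combinations, with the same coefficients, in the symmetric power and among
  the polynomials. Acting with the former is multiplication by the latter.\<close>

abbreviation "comb m j c \<equiv> (\<Sum>R\<in>indices m j. fscale (c R) (sym_prod fscale (DU m) (map (elemU m) R)))"
abbreviation "combE m j c \<equiv> (\<Sum>R\<in>indices m j. mon 0 (c R) * elem_prod m R)"

lemma sym_power_comb: "f \<in> sym_power fscale (DU m) j \<longleftrightarrow> (\<exists>c. f = comb m j c)"
proof
  assume "f \<in> sym_power fscale (DU m) j"
  then show "\<exists>c. f = comb m j c"
    unfolding coords.sym_power_span[OF coords_DU] by (rule span_image_finite) simp
next
  assume "\<exists>c. f = comb m j c"
  then obtain c where f: "f = comb m j c" by blast
  show "f \<in> sym_power fscale (DU m) j"
    unfolding coords.sym_power_span[OF coords_DU] f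
    by (intro fs.span_sum fs.span_scale fs.span_base imageI)
qed

lemma comb_pairing:
  assumes "\<And>ts. ts \<in> tuples (DU m) j \<Longrightarrow> h ts = pairing (prod_list (map (polU m) ts) * q) g"
  shows "comb m j c h = pairing (combE m j c * q) g"
proof -
  interpret D: coords fscale "DU m" m "elemU m" "\<lambda>r t. t (coords.cform (\<lambda>i u. coeff (lin u) i) m (ind {..<r}))"
    by (rule coords_DU)
  have h: "h \<in> sym_forms fscale (DU m) j"
    by (rule sym_forms_cong[OF assms sym_form_pairing D.sub D.vs])
  have "sym_prod fscale (DU m) (map (elemU m) R) h = pairing (elem_prod m R * q) g" if R: "R \<in> indices m j" for R
  proof -
    have "map (elemU m) R \<in> tuples (DU m) j"
      using R D.e_in by (auto simp: indices_def tuples_def)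
    then show ?thesis
      using h R by (simp add: sym_prod_def ev_def assms indices_def elem_prod_def polU_elemU o_def)
  qed
  then have "comb m j c h = (\<Sum>R\<in>indices m j. c R * pairing (elem_prod m R * q) g)"
    by (simp add: sum_fun_apply fscale_def)
  also have "\<dots> = pairing (combE m j c * q) g"
    by (simp add: sum_distrib_right pairing_sum mult.assoc pairing_scale)
  finally show ?thesis .
qed

lemma combE_sym: "combE m j c \<in> sym_polys m j"
  using elem_prod_sym by (intro sym_polys_sum sym_polys_scale) (auto simp: indices_def)

lemma div_star_comb: "div_star s m j 0 (comb m j c) (div_gen s m) = tensS j m (combE m j c)"
proof
  fix \<psi>
  interpret S: coords fscale "SymU s j" j "xpow s one x j" "\<lambda>i w. w (xform i)" by (rule coords_Sym)
  show "div_star s m j 0 (comb m j c) (div_gen s m) \<psi> = tensS j m (combE m j c) \<psi>"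
  proof (cases "\<psi> \<in> mult_forms fscale (SymU s j) m")
    case True
    have "comb m j c (\<lambda>ts. act_list (div_act s m) 0 ts (div_gen s m) \<psi>) =
        pairing (combE m j c * 1) (\<lambda>a. \<psi> (btup (xpow s one x j) m a))"
    proof (rule comb_pairing)
      fix ts assume "ts \<in> tuples (DU m) j"
      then have "act_list (div_act s m) 0 ts (div_gen s m) = S.tens m (prod_list (map (polU m) ts) * 1)"
        using act_list_div[OF _ sym_polys_one, of ts m] by (simp add: div_gen_tens tuples_def)
      then show "act_list (div_act s m) 0 ts (div_gen s m) \<psi> =
          pairing (prod_list (map (polU m) ts) * 1) (\<lambda>a. \<psi> (btup (xpow s one x j) m a))"
        using True by (simp add: S.tens_def)
    qed
    then show ?thesis using True by (simp add: div_star_def S.tens_def)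
  qed (simp add: div_star_def S.tens_def)
qed

lemma ext_star_comb:
  assumes "1 \<le> m"
  shows "ext_star s m j (m - 1) (comb m j c) (wedge_gen s one x m) =
    wedS (m - 1 + j) m (combE m j c * mon (stair m) 1)"
proof
  fix \<psi>
  interpret S: coords fscale "SymU s (m - 1 + j)" "m - 1 + j" "xpow s one x (m - 1 + j)" "\<lambda>i w. w (xform i)"
    by (rule coords_Sym)
  show "ext_star s m j (m - 1) (comb m j c) (wedge_gen s one x m) \<psi> = wedS (m - 1 + j) m (combE m j c * mon (stair m) 1) \<psi>"
  proof (cases "\<psi> \<in> alt_forms fscale (SymU s (m - 1 + j)) m")
    case True
    have "comb m j c (\<lambda>ts. act_list (ext_act s m) (m - 1) ts (wedge_gen s one x m) \<psi>) =
        pairing (combE m j c * mon (stair m) 1) (\<lambda>a. \<psi> (btup (xpow s one x (m - 1 + j)) m a))"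
    proof (rule comb_pairing)
      fix ts assume "ts \<in> tuples (DU m) j"
      then have "act_list (ext_act s m) (m - 1) ts (wedge_gen s one x m) = S.wed m (prod_list (map (polU m) ts) * mon (stair m) 1)"
        using act_list_ext[of ts m "mon (stair m) 1" "m - 1"] stair_exps
        by (simp add: wedge_gen_wed[OF assms] tuples_def)
      then show "act_list (ext_act s m) (m - 1) ts (wedge_gen s one x m) \<psi> =
          pairing (prod_list (map (polU m) ts) * mon (stair m) 1) (\<lambda>a. \<psi> (btup (xpow s one x (m - 1 + j)) m a))"
        using True by (simp add: S.wed_def)
    qed
    then show ?thesis using True by (simp add: ext_star_def S.wed_def)
  qed (simp add: ext_star_def S.wed_def)
qed

text \<open>In coordinates the map sends \<open>comb m j c\<close> to the tensor of
  \<open>combE m j c\<close>, so it is bijective because the products of j elementary symmetric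
  polynomials form a basis of \<open>sym_polys m j\<close>.\<close>

lemma div_star_bij:
  "bij_betw (\<lambda>f. div_star s m j 0 f (div_gen s m)) (sym_power fscale (DU m) j) (div_power fscale (SymU s j) m)"
  unfolding bij_betw_def
proof (intro conjI inj_onI set_eqI iffI)
  interpret S: coords fscale "SymU s j" j "xpow s one x j" "\<lambda>i w. w (xform i)" by (rule coords_Sym)
  fix f f' assume "f \<in> sym_power fscale (DU m) j" "f' \<in> sym_power fscale (DU m) j"
    and eq: "div_star s m j 0 f (div_gen s m) = div_star s m j 0 f' (div_gen s m)"
  then obtain c c' where f: "f = comb m j c" "f' = comb m j c'" unfolding sym_power_comb by blast
  have "combE m j c = combE m j c'"
    using eq S.tens_inject[OF combE_sym combE_sym] unfolding f div_star_comb by blast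
  then have "combE m j (\<lambda>R. c R - c' R) = 0"
    by (simp add: single_diff left_diff_distrib sum_subtractf)
  then have "c R = c' R" if "R \<in> indices m j" for R
    using elem_prod_independent[OF _ that, of "\<lambda>R. c R - c' R"] by simp
  then show "f = f'" unfolding f by (intro sum.cong) auto
next
  interpret S: coords fscale "SymU s j" j "xpow s one x j" "\<lambda>i w. w (xform i)" by (rule coords_Sym)
  fix T
  show "T \<in> div_power fscale (SymU s j) m" if "T \<in> (\<lambda>f. div_star s m j 0 f (div_gen s m)) ` sym_power fscale (DU m) j"
  proof -
    obtain c where "T = div_star s m j 0 (comb m j c) (div_gen s m)"
      using \<open>T \<in> _\<close> unfolding sym_power_comb[abs_def] image_iff by (auto simp: sym_power_comb)
    then show ?thesis using S.tens_div_power[OF combE_sym] by (simp only: div_star_comb)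
  qed
  show "T \<in> (\<lambda>f. div_star s m j 0 f (div_gen s m)) ` sym_power fscale (DU m) j"
    if "T \<in> div_power fscale (SymU s j) m"
  proof -
    obtain p where p: "p \<in> sym_polys m j" "T = S.tens m p" using \<open>T \<in> _\<close> unfolding S.div_power_iff by blast
    obtain c where "p = combE m j c" using elem_prod_span[OF p(1)] by blast
    then have "T = div_star s m j 0 (comb m j c) (div_gen s m)" using p(2) by (simp only: div_star_comb)
    then show ?thesis using sym_power_comb by blast
  qed
qed

section \<open>Bijectivity of alpha and the comparison of beta with gamma\<close>

lemma alpha_linear:
  assumes mn: "1 \<le> m" "m \<le> n"
    and T: "T \<in> div_power fscale (SymU s (n - m)) m" "T' \<in> div_power fscale (SymU s (n - m)) m"
  shows "alpha s one x n m (T + T') = alpha s one x n m T + alpha s one x n m T'"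
    and "alpha s one x n m (fscale c T) = fscale c (alpha s one x n m T)"
proof -
  interpret S: coords fscale "SymU s (n - m)" "n - m" "xpow s one x (n - m)" "\<lambda>i w. w (xform i)" by (rule coords_Sym)
  interpret E: coords fscale "SymU s (n - 1)" "n - 1" "xpow s one x (n - 1)" "\<lambda>i w. w (xform i)" by (rule coords_Sym)
  obtain p p' where p: "p \<in> sym_polys m (n - m)" "p' \<in> sym_polys m (n - m)" "T = S.tens m p" "T' = S.tens m p'"
    using T unfolding S.div_power_iff by blast
  have "alpha s one x n m (T + T') = alpha s one x n m (S.tens m (p + p'))"
    by (simp only: p S.tens_add)
  also have "\<dots> = E.wed m (mon (stair m) 1 * p + mon (stair m) 1 * p')"
    by (simp only: alpha_tens[OF mn sym_polys_add[OF p(1,2)]] distrib_left)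
  finally show "alpha s one x n m (T + T') = alpha s one x n m T + alpha s one x n m T'"
    by (simp only: E.wed_add p alpha_tens[OF mn p(1)] alpha_tens[OF mn p(2)])
  have "alpha s one x n m (fscale c T) = alpha s one x n m (S.tens m (mon 0 c * p))"
    by (simp only: p S.tens_scale)
  also have "\<dots> = E.wed m (mon 0 c * (mon (stair m) 1 * p))"
    by (simp only: alpha_tens[OF mn sym_polys_scale[OF p(1)]] mult.left_commute)
  finally show "alpha s one x n m (fscale c T) = fscale c (alpha s one x n m T)"
    by (simp only: E.wed_scale p alpha_tens[OF mn p(1)])
qed

text \<open>Injectivity comes from alternating test forms, surjectivity from
  \<open>wedge_btup_mem\<close> with the image of \<alpha> as the subspace.\<close>

lemma alpha_bij:
  assumes mn: "1 \<le> m" "m \<le> n"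
  shows "bij_betw (alpha s one x n m) (div_power fscale (SymU s (n - m)) m) (ext_power fscale (SymU s (n - 1)) m)"
  unfolding bij_betw_def
proof (intro conjI inj_onI equalityI)
  interpret S: coords fscale "SymU s (n - m)" "n - m" "xpow s one x (n - m)" "\<lambda>i w. w (xform i)" by (rule coords_Sym)
  interpret E: coords fscale "SymU s (n - 1)" "n - 1" "xpow s one x (n - 1)" "\<lambda>i w. w (xform i)" by (rule coords_Sym)
  let ?D = "div_power fscale (SymU s (n - m)) m"
  have n: "n - 1 = n - m + (m - 1)" using mn by simp
  fix T T' assume "T \<in> ?D" "T' \<in> ?D" and eq: "alpha s one x n m T = alpha s one x n m T'"
  then obtain p p' where p: "p \<in> sym_polys m (n - m)" "p' \<in> sym_polys m (n - m)" "T = S.tens m p" "T' = S.tens m p'"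
    unfolding S.div_power_iff by blast
  \<comment> \<open>A nonzero difference is detected by some alternant. Realised as an alternating
    form, it would take different values on the two equal images.\<close>
  have "p - p' = 0"
  proof (rule ccontr)
    assume "p - p' \<noteq> 0"
    then obtain b where b: "b \<in> exps m (n - 1)" "pairing (p - p') (\<lambda>a. alternant m b (a + stair m)) \<noteq> 0"
      using alternant_nonzero[OF sym_polys_diff[OF p(1,2)]] unfolding n by blast
    obtain \<psi> where \<psi>: "\<psi> \<in> alt_forms fscale (SymU s (n - 1)) m"
      "\<forall>c\<in>exps m (n - 1). \<psi> (btup (xpow s one x (n - 1)) m c) = alternant m b c"
      using E.alternant_form[OF b(1)] by blast
    have "pairing r (\<lambda>a. alternant m b (a + stair m)) = E.wed m (mon (stair m) 1 * r) \<psi>"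
      if r: "r \<in> sym_polys m (n - m)" for r
    proof -
      have "stair m + a \<in> exps m (n - 1)" if "a \<in> supp r" for a
        using exps_add[OF stair_exps sym_polys_supp[OF r that]] by (simp add: n add.commute)
      then have "pairing r (\<lambda>a. alternant m b (a + stair m)) = pairing r (\<lambda>a. \<psi> (btup (xpow s one x (n - 1)) m (stair m + a)))"
        using \<psi>(2) by (intro pairing_cong) (simp add: add.commute)
      then show ?thesis using \<psi>(1) by (simp add: E.wed_def pairing_mult)
    qed
    then have "pairing (p - p') (\<lambda>a. alternant m b (a + stair m)) =
        alpha s one x n m T \<psi> - alpha s one x n m T' \<psi>"
      using p by (simp add: pairing_diff alpha_tens[OF mn])
    then show False using eq b(2) by simp
  qed
  then show "T = T'" using p by simp
next
  interpret S: coords fscale "SymU s (n - m)" "n - m" "xpow s one x (n - m)" "\<lambda>i w. w (xform i)" by (rule coords_Sym)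
  interpret E: coords fscale "SymU s (n - 1)" "n - 1" "xpow s one x (n - 1)" "\<lambda>i w. w (xform i)" by (rule coords_Sym)
  let ?D = "div_power fscale (SymU s (n - m)) m"
  have n: "n - 1 = n - m + (m - 1)" using mn by simp
  show "alpha s one x n m ` ?D \<subseteq> ext_power fscale (SymU s (n - 1)) m"
  proof
    fix w assume "w \<in> alpha s one x n m ` ?D"
    then obtain p where p: "p \<in> sym_polys m (n - m)" "w = alpha s one x n m (S.tens m p)"
      unfolding S.div_power_iff[abs_def] by (auto simp: S.div_power_iff)
    have "supp (mon (stair m) 1 * p) \<subseteq> exps m (m - 1 + (n - m))"
      using stair_exps p(1) by (intro exps_mult) (auto simp: sym_polys_def)
    then have "supp (mon (stair m) 1 * p) \<subseteq> exps m (n - 1)" by (simp add: n add.commute)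
    then show "w \<in> ext_power fscale (SymU s (n - 1)) m"
      unfolding p(2) alpha_tens[OF mn p(1)] by (rule E.wed_ext_power)
  qed
  have sub: "fs.subspace (alpha s one x n m ` ?D)"
  proof (rule fs.subspaceI)
    have D: "fs.subspace ?D" by (rule S.subspace_div_power)
    note lin = alpha_linear[OF mn]
    show "v + w \<in> alpha s one x n m ` ?D" if "v \<in> alpha s one x n m ` ?D" "w \<in> alpha s one x n m ` ?D" for v w
      using that lin(1) fs.subspace_add[OF D] by (smt (verit) image_iff)
    show sc: "fscale c v \<in> alpha s one x n m ` ?D" if "v \<in> alpha s one x n m ` ?D" for c v
      using that lin(2) fs.subspace_scale[OF D] by (smt (verit) image_iff)
    have "alpha s one x n m 0 \<in> alpha s one x n m ` ?D" using fs.subspace_0[OF D] by (rule imageI)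
    from sc[OF this, of 0] show "0 \<in> alpha s one x n m ` ?D" by (simp only: fs.scale_zero_left)
  qed
  have "wedge fscale (SymU s (n - 1)) (btup (xpow s one x (n - 1)) m b) \<in> alpha s one x n m ` ?D"
    if "b \<in> exps m (n - 1)" for b
  proof (rule E.wedge_btup_mem[OF n sub _ that])
    fix a assume "a \<in> exps m (n - m)"
    then have o: "orbit_sum m a \<in> sym_polys m (n - m)" by (rule orbit_sum_sym)
    show "E.wed m (mon (stair m) 1 * orbit_sum m a) \<in> alpha s one x n m ` ?D"
      unfolding alpha_tens[OF mn o, symmetric] by (intro imageI S.tens_div_power o)
  qed
  then show "ext_power fscale (SymU s (n - 1)) m \<subseteq> alpha s one x n m ` ?D"
    unfolding E.ext_power_span_btup by (intro fs.span_minimal sub) blast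
qed

lemma alpha_div_star:
  assumes mn: "1 \<le> m" "m \<le> n" and f: "f \<in> sym_power fscale (DU m) (n - m)"
  shows "alpha s one x n m (div_star s m (n - m) 0 f (div_gen s m)) = ext_star s m (n - m) (m - 1) f (wedge_gen s one x m)"
proof -
  obtain c where c: "f = comb m (n - m) c" using f unfolding sym_power_comb by blast
  have n: "m - 1 + (n - m) = n - 1" using mn by simp
  show ?thesis
    unfolding c div_star_comb alpha_tens[OF mn combE_sym] ext_star_comb[OF mn(1)] n
    by (simp only: mult.commute)
qed

lemma alpha_iso_beta_gamma:
  assumes mn: "1 \<le> m" "m \<le> n"
  shows "linear_iso_on fscale (div_power fscale (SymU s (n - m)) m) fscale (ext_power fscale (SymU s (n - 1)) m)
      (alpha s one x n m)"
    and "T \<in> div_power fscale (SymU s (n - m)) m \<Longrightarrow> beta s one x n m (alpha s one x n m T) = gamma s n m T"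
proof -
  show "linear_iso_on fscale (div_power fscale (SymU s (n - m)) m) fscale (ext_power fscale (SymU s (n - 1)) m)
      (alpha s one x n m)"
    using alpha_linear[OF mn] alpha_bij[OF mn] by (simp add: linear_iso_on_def del: plus_fun_apply)
  let ?S = "sym_power fscale (DU m) (n - m)"
  let ?F = "\<lambda>f. div_star s m (n - m) 0 f (div_gen s m)"
  let ?G = "\<lambda>f. ext_star s m (n - m) (m - 1) f (wedge_gen s one x m)"
  have F: "bij_betw ?F ?S (div_power fscale (SymU s (n - m)) m)" by (rule div_star_bij)
  \<comment> \<open>The map inverted by \<beta> agrees on \<open>?S\<close> with \<alpha> after the
    map inverted by \<gamma>. Its injectivity is all that \<open>inv_into\<close> requires
    here.\<close>
  have "inj_on (alpha s one x n m \<circ> ?F) ?S"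
    using F alpha_bij[OF mn] unfolding bij_betw_def by (metis comp_inj_on)
  then have G: "inj_on ?G ?S"
    using alpha_div_star[OF mn] by (simp add: inj_on_def)
  assume T: "T \<in> div_power fscale (SymU s (n - m)) m"
  have "T \<in> ?F ` ?S" using T bij_betw_imp_surj_on[OF F] by simp
  then have g: "gamma s n m T \<in> ?S" "?F (gamma s n m T) = T"
    unfolding gamma_def by (rule inv_into_into, rule f_inv_into_f[of T ?F ?S])
  have "alpha s one x n m T = ?G (gamma s n m T)"
    using alpha_div_star[OF mn g(1)] g(2) by simp
  then show "beta s one x n m (alpha s one x n m T) = gamma s n m T"
    unfolding beta_def using inv_into_f_f[OF G g(1)] by simp
qed

end

end

theorem theorem2p9:
  fixes s :: "'k::field \<Rightarrow> 'u::ab_group_add \<Rightarrow> 'u"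
    and one x :: 'u
    and n m :: nat
  assumes "vector_space s"
    and "one \<noteq> x"
    and "\<not> module.dependent s {one, x}"
    and "module.span s {one, x} = UNIV"
    and "1 \<le> m"
    and "m \<le> n"
  shows "linear_iso_on fscale (div_power fscale (SymU s (n - m)) m)
                       fscale (ext_power fscale (SymU s (n - 1)) m)
                       (alpha s one x n m) \<and>
         (\<forall>T \<in> div_power fscale (SymU s (n - m)) m. beta s one x n m (alpha s one x n m T) = gamma s n m T)"
proof -
  interpret plane s one x using assms by (simp add: plane_def)
  show ?thesis using alpha_iso_beta_gamma[OF assms(5,6)] by blast
qed

end
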